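(* Let $G$ be a finite group acting linearly on $\mathbb{R}^d$ by permutations of coordinates, and let $X\subset\mathbb{R}^d$ be an $\mathcal{AS}$-set which is globally stabilized by this action and whose Zariski closure in $\mathbb{R}^d$ is compact (i.e. $X$ is a $G$-$\mathcal{AS}$-set in its affine realization). Let $p_1,\dots,p_m$ be generators of the $\mathbb{R}$-algebra $\mathbb{R}[x_1,\dots,x_d]^G$ and $\pi=(p_1,\dots,p_m):\mathbb{R}^d\to\mathbb{R}^m$ the corresponding geometric quotient map. Suppose that the action of $G$ on the $\mathcal{AS}$-closure $\overline{X}^{\mathcal{AS}}$ of $X$ is free. Then $\pi(X)$ is an $\mathcal{AS}$-set of $\mathbb{P}^m(\mathbb{R})$ contained in $\mathbb{R}^m$.
   Context: A semialgebraic set $A\subset\mathbb{P}^d(\mathbb{R})$ is arc-symmetric if for every real analytic arc $\gamma:(-1,1)\to\mathbb{P}^d(\mathbb{R})$, $\gamma((-1,0))\subset A$ implies $\gamma((-1,1))\subset A$. An $\mathcal{AS}$-set of $\mathbb{P}^d(\mathbb{R})$ is a Boolean combination of arc-symmetric sets of $\mathbb{P}^d(\mathbb{R})$; an $\mathcal{AS}$-set of $\mathbb{R}^d$ is an $\mathcal{AS}$-set of $\mathbb{P}^d(\mathbb{R})$ contained in $\mathbb{R}^d$, where $\mathbb{R}^d\subset\mathbb{P}^d(\mathbb{R})$ is the standard embedding. $\overline{X}^{\mathcal{AS}}$ is the smallest arc-symmetric set of $\mathbb{P}^d(\mathbb{R})$ containing $X$; here it is contained in the (compact) Zariski closure of $X$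 in $\mathbb{R}^d$ and is $G$-stable. In the paper a $G$-$\mathcal{AS}$-set is an $\mathcal{AS}$-set of a projective space with an action of $G$ by biregular isomorphisms on its projective Zariski closure, stabilizing it; every $G$-$\mathcal{AS}$-set is equivariantly biregularly isomorphic to one in the affine realization described in the claim, and the quotient is always taken in such a realization. *)

theory Defs
  imports "HOL-Analysis.Analysis" "HOL-Algebra.Group_Action"
begin

inductive_set boolean_combinations :: "'a set set \<Rightarrow> 'a set set"
  for F :: "'a set set"
where
  base: "A \<in> F \<Longrightarrow> A \<in> boolean_combinations F"
| Compl: "A \<in> boolean_combinations F \<Longrightarrow> - A \<in> boolean_combinations F"
| Un: "\<lbrakk>A \<in> boolean_combinations F; B \<in> boolean_combinations F\<rbrakk>
    \<Longrightarrow> A \<union> B \<in> boolean_combinations F"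

text \<open>
  Throughout, the polynomial ring in the coordinates of \<^typ>\<open>real^'n\<close> is identified with the ring
  of polynomial functions on \<^typ>\<open>real^'n\<close>, which is faithful because the reals are infinite.
\<close>

definition semialgebraic :: "(real^'n::finite) set \<Rightarrow> bool" where
  "semialgebraic A \<longleftrightarrow> A \<in> boolean_combinations {{x. f x > 0} | f. real_polynomial_function f}"

definition zariski_closure :: "(real^'n::finite) set \<Rightarrow> (real^'n) set" where
  "zariski_closure X =
    {x. \<forall>f. real_polynomial_function f \<and> (\<forall>y\<in>X. f y = 0) \<longrightarrow> f x = 0}"

definition real_analytic_at :: "(real \<Rightarrow> 'a::real_normed_vector) \<Rightarrow> real \<Rightarrow> bool" where
  "real_analytic_at f t \<longleftrightarrow>
    (\<exists>r>0. \<exists>a. \<forall>s. \<bar>s - t\<bar> < r \<longrightarrow> (\<lambda>n. (s - t) ^ n *\<^sub>R a n) sums f s)"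

text \<open>
  The index type \<open>'n\<close> labels the homogeneous coordinates, so \<open>'n projective_space\<close> has dimension
  \<^term>\<open>CARD('n) - 1\<close>, and the projective space compactifying \<^typ>\<open>real^'d\<close> is
  \<open>'d option projective_space\<close>.  The quotient is partial: \<open>proj_class 0\<close> has no meaning.
\<close>

definition proportional :: "real^'n::finite \<Rightarrow> real^'n \<Rightarrow> bool" where
  "proportional v w \<longleftrightarrow> v \<noteq> 0 \<and> w \<noteq> 0 \<and> (\<exists>c. w = c *\<^sub>R v)"

quotient_type 'n projective_space = "real^'n::finite" / partial: proportional
  morphisms rep_proj proj_class
proof (rule part_equivpI)
  show "\<exists>v::real^'n. proportional v v"
    by (rule exI[of _ "1"]) (auto simp: proportional_def vec_eq_iff intro: exI[of _ 1])
  show "symp (proportional :: real^'n \<Rightarrow> _)"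
  proof (rule sympI)
    fix v w :: "real^'n"
    assume "proportional v w"
    then obtain c where c: "v \<noteq> 0" "w \<noteq> 0" "w = c *\<^sub>R v"
      unfolding proportional_def by blast
    then have "v = inverse c *\<^sub>R w" by auto
    with c show "proportional w v" unfolding proportional_def by blast
  qed
  show "transp (proportional :: real^'n \<Rightarrow> _)"
    unfolding proportional_def by (rule transpI) (metis scaleR_scaleR)
qed

text \<open>
  The standard affine chart on the set where the \<open>i\<close>-th homogeneous coordinate does not vanish is
  realised as the affine hyperplane of vectors with \<open>v $ i = 1\<close>: its remaining coordinates are the
  affine coordinates.  Semialgebraicity and analyticity are read off in these charts.
\<close>

definition semialgebraic_proj :: "('n::finite) projective_space set \<Rightarrow> bool" where
  "semialgebraic_proj A \<longleftrightarrow> (\<forall>i. semialgebraic {v. v $ i = 1 \<and> proj_class v \<in> A})"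

text \<open>Arcs are total functions; their values outside the interval from -1 to 1 play no role.\<close>

definition real_analytic_arc :: "(real \<Rightarrow> ('n::finite) projective_space) \<Rightarrow> bool" where
  "real_analytic_arc \<gamma> \<longleftrightarrow>
    (\<forall>t\<in>{-1<..<1}. \<exists>i v. real_analytic_at v t \<and>
      (\<forall>\<^sub>F s in nhds t. v s $ i = 1 \<and> \<gamma> s = proj_class (v s)))"

definition arc_symmetric :: "('n::finite) projective_space set \<Rightarrow> bool" where
  "arc_symmetric A \<longleftrightarrow> semialgebraic_proj A \<and>
    (\<forall>\<gamma>. real_analytic_arc \<gamma> \<and> \<gamma> ` {-1<..<0} \<subseteq> A \<longrightarrow> \<gamma> ` {-1<..<1} \<subseteq> A)"

definition AS_set :: "('n::finite) projective_space set \<Rightarrow> bool" where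
  "AS_set A \<longleftrightarrow> A \<in> boolean_combinations (Collect arc_symmetric)"

text \<open>
  The smallest arc-symmetric set containing \<open>A\<close>, written as the intersection of all of them; it
  is itself arc-symmetric because arc-symmetric sets are the closed sets of a Noetherian topology.
\<close>

definition AS_closure :: "('n::finite) projective_space set \<Rightarrow> 'n projective_space set" where
  "AS_closure A = arc_symmetric hull A"

definition affine_embed :: "real^'d::finite \<Rightarrow> ('d option) projective_space" where
  "affine_embed x = proj_class (\<chi> j. case j of None \<Rightarrow> 1 | Some i \<Rightarrow> x $ i)"

definition AS_set_affine :: "(real^'d::finite) set \<Rightarrow> bool" where
  "AS_set_affine X \<longleftrightarrow> AS_set (affine_embed ` X)"

text \<open>
  The inverse makes this a left action on vectors, given a left action \<open>\<sigma>\<close> of \<open>G\<close> on the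
  coordinate indices: the \<open>i\<close>-th basis vector is sent to the \<open>\<sigma> g i\<close>-th one.
\<close>

definition perm_action ::
  "('g, 'b) monoid_scheme \<Rightarrow> ('g \<Rightarrow> 'd \<Rightarrow> 'd) \<Rightarrow> 'g \<Rightarrow> real^'d::finite \<Rightarrow> real^'d" where
  "perm_action G \<sigma> g x = (\<chi> i. x $ \<sigma> (inv\<^bsub>G\<^esub> g) i)"

definition free_on ::
  "('g, 'b) monoid_scheme \<Rightarrow> ('g \<Rightarrow> 'a \<Rightarrow> 'a) \<Rightarrow> 'a set \<Rightarrow> bool" where
  "free_on G \<phi> S \<longleftrightarrow> (\<forall>x\<in>S. stabilizer G \<phi> x = {\<one>\<^bsub>G\<^esub>})"

definition invariant_polynomials ::
  "('g, 'b) monoid_scheme \<Rightarrow> ('g \<Rightarrow> real^'d \<Rightarrow> real^'d) \<Rightarrow> (real^'d::finite \<Rightarrow> real) set" where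
  "invariant_polynomials G \<phi> =
    {f. real_polynomial_function f \<and> (\<forall>g\<in>carrier G. \<forall>x. f (\<phi> g x) = f x)}"

inductive_set generated_subalgebra :: "('a \<Rightarrow> real) set \<Rightarrow> ('a \<Rightarrow> real) set"
  for S :: "('a \<Rightarrow> real) set"
where
  gen: "f \<in> S \<Longrightarrow> f \<in> generated_subalgebra S"
| const: "(\<lambda>x. c) \<in> generated_subalgebra S"
| add: "\<lbrakk>f \<in> generated_subalgebra S; h \<in> generated_subalgebra S\<rbrakk>
    \<Longrightarrow> (\<lambda>x. f x + h x) \<in> generated_subalgebra S"
| mult: "\<lbrakk>f \<in> generated_subalgebra S; h \<in> generated_subalgebra S\<rbrakk>
    \<Longrightarrow> (\<lambda>x. f x * h x) \<in> generated_subalgebra S"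

end

theory Submission
  imports Defs "HOL-Complex_Analysis.Complex_Analysis" "HOL-Computational_Algebra.Fundamental_Theorem_Algebra"
begin

text \<open>
  At the centre of the proof stands a local, affine form of arc-symmetry. Call a semialgebraic
  subset of affine space locally arc-symmetric (\<open>loc_arc_sym\<close>) if the germ at 0 of
  an analytic curve that lies in the set for small negative parameters lies in it for all small
  parameters. The affine part of an arc-symmetric set of projective space has this property
  (\<open>loc_arc_sym_affine_part\<close>). Conversely a bounded set with this property is
  arc-symmetric in projective space (\<open>arc_symmetric_affine_embed\<close>), because an
  analytic arc cannot run from a bounded set into the hyperplane at infinity.

  Locally arc-symmetric sets are closed (\<open>loc_arc_sym_closed\<close>): a point of the
  closure is reached by an analytic half-branch inside the set, and the half-branch is continued
  up to its end point. This is curve selection (\<open>curve_selection\<close>), which follows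
  from the Tarski-Seidenberg theorem (\<open>semialgebraic_project\<close>) and the Puiseux
  parametrisation of roots (\<open>puiseux_roots\<close>). Both rest on Euclidean division of
  polynomials in one variable over a field of functions, namely of rational functions and of
  meromorphic germs.

  Closedness provides a good neighbour of \<open>X\<close> (\<open>exists_free_hull\<close>).
  The AS-closure of \<open>X\<close> is an intersection of possibly infinitely many
  arc-symmetric sets, and it contains no point fixed by a nontrivial element of
  \<open>G\<close>. The points of the compact Zariski closure fixed by some nontrivial element
  form a compact set, so finitely many of those arc-symmetric sets already avoid it.
  Intersecting them with the Zariski closure, which is the zero set of one polynomial by
  Hilbert's basis theorem (\<open>zariski_closure_one_equation\<close>), and with the translates
  under \<open>G\<close>, gives a locally arc-symmetric, bounded and stable set \<open>C\<close>
  around \<open>X\<close> on which \<open>G\<close> acts freely.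

  The quotient map \<open>\<pi>\<close> (\<open>quot\<close> below) sends stable, bounded,
  locally arc-symmetric subsets \<open>B\<close> of \<open>C\<close> to locally arc-symmetric
  sets (\<open>loc_arc_sym_quot_image\<close>), since analytic curves can be lifted
  (\<open>local_lift\<close>). Let the curve \<open>y\<close> lie in \<open>\<pi>(B)\<close> for
  negative parameters. By compactness \<open>y(0) = \<pi>(x0)\<close> with \<open>x0\<close> in
  \<open>B\<close>. Let \<open>l\<close> be the squared distance to \<open>x0\<close>. The
  polynomial in \<open>T\<close> that is the product of the \<open>T - l(gx)\<close> over
  \<open>g\<close> has invariant coefficients, so along \<open>y\<close> its coefficients are
  analytic in the parameter. At the parameter 0 it has the root 0, and this root is simple
  because the action is free; hence it continues to an analytic root. The point of the fibre on
  which \<open>l\<close> takes the value of this root is recovered by Lagrange interpolation, so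
  it depends analytically on the parameter. The lifted curve stays in \<open>B\<close>, and by
  the identity theorem it remains a lift of \<open>y\<close>.

  Images under \<open>\<pi>\<close> respect unions, and differences as soon as the subtracted
  set is stable, but not all Boolean operations. This dictates how \<open>X\<close> has to be
  decomposed (\<open>AS_set_affine_quot\<close>). \<open>X\<close> is a Boolean combination of
  finitely many locally arc-symmetric sets \<open>A\<close>; let the type of \<open>x\<close> be
  the set of pairs \<open>(A, g)\<close> with \<open>gx\<close> in \<open>A\<close>. Whether a
  point belongs to \<open>X\<close> depends only on its type, and all points of an orbit have
  types of the same size. For a set \<open>S\<close> of pairs let \<open>E(S)\<close> be the
  union of the orbits of the points of \<open>C\<close> whose type contains \<open>S\<close>; it
  is stable and locally arc-symmetric. Removing from \<open>E(S)\<close> all \<open>E(T)\<close>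
  with \<open>T\<close> larger than \<open>S\<close> leaves the orbits of the points of type
  exactly \<open>S\<close>. Thus \<open>X\<close> is a finite union of such differences, and
  \<open>\<pi>(X)\<close> is the corresponding Boolean combination of the arc-symmetric sets
  \<open>\<pi>(E(S))\<close>.
\<close>

section \<open>Sign patterns of real polynomials\<close>

lemma poly_sgn_eq_if_no_root:
  fixes p :: "real poly"
  assumes "a \<le> b" "\<And>x. a \<le> x \<Longrightarrow> x \<le> b \<Longrightarrow> poly p x \<noteq> 0"
  shows "sgn (poly p a) = sgn (poly p b)"
proof (cases "a = b")
  case False
  with assms have "a < b" by simp
  show ?thesis
  proof (rule ccontr)
    assume neq: "sgn (poly p a) \<noteq> sgn (poly p b)"
    have "poly p a \<noteq> 0" "poly p b \<noteq> 0" using assms by auto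
    with neq have "poly p a < 0 \<and> 0 < poly p b \<or> 0 < poly p a \<and> poly p b < 0"
      by (auto simp: sgn_if split: if_splits)
    then show False
      using poly_IVT_pos[OF \<open>a < b\<close>, of p] poly_IVT_neg[OF \<open>a < b\<close>, of p] assms(2) by force
  qed
qed simp

lemma poly_sgn_eq_if_no_root_between:
  fixes p :: "real poly"
  assumes "\<And>x. min a b \<le> x \<Longrightarrow> x \<le> max a b \<Longrightarrow> poly p x \<noteq> 0"
  shows "sgn (poly p a) = sgn (poly p b)"
proof (cases "a \<le> b")
  case True
  then show ?thesis using poly_sgn_eq_if_no_root[of a b p] assms by simp
next
  case False
  then show ?thesis using poly_sgn_eq_if_no_root[of b a p] assms by simp
qed

text \<open>Far to the right both signs are those of the leading coefficients, which agree.\<close>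

lemma sgn_poly_eq_sgn_pderiv_right:
  fixes p :: "real poly"
  assumes "pderiv p \<noteq> 0"
    and "\<And>x. R \<le> x \<Longrightarrow> poly p x \<noteq> 0" "\<And>x. R \<le> x \<Longrightarrow> poly (pderiv p) x \<noteq> 0"
  shows "sgn (poly p R) = sgn (poly (pderiv p) R)"
proof -
  have large: "\<exists>n. \<forall>x\<ge>n. sgn (poly q x) = sgn (lead_coeff q)" if "q \<noteq> 0" for q :: "real poly"
  proof (cases "lead_coeff q > 0")
    case True
    with poly_pinfty_gt_lc[OF True] show ?thesis
      by (metis less_le_trans sgn_1_pos)
  next
    case False
    with that have *: "lead_coeff (-q) > 0"
      by (simp add: linorder_not_less less_le)
    then obtain n where "\<forall>x\<ge>n. lead_coeff (-q) \<le> poly (-q) x"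
      using poly_pinfty_gt_lc[OF *] by blast
    with * show ?thesis
      by (intro exI[of _ n]) (auto simp: sgn_if)
  qed
  have p0: "p \<noteq> 0" using assms(1) by auto
  obtain n1 where n1: "\<forall>x\<ge>n1. sgn (poly p x) = sgn (lead_coeff p)" using large[OF p0] by blast
  obtain n2 where n2: "\<forall>x\<ge>n2. sgn (poly (pderiv p) x) = sgn (lead_coeff (pderiv p))"
    using large[OF assms(1)] by blast
  define M where "M = max R (max n1 n2)"
  have deg: "degree p > 0" using assms(1) by (simp add: pderiv_eq_0_iff)
  have "lead_coeff (pderiv p) = of_nat (degree p) * lead_coeff p"
    using deg by (simp add: coeff_pderiv degree_pderiv)
  then have lc: "sgn (lead_coeff (pderiv p)) = sgn (lead_coeff p)"
    using deg by (simp add: sgn_mult)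
  have "sgn (poly p R) = sgn (poly p M)"
    by (rule poly_sgn_eq_if_no_root) (use assms in \<open>auto simp: M_def\<close>)
  also have "\<dots> = sgn (poly (pderiv p) M)" using n1 n2 lc by (simp add: M_def)
  also have "\<dots> = sgn (poly (pderiv p) R)"
    by (rule poly_sgn_eq_if_no_root[symmetric]) (use assms in \<open>auto simp: M_def\<close>)
  finally show ?thesis .
qed

lemma sgn_poly_eq_sgn_pderiv_left:
  fixes p :: "real poly"
  assumes "pderiv p \<noteq> 0"
    and "\<And>x. x \<le> L \<Longrightarrow> poly p x \<noteq> 0" "\<And>x. x \<le> L \<Longrightarrow> poly (pderiv p) x \<noteq> 0"
  shows "sgn (poly p L) = - sgn (poly (pderiv p) L)"
proof -
  define q where "q = pcompose p [:0, -1:]"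
  have q: "poly q x = poly p (- x)" for x by (simp add: q_def poly_pcompose)
  have q': "poly (pderiv q) x = - poly (pderiv p) (- x)" for x
    by (simp add: q_def pderiv_pcompose poly_pcompose pderiv_pCons)
  have "sgn (poly q (-L)) = sgn (poly (pderiv q) (-L))"
  proof (rule sgn_poly_eq_sgn_pderiv_right)
    show "pderiv q \<noteq> 0"
      using q' assms(3)[of L] by (metis add.inverse_inverse neg_equal_0_iff_equal order_refl poly_0)
  qed (use assms in \<open>auto simp: q q'\<close>)
  then show ?thesis by (simp add: q q' sgn_minus)
qed

lemma poly_rolle:
  fixes p :: "real poly"
  assumes "a < b" "poly p a = 0" "poly p b = 0"
  shows "\<exists>z. a < z \<and> z < b \<and> poly (pderiv p) z = 0"
  using poly_MVT[OF assms(1), of p] assms by auto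

text \<open>
  Induction on the largest point: to the right of the previous largest point the map already
  constructed is replaced by an affine map of positive slope.
\<close>

lemma extend_strict_mono:
  fixes h :: "real \<Rightarrow> real"
  assumes "finite W" "strict_mono_on W h"
  shows "\<exists>\<psi>. strict_mono \<psi> \<and> surj \<psi> \<and> (\<forall>w\<in>W. \<psi> w = h w)"
  using assms
proof (induction W rule: finite_linorder_max_induct)
  case empty
  show ?case by (rule exI[of _ id]) (auto simp: strict_mono_def)
next
  case (insert b A)
  then obtain \<psi> where \<psi>: "strict_mono \<psi>" "surj \<psi>" "\<forall>w\<in>A. \<psi> w = h w"
    by (meson monotone_on_subset subset_insertI)
  show ?case
  proof (cases "A = {}")
    case True
    show ?thesis
      by (rule exI[of _ "\<lambda>x. x + (h b - b)"])
        (auto simp: True strict_mono_def intro!: surjI[of _ "\<lambda>x. x - (h b - b)"])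
  next
    case False
    define a where "a = Max A"
    have a: "a \<in> A" "\<And>x. x \<in> A \<Longrightarrow> x \<le> a" using False insert by (auto simp: a_def)
    have ab: "a < b" using insert a by auto
    have hab: "h a < h b"
      using insert.prems a ab by (auto simp: strict_mono_on_def)
    define s where "s = (h b - h a) / (b - a)"
    have s: "s > 0" using ab hab by (simp add: s_def)
    define \<theta> where "\<theta> x = (if x \<le> a then \<psi> x else h a + (x - a) * s)" for x
    have \<psi>a: "\<psi> a = h a" using \<psi> a by auto
    have "strict_mono \<theta>"
    proof (rule strict_monoI)
      fix x y :: real assume "x < y"
      consider "y \<le> a" | "x \<le> a" "a < y" | "a < x" by linarith
      then show "\<theta> x < \<theta> y"
      proof cases
        case 1
        with \<open>x < y\<close> \<psi>(1) show ?thesis by (auto simp: \<theta>_def strict_mono_def)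
      next
        case 2
        have "\<psi> x \<le> \<psi> a" using 2 \<psi>(1) by (simp add: strict_mono_less_eq)
        moreover have "(y - a) * s > 0" using 2 s by simp
        ultimately show ?thesis using 2 \<psi>a by (simp add: \<theta>_def)
      next
        case 3
        with \<open>x < y\<close> s show ?thesis by (simp add: \<theta>_def)
      qed
    qed
    moreover have "surj \<theta>"
      unfolding surj_def
    proof
      fix y
      show "\<exists>x. y = \<theta> x"
      proof (cases "y \<le> h a")
        case True
        obtain x where x: "y = \<psi> x" using \<psi>(2) by (meson surjD)
        with True \<psi>a \<psi>(1) have "x \<le> a" by (metis strict_mono_less_eq)
        with x show ?thesis by (auto simp: \<theta>_def)
      next
        case False
        have "y = \<theta> (a + (y - h a) / s)" using False s by (simp add: \<theta>_def divide_simps)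
        then show ?thesis ..
      qed
    qed
    moreover have "\<theta> w = h w" if "w \<in> insert b A" for w
    proof (cases "w = b")
      case True
      then show ?thesis using ab by (simp add: \<theta>_def s_def)
    next
      case False
      then show ?thesis using that a \<psi> by (auto simp: \<theta>_def)
    qed
    ultimately show ?thesis by blast
  qed
qed

text \<open>
  The set \<open>Z\<close> contains the critical points of \<open>f\<close>, so \<open>f\<close>
  is strictly monotone between neighbours in \<open>Z\<close>. A root \<open>w\<close> outside
  \<open>Z\<close> is therefore a sign change between its two neighbours \<open>a\<close> and
  \<open>b\<close>. As \<open>g\<close> has the same signs at \<open>\<phi> a\<close> and
  \<open>\<phi> b\<close>, the intermediate value theorem gives a root of \<open>g\<close> in
  the corresponding gap.
\<close>

lemma matching_root_exists:
  fixes f g :: "real poly"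
  assumes fin: "finite Z" and mono: "strict_mono \<phi>" and sj: "surj \<phi>"
    and crit: "\<And>y. poly (pderiv f) y = 0 \<Longrightarrow> y \<in> Z"
    and sgn: "\<And>z. z \<in> Z \<Longrightarrow> sgn (poly f z) = sgn (poly g (\<phi> z))"
    and LR: "L \<in> Z" "R \<in> Z" "\<And>y. poly f y = 0 \<Longrightarrow> L < y \<and> y < R"
    and w: "poly f w = 0"
  shows "\<exists>v. poly g v = 0 \<and> (\<forall>z\<in>Z. z < w \<longleftrightarrow> \<phi> z < v) \<and> (\<forall>z\<in>Z. w < z \<longleftrightarrow> v < \<phi> z)"
proof (cases "w \<in> Z")
  case True
  have "poly g (\<phi> w) = 0" using sgn[OF True] w by (simp add: sgn_if split: if_splits)
  then show ?thesis using mono by (auto simp: strict_mono_less)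
next
  case False
  define A where "A = {z\<in>Z. z < w}"
  define B where "B = {z\<in>Z. w < z}"
  have "L \<in> A" "R \<in> B" using LR w by (auto simp: A_def B_def)
  moreover have "finite A" "finite B" using fin by (auto simp: A_def B_def)
  ultimately have a: "Max A \<in> A" "\<And>z. z \<in> A \<Longrightarrow> z \<le> Max A" and b: "Min B \<in> B" "\<And>z. z \<in> B \<Longrightarrow> Min B \<le> z"
    by (auto intro: Max_in Min_in)
  define a where "a = Max A"
  define b where "b = Min B"
  have aw: "a < w" "a \<in> Z" and wb: "w < b" "b \<in> Z"
    using a(1) b(1) by (auto simp: a_def b_def A_def B_def)
  have gap: "z \<le> a \<or> b \<le> z" if "z \<in> Z" for z
    using that a(2)[of z] b(2)[of z] False by (cases z w rule: linorder_cases) (auto simp: a_def b_def A_def B_def)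
  obtain c1 where c1: "a < c1" "c1 < w" "poly f w - poly f a = (w - a) * poly (pderiv f) c1"
    using poly_MVT[OF aw(1)] by blast
  obtain c2 where c2: "w < c2" "c2 < b" "poly f b - poly f w = (b - w) * poly (pderiv f) c2"
    using poly_MVT[OF wb(1)] by blast
  have "sgn (poly (pderiv f) c1) = sgn (poly (pderiv f) c2)"
  proof (rule poly_sgn_eq_if_no_root)
    show "c1 \<le> c2" using c1 c2 by linarith
    show "poly (pderiv f) x \<noteq> 0" if "c1 \<le> x" "x \<le> c2" for x
      using crit[of x] gap[of x] that c1 c2 by auto
  qed
  moreover have "poly (pderiv f) c1 \<noteq> 0" using crit[of c1] gap[of c1] c1 c2 by auto
  moreover have "- poly f a = (w - a) * poly (pderiv f) c1" "poly f b = (b - w) * poly (pderiv f) c2"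
    using c1 c2 w by auto
  then have "- sgn (poly f a) = sgn (poly (pderiv f) c1)" "sgn (poly f b) = sgn (poly (pderiv f) c2)"
    using aw wb by (simp_all add: sgn_mult flip: sgn_minus)
  ultimately have "sgn (poly f b) = - sgn (poly f a)" "sgn (poly f b) \<noteq> 0" by (auto simp: sgn_0_0)
  then have *: "sgn (poly g (\<phi> b)) = - sgn (poly g (\<phi> a))" "sgn (poly g (\<phi> b)) \<noteq> 0"
    using sgn aw wb by auto
  have "\<phi> a < \<phi> b" using aw wb mono by (simp add: strict_mono_less)
  then have "\<exists>v. \<phi> a < v \<and> v < \<phi> b \<and> poly g v = 0"
    using poly_IVT_pos[of "\<phi> a" "\<phi> b" g] poly_IVT_neg[of "\<phi> a" "\<phi> b" g] *
    by (auto simp: sgn_if split: if_splits)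
  then obtain v where v: "\<phi> a < v" "v < \<phi> b" "poly g v = 0" by blast
  have "(z < w \<longleftrightarrow> \<phi> z < v) \<and> (w < z \<longleftrightarrow> v < \<phi> z)" if "z \<in> Z" for z
    using gap[OF that]
  proof
    assume "z \<le> a"
    then have "\<phi> z \<le> \<phi> a" using mono by (simp add: strict_mono_less_eq)
    with v aw \<open>z \<le> a\<close> show ?thesis by auto
  next
    assume "b \<le> z"
    then have "\<phi> b \<le> \<phi> z" using mono by (simp add: strict_mono_less_eq)
    with v wb \<open>b \<le> z\<close> show ?thesis by auto
  qed
  with v show ?thesis by blast
qed

text \<open>
  The inductive step of the Cohen-Hoermander method of quantifier elimination. The map
  \<open>\<phi>\<close> matches the signs of the \<open>g j\<close>, one of which is the
  derivative of \<open>f\<close>, with those of the \<open>g2 j\<close>. Together with the signs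
  of \<open>f\<close> at the roots of the \<open>g j\<close>, this fixes the whole sign table of
  \<open>f\<close>: between consecutive roots \<open>f\<close> is monotone, so it has at most
  one root there, and the signs at the two ends decide whether it has one. The map
  \<open>\<phi>\<close> is changed only inside the gaps, so that it also matches the roots of
  \<open>f\<close>. The signs of the constant coefficients matter when \<open>f\<close> is
  constant and its derivative gives no information.
\<close>

lemma sign_pattern_extend:
  fixes f f2 :: "real poly" and g g2 :: "'j \<Rightarrow> real poly"
  assumes J: "finite J" "j0 \<in> J" "g j0 = pderiv f" "g2 j0 = pderiv f2"
    and \<phi>: "strict_mono \<phi>" "surj \<phi>"
    and sg: "\<And>j y. j \<in> J \<Longrightarrow> sgn (poly (g j) y) = sgn (poly (g2 j) (\<phi> y))"
    and sf: "\<And>j y. \<lbrakk>j \<in> J; g j \<noteq> 0; g2 j \<noteq> 0; poly (g j) y = 0; poly (g2 j) (\<phi> y) = 0\<rbrakk>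
               \<Longrightarrow> sgn (poly f y) = sgn (poly f2 (\<phi> y))"
    and sc: "sgn (coeff f 0) = sgn (coeff f2 0)"
  shows "\<exists>\<psi>. strict_mono \<psi> \<and> surj \<psi> \<and> (\<forall>y. sgn (poly f y) = sgn (poly f2 (\<psi> y))) \<and>
           (\<forall>j\<in>J. \<forall>y. sgn (poly (g j) y) = sgn (poly (g2 j) (\<psi> y)))"
proof -
  have zero_iff: "g j = 0 \<longleftrightarrow> g2 j = 0" if "j \<in> J" for j
  proof
    assume "g j = 0"
    then have "poly (g2 j) (\<phi> y) = 0" for y using sg[OF that, of y] by (simp add: sgn_0_0)
    then have "poly (g2 j) y = 0" for y using \<phi>(2) by (metis surjD)
    then show "g2 j = 0" using poly_all_0_iff_0 by blast
  next
    assume "g2 j = 0"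
    then have "poly (g j) y = 0" for y using sg[OF that, of y] by (simp add: sgn_0_0)
    then show "g j = 0" using poly_all_0_iff_0 by blast
  qed
  show ?thesis
  proof (cases "pderiv f = 0")
    case True
    then have "pderiv f2 = 0" using zero_iff[OF J(2)] J by simp
    with True have "degree f = 0" "degree f2 = 0" by (simp_all add: pderiv_eq_0_iff)
    then have "poly f y = coeff f 0" "poly f2 y = coeff f2 0" for y
      by (auto elim!: degree_eq_zeroE)
    with sc \<phi> sg show ?thesis by (intro exI[of _ \<phi>]) auto
  next
    case False
    then have F2: "pderiv f2 \<noteq> 0" using zero_iff[OF J(2)] J by simp
    have f0: "f \<noteq> 0" "f2 \<noteq> 0" using False F2 by auto
    define Z0 where "Z0 = {y. \<exists>j\<in>J. g j \<noteq> 0 \<and> poly (g j) y = 0}"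
    have "Z0 = (\<Union>j\<in>{j\<in>J. g j \<noteq> 0}. {y. poly (g j) y = 0})" by (auto simp: Z0_def)
    then have finZ0: "finite Z0" using J(1) by (auto intro: poly_roots_finite)
    have Z0D: "sgn (poly f z) = sgn (poly f2 (\<phi> z))" if z: "z \<in> Z0" for z
    proof -
      obtain j where j: "j \<in> J" "g j \<noteq> 0" "poly (g j) z = 0" using z by (auto simp: Z0_def)
      have "poly (g2 j) (\<phi> z) = 0" using sg[OF j(1), of z] j by (simp add: sgn_0_0)
      with sf[OF j(1,2) _ j(3)] zero_iff[OF j(1)] j show ?thesis by blast
    qed
    have Z02: "\<exists>z\<in>Z0. y = \<phi> z" if "j \<in> J" "g2 j \<noteq> 0" "poly (g2 j) y = 0" for j y
    proof -
      obtain z where z: "y = \<phi> z" using \<phi>(2) by (metis surjD)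
      have "poly (g j) z = 0" using sg[OF that(1), of z] that z by (simp add: sgn_0_0)
      then show ?thesis using that zero_iff z by (auto simp: Z0_def)
    qed
    have finr: "finite {y. poly f y = 0}" "finite {y. poly f2 y = 0}"
      using f0 by (auto intro: poly_roots_finite)
    \<comment> \<open>Two sentinels beyond all roots reduce the unbounded intervals to bounded ones.\<close>
    obtain L R where LR: "\<And>y. poly f y = 0 \<or> y \<in> Z0 \<Longrightarrow> L < y \<and> y < R"
      "\<And>y. poly f2 y = 0 \<Longrightarrow> \<phi> L < y \<and> y < \<phi> R" and "L < R"
    proof -
      define S where "S = insert 0 ({y. poly f y = 0} \<union> Z0 \<union> \<phi> -` {y. poly f2 y = 0})"
      have "finite (\<phi> -` {y. poly f2 y = 0})"
        using finite_vimageI[OF finr(2)] strict_mono_imp_inj_on[OF \<phi>(1)] by blast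
      then have "finite S" unfolding S_def using finr finZ0 by blast
      then obtain M where M: "\<forall>x\<in>S. \<bar>x\<bar> < M"
        by (metis bounded_iff finite_imp_bounded gt_ex order_le_less_trans real_norm_def)
      show thesis
      proof (rule that[of "-M" M])
        show "- M < y \<and> y < M" if "poly f y = 0 \<or> y \<in> Z0" for y
        proof -
          have "y \<in> S" using that by (auto simp: S_def)
          then have "\<bar>y\<bar> < M" using M by blast
          then show ?thesis by auto
        qed
        show "\<phi> (- M) < y \<and> y < \<phi> M" if y: "poly f2 y = 0" for y
        proof -
          obtain z where z: "y = \<phi> z" using \<phi>(2) by (metis surjD)
          then have "\<bar>z\<bar> < M" using M y by (auto simp: S_def)
          then show ?thesis using z \<phi>(1) by (auto simp: strict_mono_less)
        qed
        have "0 < M" using M by (auto simp: S_def)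
        then show "-M < M" by simp
      qed
    qed
    have dZ: "y \<in> Z0" if "poly (pderiv f) y = 0" for y
      using that J False by (auto simp: Z0_def intro!: bexI[of _ j0])
    have dZ2: "\<exists>z\<in>Z0. y = \<phi> z" if "poly (pderiv f2) y = 0" for y
      using Z02[OF J(2)] that J F2 by auto
    define Z where "Z = Z0 \<union> {L, R}"
    have finZ: "finite Z" using finZ0 by (simp add: Z_def)
    have noroot2: "poly (pderiv f2) y \<noteq> 0" if "y \<le> \<phi> L \<or> \<phi> R \<le> y" for y
    proof
      assume "poly (pderiv f2) y = 0"
      then obtain z where "z \<in> Z0" "y = \<phi> z" using dZ2 by blast
      with LR(1)[of z] have "\<phi> L < y" "y < \<phi> R" using \<phi>(1) by (auto simp: strict_mono_less)
      with that show False by auto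
    qed
    have sL: "sgn (poly f L) = - sgn (poly (pderiv f) L)"
      by (rule sgn_poly_eq_sgn_pderiv_left) (use False LR(1) dZ in force)+
    have sR: "sgn (poly f R) = sgn (poly (pderiv f) R)"
      by (rule sgn_poly_eq_sgn_pderiv_right) (use False LR(1) dZ in force)+
    have sL2: "sgn (poly f2 (\<phi> L)) = - sgn (poly (pderiv f2) (\<phi> L))"
      by (rule sgn_poly_eq_sgn_pderiv_left) (use F2 LR(2) noroot2 in force)+
    have sR2: "sgn (poly f2 (\<phi> R)) = sgn (poly (pderiv f2) (\<phi> R))"
      by (rule sgn_poly_eq_sgn_pderiv_right) (use F2 LR(2) noroot2 in force)+
    have Zs: "sgn (poly f z) = sgn (poly f2 (\<phi> z))" if "z \<in> Z" for z
      using that Z0D sL sR sL2 sR2 sg[OF J(2)] J by (auto simp: Z_def)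
    \<comment> \<open>The root \<open>v\<close> of \<open>f2\<close> takes the same position relative to
      \<open>\<phi>(Z)\<close> as \<open>w\<close> relative to \<open>Z\<close>.\<close>
    define Rel where "Rel w v \<longleftrightarrow> poly f w = 0 \<and> poly f2 v = 0 \<and>
        (\<forall>z\<in>Z. z < w \<longleftrightarrow> \<phi> z < v) \<and> (\<forall>z\<in>Z. w < z \<longleftrightarrow> v < \<phi> z)" for w v
    have ex1: "\<exists>v. Rel w v" if "poly f w = 0" for w
      unfolding Rel_def using matching_root_exists[OF finZ \<phi>, of f f2 L R w] that dZ Zs LR(1)
      by (auto simp: Z_def)
    \<comment> \<open>The roles of \<open>f\<close> and \<open>f2\<close> are exchanged by passing to the
      inverse of \<open>\<phi>\<close>.\<close>
    have ex2: "\<exists>w. Rel w v" if v: "poly f2 v = 0" for v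
    proof -
      define \<phi>' where "\<phi>' = inv_into UNIV \<phi>"
      have inv: "\<phi> (\<phi>' y) = y" "\<phi>' (\<phi> y) = y" for y
        using \<phi> by (auto simp: \<phi>'_def surj_f_inv_f strict_mono_imp_inj_on)
      have less: "\<phi>' x < y \<longleftrightarrow> x < \<phi> y" "y < \<phi>' x \<longleftrightarrow> \<phi> y < x" for x y
        using \<phi>(1) inv by (metis strict_mono_less)+
      have mono': "strict_mono \<phi>'" using less inv by (auto simp: strict_mono_def)
      have surj': "surj \<phi>'" using inv(2) by (metis surjI)
      have "\<exists>w. poly f w = 0 \<and> (\<forall>z\<in>\<phi> ` Z. z < v \<longleftrightarrow> \<phi>' z < w) \<and> (\<forall>z\<in>\<phi> ` Z. v < z \<longleftrightarrow> w < \<phi>' z)"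
      proof (rule matching_root_exists[OF _ mono' surj', of _ f2 f "\<phi> L" "\<phi> R"])
        show "y \<in> \<phi> ` Z" if "poly (pderiv f2) y = 0" for y using dZ2[OF that] by (auto simp: Z_def)
        show "sgn (poly f2 z) = sgn (poly f (\<phi>' z))" if "z \<in> \<phi> ` Z" for z
          using that Zs inv by auto
      qed (use finZ LR(2) v in \<open>auto simp: Z_def\<close>)
      then show ?thesis unfolding Rel_def using v by (auto simp: inv)
    qed
    have mono_rel: "v1 < v2" if lt: "w1 < w2" and r: "Rel w1 v1" "Rel w2 v2" for w1 w2 v1 v2
    proof -
      obtain z where "w1 < z" "z < w2" "poly (pderiv f) z = 0"
        using poly_rolle[OF lt, of f] r by (auto simp: Rel_def)
      with dZ[of z] r show ?thesis by (auto simp: Rel_def Z_def)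
    qed
    have uniq: "v1 = v2" if r: "Rel w v1" "Rel w v2" for w v1 v2
    proof (rule ccontr)
      assume "v1 \<noteq> v2"
      moreover have False if lt: "u1 < u2" and r: "Rel w u1" "Rel w u2" for u1 u2
      proof -
        obtain y where "u1 < y" "y < u2" "poly (pderiv f2) y = 0"
          using poly_rolle[OF lt, of f2] r by (auto simp: Rel_def)
        moreover from this(3) obtain z where "z \<in> Z" "y = \<phi> z" using dZ2[of y] by (auto simp: Z_def)
        ultimately show False using r by (auto simp: Rel_def)
      qed
      ultimately show False using r by (metis linorder_neqE)
    qed
    have relZ: "v = \<phi> w" if "w \<in> Z" "Rel w v" for w v
    proof -
      have "\<not> \<phi> w < v" "\<not> v < \<phi> w" using that unfolding Rel_def by blast+
      then show ?thesis by simp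
    qed
    define W where "W = Z \<union> {y. poly f y = 0}"
    define h where "h w = (if w \<in> Z then \<phi> w else (SOME v. Rel w v))" for w
    have hrel: "Rel w (h w)" if "poly f w = 0" for w
      using someI_ex[OF ex1[OF that]] relZ[of w] by (auto simp: h_def)
    have "strict_mono_on W h"
    proof (rule strict_mono_onI)
      fix r s assume rs: "r \<in> W" "s \<in> W" "r < s"
      have hZ: "h x = \<phi> x" if "x \<in> Z" for x using that by (simp add: h_def)
      consider "r \<in> Z" "s \<in> Z" | "r \<in> Z" "poly f s = 0" | "poly f r = 0" "s \<in> Z"
        | "poly f r = 0" "poly f s = 0" using rs by (auto simp: W_def)
      then show "h r < h s"
      proof cases
        case 1 then show ?thesis using rs \<phi>(1) hZ by (simp add: strict_mono_less)
      next
        case 2 then show ?thesis using rs hrel[of s] hZ by (auto simp: Rel_def)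
      next
        case 3 then show ?thesis using rs hrel[of r] hZ by (auto simp: Rel_def)
      next
        case 4 then show ?thesis using mono_rel[OF rs(3)] hrel by blast
      qed
    qed
    moreover have finW: "finite W" using finZ finr by (simp add: W_def)
    ultimately obtain \<psi> where \<psi>: "strict_mono \<psi>" "surj \<psi>" "\<forall>w\<in>W. \<psi> w = h w"
      using extend_strict_mono by blast
    have \<psi>Z: "\<psi> z = \<phi> z" if "z \<in> Z" for z using that \<psi>(3) by (auto simp: W_def h_def)
    have root2: "poly f2 (\<psi> y) = 0 \<longleftrightarrow> poly f y = 0" for y
    proof
      assume "poly f y = 0"
      then have "Rel y (\<psi> y)" using hrel \<psi>(3) by (auto simp: W_def)
      then show "poly f2 (\<psi> y) = 0" by (simp add: Rel_def)
    next
      assume "poly f2 (\<psi> y) = 0"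
      then obtain w where w: "Rel w (\<psi> y)" using ex2 by blast
      then have fw: "poly f w = 0" by (simp add: Rel_def)
      then have "\<psi> w = \<psi> y" using uniq[OF w hrel[OF fw]] \<psi>(3) by (auto simp: W_def)
      then have "w = y" using \<psi>(1) by (metis strict_mono_eq)
      with fw show "poly f y = 0" by simp
    qed
    \<comment> \<open>Signs are carried along any interval on which neither polynomial vanishes.\<close>
    have transfer: "sgn (poly f y) = sgn (poly f2 (\<psi> y))"
      if z: "z \<in> Z" and nr: "\<And>x. min y z \<le> x \<Longrightarrow> x \<le> max y z \<Longrightarrow> poly f x \<noteq> 0" for y z
    proof -
      have nr2: "poly f2 x \<noteq> 0" if x: "min (\<psi> y) (\<psi> z) \<le> x" "x \<le> max (\<psi> y) (\<psi> z)" for x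
      proof -
        obtain u where u: "x = \<psi> u" using \<psi>(2) by (metis surjD)
        then have "min y z \<le> u" "u \<le> max y z"
          using x \<psi>(1) by (auto simp: min_le_iff_disj le_max_iff_disj strict_mono_less_eq)
        then show ?thesis using nr root2 u by blast
      qed
      have "sgn (poly f y) = sgn (poly f z)"
        using nr by (rule poly_sgn_eq_if_no_root_between)
      also have "\<dots> = sgn (poly f2 (\<psi> z))" using Zs[OF z] \<psi>Z[OF z] by simp
      also have "\<dots> = sgn (poly f2 (\<psi> y))"
        using nr2 by (rule poly_sgn_eq_if_no_root_between[symmetric])
      finally show ?thesis .
    qed
    have "sgn (poly f y) = sgn (poly f2 (\<psi> y))" for y
    proof (cases "poly f y = 0")
      case True
      then show ?thesis using root2[of y] by simp
    next
      case fy: False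
      show ?thesis
      proof (cases "y \<in> Z")
        case True
        then show ?thesis using Zs \<psi>Z by simp
      next
        case yZ: False
        consider "y < L" | "R < y" | "L < y" "y < R" using yZ
          by (metis Un_iff Z_def insertI1 insertI2 linorder_neqE)
        then show ?thesis
        proof cases
          case 1
          show ?thesis by (rule transfer[of L]) (use 1 LR(1) in \<open>force simp: Z_def\<close>)+
        next
          case 2
          show ?thesis by (rule transfer[of R]) (use 2 LR(1) in \<open>force simp: Z_def\<close>)+
        next
          case 3
          define A where "A = {w\<in>W. w < y}"
          define B where "B = {w\<in>W. y < w}"
          have "L \<in> A" "R \<in> B" using 3 by (auto simp: A_def B_def W_def Z_def)
          moreover have "finite A" "finite B" using finW by (auto simp: A_def B_def)
          ultimately have a: "Max A \<in> A" "\<And>z. z \<in> A \<Longrightarrow> z \<le> Max A"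
            and b: "Min B \<in> B" "\<And>z. z \<in> B \<Longrightarrow> Min B \<le> z"
            by (auto intro: Max_in Min_in)
          define a where "a = Max A"
          define b where "b = Min B"
          have ay: "a < y" "a \<in> W" and yb: "y < b" "b \<in> W"
            using a(1) b(1) by (auto simp: a_def b_def A_def B_def)
          have yW: "y \<notin> W" using fy yZ by (auto simp: W_def)
          have gap: "z \<le> a \<or> b \<le> z" if "z \<in> W" for z
            using that a(2)[of z] b(2)[of z] yW
            by (cases z y rule: linorder_cases) (auto simp: a_def b_def A_def B_def)
          have nr: "poly f x \<noteq> 0" if "a < x" "x < b" for x
            using gap[of x] that by (auto simp: W_def)
          \<comment> \<open>By Rolle's theorem the neighbours \<open>a\<close> and \<open>b\<close> of
            \<open>y\<close> in \<open>W\<close> are not both roots of \<open>f\<close>; one that is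
            not a root lies in \<open>Z\<close>, where the signs are known.\<close>
          have "poly f a \<noteq> 0 \<or> poly f b \<noteq> 0"
          proof (rule ccontr)
            assume "\<not> ?thesis"
            then obtain z where "a < z" "z < b" "poly (pderiv f) z = 0"
              using poly_rolle[of a b f] ay yb by auto
            with dZ[of z] gap[of z] show False by (auto simp: W_def Z_def)
          qed
          then show ?thesis
          proof
            assume fa: "poly f a \<noteq> 0"
            then have aZ: "a \<in> Z" using ay by (auto simp: W_def)
            show ?thesis
            proof (rule transfer[OF aZ])
              fix x assume "min y a \<le> x" "x \<le> max y a"
              then have "a \<le> x" "x \<le> y" using ay by auto
              then show "poly f x \<noteq> 0" using nr[of x] fa yb by (cases "x = a") auto
            qed
          next
            assume fb: "poly f b \<noteq> 0"
            then have bZ: "b \<in> Z" using yb by (auto simp: W_def)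
            show ?thesis
            proof (rule transfer[OF bZ])
              fix x assume "min y b \<le> x" "x \<le> max y b"
              then have "y \<le> x" "x \<le> b" using yb by auto
              then show "poly f x \<noteq> 0" using nr[of x] fb ay by (cases "x = b") auto
            qed
          qed
        qed
      qed
    qed
    moreover have "sgn (poly (g j) y) = sgn (poly (g2 j) (\<psi> y))" if j: "j \<in> J" for j y
    proof (cases "g j = 0 \<or> y \<in> Z")
      case True
      then show ?thesis using zero_iff[OF j] sg[OF j] \<psi>Z by auto
    next
      case False
      then have g0: "g2 j \<noteq> 0" and yZ: "y \<notin> Z" using zero_iff[OF j] by auto
      \<comment> \<open>The maps \<open>\<phi>\<close> and \<open>\<psi>\<close> agree on \<open>Z\<close>, so
        \<open>\<phi> y\<close> and \<open>\<psi> y\<close> lie in the same gap of the roots of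
        \<open>g2 j\<close>.\<close>
      have nr: "poly (g2 j) x \<noteq> 0" if x: "min (\<phi> y) (\<psi> y) \<le> x" "x \<le> max (\<phi> y) (\<psi> y)" for x
      proof
        assume "poly (g2 j) x = 0"
        then obtain z where z: "z \<in> Z0" "x = \<phi> z" using Z02[OF j g0] by blast
        then have "z \<in> Z" "x = \<psi> z" using \<psi>Z by (auto simp: Z_def)
        with yZ consider "y < z" | "z < y" by (metis linorder_neqE)
        then show False
        proof cases
          case 1
          then have "\<phi> y < \<phi> z" "\<psi> y < \<psi> z" using \<phi>(1) \<psi>(1) by (auto simp: strict_mono_less)
          with x z \<open>x = \<psi> z\<close> show False by auto
        next
          case 2
          then have "\<phi> z < \<phi> y" "\<psi> z < \<psi> y" using \<phi>(1) \<psi>(1) by (auto simp: strict_mono_less)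
          with x z \<open>x = \<psi> z\<close> show False by auto
        qed
      qed
      have "sgn (poly (g2 j) (\<phi> y)) = sgn (poly (g2 j) (\<psi> y))"
        using nr by (rule poly_sgn_eq_if_no_root_between)
      then show ?thesis using sg[OF j] by simp
    qed
    ultimately show ?thesis using \<psi>(1,2) by blast
  qed
qed

section \<open>Polynomials over fields of functions\<close>

text \<open>
  The inverse of 0 being 0, a set of functions with these closure properties contains the
  indicator function \<open>1 - f * inverse f\<close> of the zero set of each member
  \<open>f\<close>. Case distinctions on vanishing are thus available inside the set, and
  algorithms of polynomial algebra over a field can be run at all parameters \<open>x\<close>
  simultaneously. The two instances used below are the rational functions on affine space and
  the meromorphic germs.
\<close>

locale function_field =
  fixes R :: "('x \<Rightarrow> 'k::field) set"
  assumes const: "(\<lambda>x. c) \<in> R"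
    and add: "f \<in> R \<Longrightarrow> g \<in> R \<Longrightarrow> (\<lambda>x. f x + g x) \<in> R"
    and mult: "f \<in> R \<Longrightarrow> g \<in> R \<Longrightarrow> (\<lambda>x. f x * g x) \<in> R"
    and inverse: "f \<in> R \<Longrightarrow> (\<lambda>x. inverse (f x)) \<in> R"
begin

lemma diff: "f \<in> R \<Longrightarrow> g \<in> R \<Longrightarrow> (\<lambda>x. f x - g x) \<in> R"
  using add[of f "\<lambda>x. -1 * g x"] mult[OF const[of "-1"], of g] by simp

lemma sum: "(\<And>i. i \<in> I \<Longrightarrow> f i \<in> R) \<Longrightarrow> (\<lambda>x. \<Sum>i\<in>I. f i x) \<in> R"
  by (induction I rule: infinite_finite_induct) (auto intro: const add)

lemma prod: "(\<And>i. i \<in> I \<Longrightarrow> f i \<in> R) \<Longrightarrow> (\<lambda>x. \<Prod>i\<in>I. f i x) \<in> R"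
  by (induction I rule: infinite_finite_induct) (auto intro: const mult)

definition decidable :: "('x \<Rightarrow> bool) \<Rightarrow> bool" where
  "decidable P \<longleftrightarrow> (\<lambda>x. if P x then 1 else 0) \<in> R"

lemma if_in:
  assumes "decidable P" "f \<in> R" "g \<in> R"
  shows "(\<lambda>x. if P x then f x else g x) \<in> R"
proof -
  have "(\<lambda>x. (if P x then 1 else 0) * f x + (1 - (if P x then 1 else 0)) * g x) \<in> R"
    using assms unfolding decidable_def by (intro add mult diff const)
  also have "(\<lambda>x. (if P x then 1 else 0) * f x + (1 - (if P x then 1 else 0)) * g x) =
      (\<lambda>x. if P x then f x else g x)" by auto
  finally show ?thesis .
qed

lemma decidable_zero: "f \<in> R \<Longrightarrow> decidable (\<lambda>x. f x = 0)"
proof -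
  assume "f \<in> R"
  then have "(\<lambda>x. 1 - f x * inverse (f x)) \<in> R" by (intro diff const mult inverse)
  also have "(\<lambda>x. 1 - f x * inverse (f x)) = (\<lambda>x. if f x = 0 then 1 else 0)" by auto
  finally show ?thesis by (simp add: decidable_def)
qed

lemma decidable_not:
  assumes "decidable P" shows "decidable (\<lambda>x. \<not> P x)"
proof -
  have "(\<lambda>x. if P x then 0 else 1) \<in> R" using if_in[OF assms const const] .
  also have "(\<lambda>x. if P x then 0 else 1) = (\<lambda>x. if \<not> P x then 1 else 0 :: 'k)" by auto
  finally show ?thesis by (simp add: decidable_def)
qed

lemma decidable_conj:
  assumes "decidable P" "decidable Q" shows "decidable (\<lambda>x. P x \<and> Q x)"
proof -
  have "(\<lambda>x. if P x then if Q x then 1 else 0 else 0) \<in> R"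
    using if_in[OF assms(1) assms(2)[unfolded decidable_def] const] .
  also have "(\<lambda>x. if P x then if Q x then 1 else 0 else 0) = (\<lambda>x. if P x \<and> Q x then 1 else 0 :: 'k)" by auto
  finally show ?thesis by (simp add: decidable_def)
qed

lemma decidable_ball:
  "finite I \<Longrightarrow> (\<And>i. i \<in> I \<Longrightarrow> decidable (P i)) \<Longrightarrow> decidable (\<lambda>x. \<forall>i\<in>I. P i x)"
proof (induction I rule: finite_induct)
  case empty
  then show ?case by (simp add: decidable_def const)
next
  case (insert i I)
  then have "decidable (\<lambda>x. P i x \<and> (\<forall>i\<in>I. P i x))" by (intro decidable_conj) blast+
  then show ?case by simp
qed

text \<open>
  Polynomials with parameters. The common bound on the degrees makes recursion on the degree
  possible for all parameters at once.
\<close>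

definition families :: "('x \<Rightarrow> 'k poly) set" where
  "families = {F. (\<forall>k. (\<lambda>x. coeff (F x) k) \<in> R) \<and> (\<exists>n. \<forall>x. degree (F x) \<le> n)}"

lemma familiesD: "F \<in> families \<Longrightarrow> (\<lambda>x. coeff (F x) k) \<in> R"
  by (simp add: families_def)

lemma familiesI:
  "(\<And>k. (\<lambda>x. coeff (F x) k) \<in> R) \<Longrightarrow> (\<And>x. degree (F x) \<le> n) \<Longrightarrow> F \<in> families"
  by (auto simp: families_def)

lemma families_bound: "F \<in> families \<Longrightarrow> \<exists>n. \<forall>x. degree (F x) \<le> n"
  by (simp add: families_def)

lemma families_const [intro]: "(\<lambda>x. p) \<in> families"
  by (auto simp: families_def const)

lemma families_pCons [intro]:
  assumes "f \<in> R" "F \<in> families" shows "(\<lambda>x. pCons (f x) (F x)) \<in> families"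
proof -
  obtain n where "\<forall>x. degree (F x) \<le> n" using families_bound[OF assms(2)] by blast
  then have "\<forall>x. degree (pCons (f x) (F x)) \<le> Suc n"
    by (metis degree_pCons_le le_trans Suc_le_mono)
  moreover have "(\<lambda>x. coeff (pCons (f x) (F x)) k) \<in> R" for k
    by (cases k) (use assms familiesD in auto)
  ultimately show ?thesis by (intro familiesI) blast+
qed

lemma families_add [intro]:
  assumes "F \<in> families" "G \<in> families" shows "(\<lambda>x. F x + G x) \<in> families"
proof -
  obtain n m where "\<forall>x. degree (F x) \<le> n" "\<forall>x. degree (G x) \<le> m"
    using assms families_bound by meson
  then have "\<forall>x. degree (F x + G x) \<le> max n m"
    by (meson degree_add_le_max le_trans max.mono)
  then show ?thesis using assms by (auto simp: families_def intro: add)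
qed

lemma families_mult [intro]:
  assumes "F \<in> families" "G \<in> families" shows "(\<lambda>x. F x * G x) \<in> families"
proof -
  obtain n m where "\<forall>x. degree (F x) \<le> n" "\<forall>x. degree (G x) \<le> m"
    using assms families_bound by meson
  then have "\<forall>x. degree (F x * G x) \<le> n + m"
    by (meson degree_mult_le le_trans add_mono)
  moreover have "(\<lambda>x. coeff (F x * G x) k) \<in> R" for k
    unfolding coeff_mult by (intro sum mult familiesD assms)
  ultimately show ?thesis by (intro familiesI) blast+
qed

lemma families_diff [intro]:
  "F \<in> families \<Longrightarrow> G \<in> families \<Longrightarrow> (\<lambda>x. F x - G x) \<in> families"
  using families_add[of F "\<lambda>x. [:-1:] * G x"] families_mult[OF families_const[of "[:-1:]"], of G]
  by simp

lemma families_prod: "(\<And>i. i \<in> I \<Longrightarrow> F i \<in> families) \<Longrightarrow> (\<lambda>x. \<Prod>i\<in>I. F i x) \<in> families"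
  by (induction I rule: infinite_finite_induct) auto

lemma families_pderiv [intro]:
  assumes "F \<in> families" shows "(\<lambda>x. pderiv (F x)) \<in> families"
proof -
  obtain n where "\<forall>x. degree (F x) \<le> n" using families_bound[OF assms] by blast
  then have "degree (pderiv (F x)) \<le> n" for x
    by (intro degree_le) (auto simp: coeff_pderiv intro!: coeff_eq_0 le_less_trans[of _ n] less_SucI)
  moreover have "(\<lambda>x. coeff (pderiv (F x)) k) \<in> R" for k
    unfolding coeff_pderiv by (intro mult const familiesD assms)
  ultimately show ?thesis by (intro familiesI)
qed

lemma families_if [intro]:
  assumes "decidable P" "F \<in> families" "G \<in> families"
  shows "(\<lambda>x. if P x then F x else G x) \<in> families"
proof -
  obtain n m where "\<forall>x. degree (F x) \<le> n" "\<forall>x. degree (G x) \<le> m"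
    using assms families_bound by meson
  then have "\<forall>x. degree (if P x then F x else G x) \<le> max n m" by (simp add: le_max_iff_disj)
  moreover have "(\<lambda>x. coeff (if P x then F x else G x) k) \<in> R" for k
    using if_in[OF assms(1) familiesD[OF assms(2)] familiesD[OF assms(3)], of k k]
    by (simp add: if_distrib if_distribR cong: if_cong)
  ultimately show ?thesis by (intro familiesI) blast+
qed

lemma decidable_degree:
  assumes "F \<in> families" shows "decidable (\<lambda>x. P (degree (F x)))"
proof -
  obtain n where n: "\<forall>x. degree (F x) \<le> n" using families_bound[OF assms] by blast
  have le: "decidable (\<lambda>x. degree (F x) \<le> d)" for d
  proof -
    have "degree (F x) \<le> d \<longleftrightarrow> (\<forall>k\<in>{d<..n}. coeff (F x) k = 0)" for x
    proof
      assume *: "\<forall>k\<in>{d<..n}. coeff (F x) k = 0"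
      show "degree (F x) \<le> d"
      proof (rule degree_le, intro allI impI)
        fix i assume "d < i"
        then show "coeff (F x) i = 0"
          using * le_less_trans[of "degree (F x)" n i] n by (cases "i \<le> n") (auto intro: coeff_eq_0)
      qed
    qed (auto intro: coeff_eq_0)
    moreover have "decidable (\<lambda>x. \<forall>k\<in>{d<..n}. coeff (F x) k = 0)"
      by (intro decidable_ball decidable_zero familiesD assms) auto
    ultimately show ?thesis by simp
  qed
  have eq: "decidable (\<lambda>x. degree (F x) = d)" for d
  proof (cases d)
    case 0
    then show ?thesis using le[of 0] by simp
  next
    case (Suc e)
    have "decidable (\<lambda>x. degree (F x) \<le> d \<and> \<not> degree (F x) \<le> e)"
      by (intro decidable_conj decidable_not le)
    moreover have "degree (F x) \<le> d \<and> \<not> degree (F x) \<le> e \<longleftrightarrow> degree (F x) = d" for x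
      using Suc by linarith
    ultimately show ?thesis by simp
  qed
  have "(\<lambda>x. \<Sum>d\<in>{d. d \<le> n \<and> P d}. if degree (F x) = d then 1 else 0) \<in> R"
    by (intro sum) (use eq in \<open>auto simp: decidable_def\<close>)
  also have "(\<lambda>x. \<Sum>d\<in>{d. d \<le> n \<and> P d}. if degree (F x) = d then 1 else 0) =
      (\<lambda>x. if P (degree (F x)) then 1 else 0 :: 'k)" using n by (auto simp: sum.delta)
  finally show ?thesis by (simp add: decidable_def)
qed

lemma decidable_poly_zero:
  assumes "F \<in> families" shows "decidable (\<lambda>x. F x = 0)"
proof -
  have "decidable (\<lambda>x. degree (F x) = 0 \<and> coeff (F x) 0 = 0)"
    by (intro decidable_conj decidable_degree decidable_zero familiesD assms)
  moreover have "degree p = 0 \<and> coeff p 0 = 0 \<longleftrightarrow> p = 0" for p :: "'k poly"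
    by (metis coeff_0 degree_0 leading_coeff_0_iff)
  ultimately show ?thesis by simp
qed

lemma lead_coeff_in:
  assumes "F \<in> families" shows "(\<lambda>x. lead_coeff (F x)) \<in> R"
proof -
  obtain n where n: "\<forall>x. degree (F x) \<le> n" using families_bound[OF assms] by blast
  have "(\<lambda>x. \<Sum>d\<le>n. if degree (F x) = d then coeff (F x) d else 0) \<in> R"
    by (intro sum if_in decidable_degree assms familiesD const)
  also have "(\<lambda>x. \<Sum>d\<le>n. if degree (F x) = d then coeff (F x) d else 0) = (\<lambda>x. lead_coeff (F x))"
    using n by (auto simp: sum.delta)
  finally show ?thesis .
qed

text \<open>
  Long division, by recursion on a bound \<open>n\<close> for the degree of \<open>F x\<close>.
  In each step the coefficient of index \<open>n\<close> is eliminated, whether or not it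
  vanishes at the parameter \<open>x\<close>, provided that \<open>G x\<close> has degree at
  most \<open>n\<close>; this condition is decidable, so quotient and remainder are families
  again.
\<close>

lemma euclidean_division:
  assumes "F \<in> families" "G \<in> families"
  shows "\<exists>Q\<in>families. \<exists>S\<in>families. \<forall>x. G x \<noteq> 0 \<longrightarrow>
           F x = Q x * G x + S x \<and> (S x = 0 \<or> degree (S x) < degree (G x))"
proof -
  have "\<exists>Q\<in>families. \<exists>S\<in>families. \<forall>x. G x \<noteq> 0 \<longrightarrow>
           F x = Q x * G x + S x \<and> (S x = 0 \<or> degree (S x) < degree (G x))"
    if "F \<in> families" "\<forall>x. degree (F x) < n" for F n
    using that
  proof (induction n arbitrary: F)
    case 0
    then show ?case by auto
  next
    case (Suc n)
    define q where "q x = monom (coeff (F x) n * inverse (lead_coeff (G x))) (n - degree (G x))" for x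
    have "q \<in> families"
    proof -
      have "coeff (q x) k = (if n - degree (G x) = k then coeff (F x) n * inverse (lead_coeff (G x)) else 0)"
        for x k by (simp add: q_def coeff_monom)
      moreover have "(\<lambda>x. if n - degree (G x) = k then coeff (F x) n * inverse (lead_coeff (G x)) else 0) \<in> R" for k
        by (intro if_in decidable_degree[OF assms(2), of "\<lambda>d. n - d = k"] const mult familiesD Suc inverse lead_coeff_in assms)
      moreover have "degree (q x) \<le> n" for x
        unfolding q_def by (meson degree_monom_le diff_le_self le_trans)
      ultimately show ?thesis by (auto simp: families_def)
    qed
    define c where "c x \<longleftrightarrow> degree (G x) \<le> n \<and> G x \<noteq> 0" for x
    have c: "decidable c" unfolding c_def
      by (intro decidable_conj decidable_not decidable_degree[OF assms(2), of "\<lambda>d. d \<le> n"] decidable_poly_zero assms)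
    define F' where "F' x = (if c x then F x - q x * G x else 0)" for x
    have F': "F' \<in> families" unfolding F'_def
      by (intro families_if families_diff families_mult families_const \<open>q \<in> families\<close> Suc.prems assms c)
    have deg: "degree (F' x) < n \<or> F' x = 0" for x
    proof (cases "c x")
      case True
      have cf: "coeff (F' x) i = 0" if "i \<ge> n" for i
      proof (cases "i = n")
        case True
        with \<open>c x\<close> show ?thesis
          by (simp add: F'_def q_def c_def coeff_monom_mult)
      next
        case False
        with that have "i > n" by simp
        moreover have "degree (F x) \<le> n" using Suc by (simp add: less_Suc_eq_le)
        moreover have "degree (q x * G x) \<le> n"
        proof -
          have "degree (q x * G x) \<le> degree (q x) + degree (G x)" by (rule degree_mult_le)
          also have "\<dots> \<le> (n - degree (G x)) + degree (G x)"
            unfolding q_def by (intro add_mono degree_monom_le) auto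
          also have "\<dots> = n" using True by (simp add: c_def)
          finally show ?thesis .
        qed
        ultimately show ?thesis using True by (simp add: F'_def coeff_eq_0)
      qed
      show ?thesis
        by (metis cf leading_coeff_0_iff linorder_not_less)
    qed (simp add: F'_def)
    show ?case
    proof (cases n)
      case 0
      then have F'0: "F' x = 0" for x using deg[of x] by simp
      have "\<forall>x. G x \<noteq> 0 \<longrightarrow> F x = (if c x then q x else 0) * G x + (if c x then 0 else F x) \<and>
          ((if c x then 0 else F x) = 0 \<or> degree (if c x then 0 else F x) < degree (G x))"
      proof (intro allI impI)
        fix x assume "G x \<noteq> 0"
        then show "F x = (if c x then q x else 0) * G x + (if c x then 0 else F x) \<and>
          ((if c x then 0 else F x) = 0 \<or> degree (if c x then 0 else F x) < degree (G x))"
          using F'0[of x] Suc.prems(2) 0 by (auto simp: F'_def c_def)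
      qed
      moreover have "(\<lambda>x. if c x then q x else 0) \<in> families" "(\<lambda>x. if c x then 0 else F x) \<in> families"
        by (intro families_if families_const c \<open>q \<in> families\<close> Suc.prems)+
      ultimately show ?thesis by (intro bexI)
    next
      case (Suc m)
      then have "\<forall>x. degree (F' x) < n" using deg by (metis degree_0 zero_less_Suc)
      from Suc.IH[OF F' this] obtain Q S where QS: "Q \<in> families" "S \<in> families"
        "\<forall>x. G x \<noteq> 0 \<longrightarrow> F' x = Q x * G x + S x \<and> (S x = 0 \<or> degree (S x) < degree (G x))"
        by blast
      have "\<forall>x. G x \<noteq> 0 \<longrightarrow> F x = (if c x then q x + Q x else 0) * G x + (if c x then S x else F x) \<and>
          ((if c x then S x else F x) = 0 \<or> degree (if c x then S x else F x) < degree (G x))"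
      proof (intro allI impI)
        fix x assume g: "G x \<noteq> 0"
        show "F x = (if c x then q x + Q x else 0) * G x + (if c x then S x else F x) \<and>
          ((if c x then S x else F x) = 0 \<or> degree (if c x then S x else F x) < degree (G x))"
        proof (cases "c x")
          case True
          then have "F x = q x * G x + F' x" by (simp add: F'_def)
          with True QS(3) g show ?thesis by (auto simp: algebra_simps)
        next
          case False
          then show ?thesis using Suc.prems(2) g unfolding c_def by (auto simp: less_Suc_eq_le intro: le_less_trans)
        qed
      qed
      moreover have "(\<lambda>x. if c x then q x + Q x else 0) \<in> families" "(\<lambda>x. if c x then S x else F x) \<in> families"
        by (intro families_if families_add families_const c \<open>q \<in> families\<close> Suc.prems QS)+
      ultimately show ?thesis by (intro bexI)
    qed
  qed
  moreover obtain n where "\<forall>x. degree (F x) \<le> n" using families_bound assms by blast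
  then have "\<forall>x. degree (F x) < Suc n" by (simp add: less_Suc_eq_le)
  ultimately show ?thesis using assms by blast
qed

end

section \<open>Sign patterns of families of polynomials\<close>

locale real_function_field = function_field R for R :: "('x \<Rightarrow> real) set"
begin

definition same_pattern :: "('x \<Rightarrow> real poly) set \<Rightarrow> 'x \<Rightarrow> 'x \<Rightarrow> bool" where
  "same_pattern \<F> x x' \<longleftrightarrow> (\<exists>\<phi>. strict_mono \<phi> \<and> surj \<phi> \<and>
     (\<forall>F\<in>\<F>. \<forall>y. sgn (poly (F x) y) = sgn (poly (F x') (\<phi> y))))"

definition pattern_determined :: "('x \<Rightarrow> real poly) set \<Rightarrow> bool" where
  "pattern_determined \<F> \<longleftrightarrow> (\<exists>C. finite C \<and> C \<subseteq> R \<and>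
     (\<forall>x x'. (\<forall>c\<in>C. sgn (c x) = sgn (c x')) \<longrightarrow> same_pattern \<F> x x'))"

text \<open>
  At a root of \<open>G x\<close> the polynomial \<open>F x\<close> takes the value of the
  remainder \<open>S G x\<close>. Hence the pattern of the remainders contains the signs of
  \<open>F x\<close> at the roots of the other polynomials, as the extension of a sign pattern
  requires. The constant coefficient of \<open>F\<close> joins the deciding functions for those
  parameters where \<open>F x\<close> is constant.
\<close>

lemma pattern_determined_insert:
  assumes fin: "finite \<S>" and sub: "\<S> \<subseteq> families" and F: "F \<in> families"
    and F': "(\<lambda>x. pderiv (F x)) \<in> \<S>"
    and S: "\<And>G. G \<in> \<S> \<Longrightarrow> \<exists>Q. \<forall>x. G x \<noteq> 0 \<longrightarrow> F x = Q x * G x + S G x"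
    and det: "pattern_determined (\<S> \<union> S ` \<S>)"
  shows "pattern_determined (insert F \<S>)"
proof -
  obtain C where C: "finite C" "C \<subseteq> R"
    "\<And>x x'. (\<forall>c\<in>C. sgn (c x) = sgn (c x')) \<Longrightarrow> same_pattern (\<S> \<union> S ` \<S>) x x'"
    using det unfolding pattern_determined_def by blast
  define C' where "C' = insert (\<lambda>x. coeff (F x) 0) C"
  have "same_pattern (insert F \<S>) x x'" if *: "\<forall>c\<in>C'. sgn (c x) = sgn (c x')" for x x'
  proof -
    obtain \<phi> where \<phi>: "strict_mono \<phi>" "surj \<phi>"
      "\<And>H y. H \<in> \<S> \<union> S ` \<S> \<Longrightarrow> sgn (poly (H x) y) = sgn (poly (H x') (\<phi> y))"
      using C(3)[of x x'] * unfolding same_pattern_def C'_def by blast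
    have "\<exists>\<psi>. strict_mono \<psi> \<and> surj \<psi> \<and> (\<forall>y. sgn (poly (F x) y) = sgn (poly (F x') (\<psi> y))) \<and>
           (\<forall>G\<in>\<S>. \<forall>y. sgn (poly (G x) y) = sgn (poly (G x') (\<psi> y)))"
    proof (rule sign_pattern_extend[where g = "\<lambda>G. G x" and \<phi> = \<phi>, OF fin F'])
      fix G y assume G: "G \<in> \<S>" "G x \<noteq> 0" "G x' \<noteq> 0" "poly (G x) y = 0" "poly (G x') (\<phi> y) = 0"
      obtain Q where "\<forall>x. G x \<noteq> 0 \<longrightarrow> F x = Q x * G x + S G x" using S[OF G(1)] by blast
      then have "poly (F x) y = poly (S G x) y" "poly (F x') (\<phi> y) = poly (S G x') (\<phi> y)"
        using G by auto
      then show "sgn (poly (F x) y) = sgn (poly (F x') (\<phi> y))" using \<phi>(3)[of "S G" y] G by simp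
    qed (use \<phi> * in \<open>auto simp: C'_def\<close>)
    then show ?thesis by (auto simp: same_pattern_def)
  qed
  moreover have "finite C'" "C' \<subseteq> R" using C familiesD[OF F] by (auto simp: C'_def)
  ultimately show ?thesis unfolding pattern_determined_def by blast
qed

lemma pattern_determined_mono: "pattern_determined \<F> \<Longrightarrow> \<G> \<subseteq> \<F> \<Longrightarrow> pattern_determined \<G>"
  unfolding pattern_determined_def same_pattern_def by (meson subset_iff)

text \<open>
  A polynomial of top degree is traded for its derivative and for its remainders modulo the
  other polynomials, which all have smaller degree. The inner induction treats the polynomials
  of degree \<open>Suc n\<close> one after the other, the outer induction lowers the degree.
\<close>

theorem pattern_determined_families:
  assumes "finite \<F>" "\<F> \<subseteq> families"
  shows "pattern_determined \<F>"
proof -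
  have main: "pattern_determined \<F>"
    if "finite \<F>" "\<F> \<subseteq> families" "\<forall>F\<in>\<F>. \<forall>x. degree (F x) \<le> n" for \<F> n
    using that
  proof (induction n arbitrary: \<F>)
    case 0
    have p: "poly (F x) y = coeff (F x) 0" if "F \<in> \<F>" for F x y
    proof -
      have "degree (F x) = 0" using 0 that by simp
      then show ?thesis by (auto elim!: degree_eq_zeroE)
    qed
    show ?case unfolding pattern_determined_def same_pattern_def
      by (rule exI[of _ "(\<lambda>F x. coeff (F x) 0) ` \<F>"])
        (use 0 familiesD p in \<open>auto intro!: exI[of _ id] simp: strict_mono_def\<close>)
  next
    case (Suc n)
    have step: "pattern_determined (\<H> \<union> \<L>)"
      if "finite \<H>" "\<H> \<subseteq> families" "\<forall>F\<in>\<H>. \<forall>x. degree (F x) \<le> Suc n"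
        "finite \<L>" "\<L> \<subseteq> families" "\<forall>F\<in>\<L>. \<forall>x. degree (F x) \<le> n" for \<H> \<L>
      using that
    proof (induction \<H> arbitrary: \<L> rule: finite_induct)
      case empty
      then show ?case using Suc.IH[of \<L>] by simp
    next
      case (insert F \<H>)
      define F' where "F' = (\<lambda>x. pderiv (F x))"
      have F': "F' \<in> families" using insert by (auto simp: F'_def)
      have dF': "degree (F' x) \<le> n" for x
      proof -
        have "degree (F x) \<le> Suc n" using insert by auto
        then show ?thesis by (simp add: F'_def degree_pderiv)
      qed
      define \<S> where "\<S> = insert F' (\<H> \<union> \<L>)"
      have \<S>: "finite \<S>" "\<S> \<subseteq> families" "\<forall>G\<in>\<S>. \<forall>x. degree (G x) \<le> Suc n"
        using insert.hyps insert.prems F' dF' unfolding \<S>_def by (blast intro: le_SucI)+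
      have "\<exists>S\<in>families. (\<exists>Q. \<forall>x. G x \<noteq> 0 \<longrightarrow> F x = Q x * G x + S x) \<and> (\<forall>x. degree (S x) \<le> n)"
        if G: "G \<in> \<S>" for G
      proof -
        have Ff: "F \<in> families" and Gf: "G \<in> families" using insert.prems \<S> G by auto
        obtain Q S where S: "S \<in> families" "\<forall>x. G x \<noteq> 0 \<longrightarrow>
           F x = Q x * G x + S x \<and> (S x = 0 \<or> degree (S x) < degree (G x))"
          using euclidean_division[OF Ff Gf] by blast
        have "(\<lambda>x. if G x = 0 then 0 else S x) \<in> families"
          by (rule families_if[OF decidable_poly_zero families_const S(1)]) (use \<S> G in blast)
        moreover have "degree (if G x = 0 then 0 else S x) \<le> n" for x
        proof (cases "G x = 0 \<or> S x = 0")
          case False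
          then have "degree (S x) < degree (G x)" using S by auto
          also have "\<dots> \<le> Suc n" using \<S> G by auto
          finally show ?thesis using False by simp
        qed auto
        ultimately show ?thesis using S(2)
          by (intro bexI[of _ "\<lambda>x. if G x = 0 then 0 else S x"]) auto
      qed
      then obtain S where S: "\<And>G. G \<in> \<S> \<Longrightarrow> S G \<in> families"
        "\<And>G. G \<in> \<S> \<Longrightarrow> \<exists>Q. \<forall>x. G x \<noteq> 0 \<longrightarrow> F x = Q x * G x + S G x"
        "\<And>G x. G \<in> \<S> \<Longrightarrow> degree (S G x) \<le> n"
        by metis
      have "pattern_determined (\<H> \<union> (insert F' (\<L> \<union> S ` \<S>)))"
        by (rule insert.IH) (use insert.prems S \<S> F' dF' in auto)
      also have "\<H> \<union> (insert F' (\<L> \<union> S ` \<S>)) = \<S> \<union> S ` \<S>" by (auto simp: \<S>_def)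
      finally have "pattern_determined (insert F \<S>)"
        by (intro pattern_determined_insert[where S = S] \<S> S) (use insert.prems in \<open>auto simp: \<S>_def F'_def\<close>)
      then show ?case by (rule pattern_determined_mono) (auto simp: \<S>_def)
    qed
    show ?case using step[OF Suc.prems, of "{}"] by simp
  qed
  have "\<forall>F\<in>\<F>. \<exists>n. \<forall>x. degree (F x) \<le> n" using assms families_bound by blast
  then obtain d where d: "\<forall>F\<in>\<F>. \<forall>x. degree (F x) \<le> d F" by metis
  have "\<forall>F\<in>\<F>. \<forall>x. degree (F x) \<le> (\<Sum>F\<in>\<F>. d F)"
    using d member_le_sum[OF _ _ assms(1), of _ d] by (meson le_trans zero_le)
  then show ?thesis using main assms by blast
qed

end

section \<open>Semialgebraic sets and the Tarski-Seidenberg theorem\<close>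

lemmas real_polynomial_function_linear = real_polynomial_function.intros(1)
lemmas real_polynomial_function_const = real_polynomial_function.intros(2)
lemmas real_polynomial_function_mult = real_polynomial_function.intros(4)

lemma semialgebraic_pos: "real_polynomial_function f \<Longrightarrow> semialgebraic {x. f x > 0}"
  unfolding semialgebraic_def by (rule boolean_combinations.base) blast

lemma semialgebraic_Compl: "semialgebraic A \<Longrightarrow> semialgebraic (- A)"
  unfolding semialgebraic_def by (rule boolean_combinations.Compl)

lemma semialgebraic_Un: "semialgebraic A \<Longrightarrow> semialgebraic B \<Longrightarrow> semialgebraic (A \<union> B)"
  unfolding semialgebraic_def by (rule boolean_combinations.Un)

lemma semialgebraic_Int: "semialgebraic A \<Longrightarrow> semialgebraic B \<Longrightarrow> semialgebraic (A \<inter> B)"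
  using semialgebraic_Compl[OF semialgebraic_Un[OF semialgebraic_Compl semialgebraic_Compl]]
  by (metis Compl_Un double_compl)

lemma semialgebraic_UNIV: "semialgebraic UNIV"
  using semialgebraic_pos[OF real_polynomial_function_const[of 1]] by simp

lemma semialgebraic_empty: "semialgebraic {}"
  using semialgebraic_Compl[OF semialgebraic_UNIV] by simp

lemma semialgebraic_UNION:
  "finite I \<Longrightarrow> (\<And>i. i \<in> I \<Longrightarrow> semialgebraic (A i)) \<Longrightarrow> semialgebraic (\<Union>i\<in>I. A i)"
  by (induction I rule: finite_induct) (auto intro: semialgebraic_Un semialgebraic_empty)

lemma semialgebraic_INTER:
  "finite I \<Longrightarrow> (\<And>i. i \<in> I \<Longrightarrow> semialgebraic (A i)) \<Longrightarrow> semialgebraic (\<Inter>i\<in>I. A i)"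
  by (induction I rule: finite_induct) (auto intro: semialgebraic_Int semialgebraic_UNIV)

lemma semialgebraic_zero:
  assumes "real_polynomial_function f" shows "semialgebraic {x. f x = 0}"
proof -
  have "semialgebraic (- ({x. f x > 0} \<union> {x. - f x > 0}))"
    by (intro semialgebraic_Compl semialgebraic_Un semialgebraic_pos assms real_polynomial_function_minus)
  also have "- ({x. f x > 0} \<union> {x. - f x > 0}) = {x. f x = 0}" by auto
  finally show ?thesis .
qed

text \<open>
  The inverse of 0 being 0, these functions are defined everywhere. They need not be quotients
  of two polynomials, but they are so piecewise.
\<close>

inductive_set rational_functions :: "((real^'n::finite) \<Rightarrow> real) set" where
  poly: "real_polynomial_function f \<Longrightarrow> f \<in> rational_functions"
| add: "f \<in> rational_functions \<Longrightarrow> g \<in> rational_functions \<Longrightarrow> (\<lambda>x. f x + g x) \<in> rational_functions"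
| mult: "f \<in> rational_functions \<Longrightarrow> g \<in> rational_functions \<Longrightarrow> (\<lambda>x. f x * g x) \<in> rational_functions"
| inverse: "f \<in> rational_functions \<Longrightarrow> (\<lambda>x. inverse (f x)) \<in> rational_functions"

interpretation rational: real_function_field rational_functions
  by unfold_locales (auto intro: rational_functions.intros)

definition rational_piece where
  "rational_piece f t \<longleftrightarrow> (case t of (A, p, q) \<Rightarrow> semialgebraic A \<and> real_polynomial_function p \<and>
     real_polynomial_function q \<and> (\<forall>x\<in>A. q x \<noteq> 0 \<and> f x = p x / q x))"

lemma rational_piece_iff:
  "rational_piece f (A, p, q) \<longleftrightarrow> semialgebraic A \<and> real_polynomial_function p \<and>
     real_polynomial_function q \<and> (\<forall>x\<in>A. q x \<noteq> 0 \<and> f x = p x / q x)"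
  by (simp add: rational_piece_def)

text \<open>
  Each function is a quotient of polynomials on every piece of a finite semialgebraic covering.
  Sums and products refine the covering, and an inversion splits each piece according to the
  vanishing of the numerator.
\<close>

lemma rational_function_piecewise:
  fixes f :: "real^'n::finite \<Rightarrow> real"
  assumes "f \<in> rational_functions"
  shows "\<exists>T. finite T \<and> (\<forall>t\<in>T. rational_piece f t) \<and> (\<forall>x. \<exists>t\<in>T. x \<in> fst t)"
  using assms
proof induction
  case (poly f)
  show ?case
    by (rule exI[of _ "{(UNIV, f, \<lambda>x. 1)}"])
      (use poly semialgebraic_UNIV in \<open>auto simp: rational_piece_iff\<close>)
next
  case (add f g)
  then obtain S T where S: "finite S" "\<forall>t\<in>S. rational_piece f t" "\<forall>x. \<exists>t\<in>S. x \<in> fst t"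
    and T: "finite T" "\<forall>t\<in>T. rational_piece g t" "\<forall>x. \<exists>t\<in>T. x \<in> fst t" by metis
  define h :: "((real^'n) set \<times> (real^'n \<Rightarrow> real) \<times> (real^'n \<Rightarrow> real)) \<times>
      ((real^'n) set \<times> (real^'n \<Rightarrow> real) \<times> (real^'n \<Rightarrow> real)) \<Rightarrow> _"
    where "h = (\<lambda>((A, p, q), (B, r, s)). (A \<inter> B, (\<lambda>x. p x * s x + r x * q x), (\<lambda>x. q x * s x)))"
  have "rational_piece (\<lambda>x. f x + g x) (h (u, v))" if uv: "u \<in> S" "v \<in> T" for u v
  proof -
    obtain A p q B r s where eq: "u = (A,p,q)" "v = (B,r,s)" by (metis prod.collapse)
    then have "rational_piece f (A,p,q)" "rational_piece g (B,r,s)" using uv S T by blast+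
    then show ?thesis unfolding eq h_def rational_piece_iff
      by (auto simp: rational_piece_iff field_simps intro!: semialgebraic_Int)
  qed
  then have "\<forall>t\<in>h ` (S \<times> T). rational_piece (\<lambda>x. f x + g x) t" by blast
  moreover have "\<exists>t\<in>h ` (S \<times> T). x \<in> fst t" for x
  proof -
    obtain u v where "u \<in> S" "x \<in> fst u" "v \<in> T" "x \<in> fst v" using S(3) T(3) by blast
    then show ?thesis
      by (intro bexI[of _ "h (u, v)"] imageI) (auto simp: h_def split: prod.split)
  qed
  ultimately show ?case using S(1) T(1) by (intro exI[of _ "h ` (S \<times> T)"]) simp
next
  case (mult f g)
  then obtain S T where S: "finite S" "\<forall>t\<in>S. rational_piece f t" "\<forall>x. \<exists>t\<in>S. x \<in> fst t"
    and T: "finite T" "\<forall>t\<in>T. rational_piece g t" "\<forall>x. \<exists>t\<in>T. x \<in> fst t" by metis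
  define h :: "((real^'n) set \<times> (real^'n \<Rightarrow> real) \<times> (real^'n \<Rightarrow> real)) \<times>
      ((real^'n) set \<times> (real^'n \<Rightarrow> real) \<times> (real^'n \<Rightarrow> real)) \<Rightarrow> _"
    where "h = (\<lambda>((A, p, q), (B, r, s)). (A \<inter> B, (\<lambda>x. p x * r x), (\<lambda>x. q x * s x)))"
  have "rational_piece (\<lambda>x. f x * g x) (h (u, v))" if uv: "u \<in> S" "v \<in> T" for u v
  proof -
    obtain A p q B r s where eq: "u = (A,p,q)" "v = (B,r,s)" by (metis prod.collapse)
    then have "rational_piece f (A,p,q)" "rational_piece g (B,r,s)" using uv S T by blast+
    then show ?thesis unfolding eq h_def rational_piece_iff
      by (auto simp: rational_piece_iff intro!: semialgebraic_Int)
  qed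
  then have "\<forall>t\<in>h ` (S \<times> T). rational_piece (\<lambda>x. f x * g x) t" by blast
  moreover have "\<exists>t\<in>h ` (S \<times> T). x \<in> fst t" for x
  proof -
    obtain u v where "u \<in> S" "x \<in> fst u" "v \<in> T" "x \<in> fst v" using S(3) T(3) by blast
    then show ?thesis
      by (intro bexI[of _ "h (u, v)"] imageI) (auto simp: h_def split: prod.split)
  qed
  ultimately show ?case using S(1) T(1) by (intro exI[of _ "h ` (S \<times> T)"]) simp
next
  case (inverse f)
  then obtain T where T: "finite T" "\<forall>t\<in>T. rational_piece f t" "\<forall>x. \<exists>t\<in>T. x \<in> fst t" by metis
  define h0 :: "(real^'n) set \<times> (real^'n \<Rightarrow> real) \<times> (real^'n \<Rightarrow> real) \<Rightarrow> _"
    where "h0 = (\<lambda>(A, p, q). (A \<inter> {x. p x = 0}, (\<lambda>x::real^'n. 0::real), (\<lambda>x::real^'n. 1::real)))"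
  define h1 :: "(real^'n) set \<times> (real^'n \<Rightarrow> real) \<times> (real^'n \<Rightarrow> real) \<Rightarrow> _"
    where "h1 = (\<lambda>(A, p, q). (A \<inter> - {x. p x = 0}, q, p))"
  have "rational_piece (\<lambda>x. inverse (f x)) (h0 u) \<and> rational_piece (\<lambda>x. inverse (f x)) (h1 u)"
    if u: "u \<in> T" for u
  proof -
    obtain A p q where eq: "u = (A,p,q)" by (metis prod.collapse)
    then have "rational_piece f (A,p,q)" using u T by blast
    then show ?thesis unfolding eq h0_def h1_def
      by (auto simp: rational_piece_iff intro!: semialgebraic_Int semialgebraic_zero semialgebraic_Compl)
  qed
  then have "\<forall>t\<in>h0 ` T \<union> h1 ` T. rational_piece (\<lambda>x. inverse (f x)) t" by blast
  moreover have "\<exists>t\<in>h0 ` T \<union> h1 ` T. x \<in> fst t" for x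
  proof -
    obtain u where u: "u \<in> T" "x \<in> fst u" using T(3) by blast
    then have "x \<in> fst (h0 u) \<or> x \<in> fst (h1 u)" by (auto simp: h0_def h1_def split: prod.split)
    then show ?thesis using u by blast
  qed
  ultimately show ?case using T(1) by (intro exI[of _ "h0 ` T \<union> h1 ` T"]) simp
qed

lemma semialgebraic_rational_pos:
  assumes "f \<in> rational_functions" shows "semialgebraic {x. f x > 0}"
proof -
  obtain T where T: "finite T" "\<forall>t\<in>T. rational_piece f t" "\<forall>x. \<exists>t\<in>T. x \<in> fst t"
    using rational_function_piecewise[OF assms] by blast
  have "semialgebraic (fst t \<inter> {x. fst (snd t) x * snd (snd t) x > 0})" if "t \<in> T" for t
    using T(2) that
    by (intro semialgebraic_Int semialgebraic_pos real_polynomial_function_mult) (auto simp: rational_piece_def)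
  then have "semialgebraic (\<Union>t\<in>T. fst t \<inter> {x. fst (snd t) x * snd (snd t) x > 0})"
    using T(1) by (intro semialgebraic_UNION)
  also have "(\<Union>t\<in>T. fst t \<inter> {x. fst (snd t) x * snd (snd t) x > 0}) = {x. f x > 0}"
  proof -
    have "f x > 0 \<longleftrightarrow> fst (snd t) x * snd (snd t) x > 0" if "t \<in> T" "x \<in> fst t" for x t
    proof -
      have "f x = fst (snd t) x / snd (snd t) x" using T(2) that by (auto simp: rational_piece_def)
      then show ?thesis by (simp add: zero_less_divide_iff zero_less_mult_iff)
    qed
    then show ?thesis using T(3)[rule_format] by (intro Set.set_eqI) (simp, metis)
  qed
  finally show ?thesis .
qed

text \<open>Such a set is a finite union of sign cells of the functions in \<open>C\<close>.\<close>

lemma semialgebraic_sign_determined: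
  assumes "finite C" "C \<subseteq> rational_functions"
    and "\<And>x x'. (\<forall>c\<in>C. sgn (c x) = sgn (c x')) \<Longrightarrow> x \<in> A \<Longrightarrow> x' \<in> A"
  shows "semialgebraic A"
  using assms
proof (induction C arbitrary: A rule: finite_induct)
  case empty
  then have "A = UNIV \<or> A = {}" by auto
  then show ?case by (auto intro: semialgebraic_UNIV semialgebraic_empty)
next
  case (insert c C)
  define B where "B s = {x. \<exists>x0\<in>A. sgn (c x0) = s \<and> (\<forall>c\<in>C. sgn (c x0) = sgn (c x))}" for s :: real
  have B: "semialgebraic (B s)" for s
    by (rule insert.IH) (use insert.prems in \<open>auto simp: B_def\<close>)
  have c: "c \<in> rational_functions" using insert.prems by auto
  have m: "(\<lambda>x. - c x) \<in> rational_functions"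
    using rational.diff[OF rational.const[of 0] c] by simp
  have s: "semialgebraic {x. sgn (c x) = s}" if "s \<in> {-1,0,1}" for s :: real
  proof -
    have "{x. sgn (c x) = 1} = {x. c x > 0}" "{x. sgn (c x) = -1} = {x. - c x > 0}"
      "{x. sgn (c x) = 0} = - ({x. c x > 0} \<union> {x. - c x > 0})"
      by (auto simp: sgn_if split: if_splits)
    moreover have "semialgebraic (- ({x. c x > 0} \<union> {x. - c x > 0}))"
      "semialgebraic {x. c x > 0}" "semialgebraic {x. - c x > 0}"
      by (intro semialgebraic_Compl semialgebraic_Un semialgebraic_rational_pos c m)+
    ultimately show ?thesis using that by (metis insertE singletonD)
  qed
  have "A = (\<Union>s\<in>{-1,0,1}. B s \<inter> {x. sgn (c x) = s})"
  proof (intro Set.set_eqI iffI)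
    fix x assume "x \<in> A"
    then have "x \<in> B (sgn (c x)) \<inter> {y. sgn (c y) = sgn (c x)}" by (auto simp: B_def)
    moreover have "sgn (c x) \<in> {-1,0,1}" by (auto simp: sgn_if)
    ultimately show "x \<in> (\<Union>s\<in>{-1,0,1}. B s \<inter> {x. sgn (c x) = s})" by blast
  next
    fix x assume "x \<in> (\<Union>s\<in>{-1,0,1}. B s \<inter> {x. sgn (c x) = s})"
    then obtain x0 where "x0 \<in> A" "\<forall>c'\<in>insert c C. sgn (c' x0) = sgn (c' x)" by (auto simp: B_def)
    then show "x \<in> A" using insert.prems(2) by blast
  qed
  moreover have "semialgebraic (\<Union>s\<in>{-1,0,1::real}. B s \<inter> {x. sgn (c x) = s})"
    by (intro semialgebraic_UNION semialgebraic_Int B s) auto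
  ultimately show ?case by simp
qed

lemma semialgebraic_imp_sign_determined:
  assumes "semialgebraic A"
  shows "\<exists>C. finite C \<and> C \<subseteq> Collect real_polynomial_function \<and>
    (\<forall>x x'. (\<forall>c\<in>C. sgn (c x) = sgn (c x')) \<longrightarrow> (x \<in> A \<longleftrightarrow> x' \<in> A))"
  using assms unfolding semialgebraic_def
proof induction
  case (base A)
  then obtain f where A: "A = {x. f x > 0}" and f: "real_polynomial_function f" by blast
  show ?case
  proof (intro exI[of _ "{f}"] conjI allI impI)
    show "{f} \<subseteq> Collect real_polynomial_function" using f by simp
    show "x \<in> A \<longleftrightarrow> x' \<in> A" if "\<forall>c\<in>{f}. sgn (c x) = sgn (c x')" for x x'
      using that sgn_greater[of "f x"] sgn_greater[of "f x'"] by (simp add: A)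
  qed simp
next
  case (Compl A)
  then show ?case by auto
next
  case (Un A B)
  then obtain C D where "finite C \<and> C \<subseteq> Collect real_polynomial_function \<and>
    (\<forall>x x'. (\<forall>c\<in>C. sgn (c x) = sgn (c x')) \<longrightarrow> (x \<in> A \<longleftrightarrow> x' \<in> A))"
    "finite D \<and> D \<subseteq> Collect real_polynomial_function \<and>
    (\<forall>x x'. (\<forall>c\<in>D. sgn (c x) = sgn (c x')) \<longrightarrow> (x \<in> B \<longleftrightarrow> x' \<in> B))" by blast
  then show ?case by (intro exI[of _ "C \<union> D"]) (simp, blast)
qed

definition vec_upd :: "real^'n::finite \<Rightarrow> 'n \<Rightarrow> real \<Rightarrow> real^'n" where
  "vec_upd x k y = (\<chi> j. if j = k then y else x $ j)"

lemma vec_upd_nth: "vec_upd x k y $ j = (if j = k then y else x $ j)"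
  by (simp add: vec_upd_def)

lemma real_polynomial_function_nth [intro]: "real_polynomial_function (\<lambda>x. x $ i)"
  by (rule real_polynomial_function_linear) (rule bounded_linear_vec_nth)

lemma linear_functional_eq_sum:
  fixes f :: "real^'n::finite \<Rightarrow> real"
  assumes "linear f" shows "f x = (\<Sum>j\<in>UNIV. x $ j * f (axis j 1))"
proof -
  have "f x = f (\<Sum>j\<in>UNIV. x $ j *\<^sub>R axis j 1)"
    by (simp add: basis_expansion flip: scalar_mult_eq_scaleR)
  also have "\<dots> = (\<Sum>j\<in>UNIV. x $ j * f (axis j 1))"
    by (simp add: linear_sum[OF assms] linear_cmul[OF assms])
  finally show ?thesis .
qed

text \<open>
  All other coordinates are treated as parameters of a polynomial in the \<open>k\<close>-th
  one.
\<close>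

lemma poly_in_one_coordinate:
  assumes "real_polynomial_function c"
  shows "\<exists>F\<in>rational.families. \<forall>x y. poly (F x) y = c (vec_upd x k y)"
  using assms
proof induction
  case (linear f)
  then have lin: "linear f" by (rule bounded_linear.linear)
  define a where "a x = (\<Sum>j\<in>UNIV-{k}. x $ j * f (axis j 1))" for x
  have "a \<in> rational_functions" unfolding a_def
    by (intro rational_functions.poly real_polynomial_function_sum real_polynomial_function_mult
         real_polynomial_function_nth real_polynomial_function_const) auto
  then have "(\<lambda>x. pCons (a x) [:f (axis k 1):]) \<in> rational.families"
    by (rule rational.families_pCons) (rule rational.families_const)
  moreover have "f (vec_upd x k y) = a x + y * f (axis k 1)" for x y
    unfolding linear_functional_eq_sum[OF lin, of "vec_upd x k y"] a_def
    by (subst sum.remove[of UNIV k]) (auto simp: vec_upd_nth intro!: sum.cong)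
  ultimately show ?case by (intro bexI[of _ "\<lambda>x. pCons (a x) [:f (axis k 1):]"]) auto
next
  case (const c)
  show ?case by (rule bexI[of _ "\<lambda>x. [:c:]"]) auto
next
  case (add f g)
  then obtain F G where "F \<in> rational.families" "G \<in> rational.families"
    "\<forall>x y. poly (F x) y = f (vec_upd x k y)" "\<forall>x y. poly (G x) y = g (vec_upd x k y)" by blast
  then show ?case by (intro bexI[of _ "\<lambda>x. F x + G x"]) auto
next
  case (mult f g)
  then obtain F G where "F \<in> rational.families" "G \<in> rational.families"
    "\<forall>x y. poly (F x) y = f (vec_upd x k y)" "\<forall>x y. poly (G x) y = g (vec_upd x k y)" by blast
  then show ?case by (intro bexI[of _ "\<lambda>x. F x * G x"]) auto
qed

text \<open>
  Along the lines in direction \<open>k\<close> the set \<open>A\<close> is given by signs of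
  polynomials in one variable, whose coefficients are rational functions of the base point. If
  two base points have the same sign pattern, the matching map \<open>\<phi>\<close> carries a
  witness over the first to a witness over the second. So the projection is determined by the
  signs of the functions that decide the pattern.
\<close>

theorem semialgebraic_project:
  fixes A :: "(real^'n::finite) set"
  assumes "semialgebraic A" shows "semialgebraic {x. \<exists>y. vec_upd x k y \<in> A}"
proof -
  obtain C where C: "finite C" "C \<subseteq> Collect real_polynomial_function"
    "\<And>x x'. (\<forall>c\<in>C. sgn (c x) = sgn (c x')) \<Longrightarrow> x \<in> A \<longleftrightarrow> x' \<in> A"
    using semialgebraic_imp_sign_determined[OF assms] by blast
  have "\<forall>c\<in>C. \<exists>F\<in>rational.families. \<forall>x y. poly (F x) y = c (vec_upd x k y)"
    using C(2) poly_in_one_coordinate by blast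
  then obtain F where F: "\<And>c. c \<in> C \<Longrightarrow> F c \<in> rational.families"
    "\<And>c x y. c \<in> C \<Longrightarrow> poly (F c x) y = c (vec_upd x k y)" by metis
  have "rational.pattern_determined (F ` C)"
    by (rule rational.pattern_determined_families) (use C F in auto)
  then obtain D where D: "finite D" "D \<subseteq> rational_functions"
    "\<And>x x'. (\<forall>c\<in>D. sgn (c x) = sgn (c x')) \<Longrightarrow> rational.same_pattern (F ` C) x x'"
    unfolding rational.pattern_determined_def by blast
  show ?thesis
  proof (rule semialgebraic_sign_determined[OF D(1,2)])
    fix x x' :: "real^'n"
    assume "\<forall>c\<in>D. sgn (c x) = sgn (c x')"
    then obtain \<phi> where \<phi>: "\<forall>f\<in>F ` C. \<forall>y. sgn (poly (f x) y) = sgn (poly (f x') (\<phi> y))"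
      using D(3) unfolding rational.same_pattern_def by blast
    assume "x \<in> {x. \<exists>y. vec_upd x k y \<in> A}"
    then obtain y where y: "vec_upd x k y \<in> A" by blast
    have "\<forall>c\<in>C. sgn (c (vec_upd x k y)) = sgn (c (vec_upd x' k (\<phi> y)))" using \<phi> F(2) by auto
    with C(3) y show "x' \<in> {x. \<exists>y. vec_upd x k y \<in> A}" by blast
  qed
qed

lemma semialgebraic_project_set:
  fixes A :: "(real^'n::finite) set"
  assumes "semialgebraic A"
  shows "semialgebraic {x. \<exists>z\<in>A. \<forall>j. j \<notin> I \<longrightarrow> z $ j = x $ j}"
proof -
  have "finite I" by simp
  then show ?thesis
  proof (induction I rule: finite_induct)
    case empty
    have "{x. \<exists>z\<in>A. \<forall>j. j \<notin> {} \<longrightarrow> z $ j = x $ j} = A" by (auto simp: vec_eq_iff) (metis vec_eq_iff)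
    then show ?case using assms by simp
  next
    case (insert i I)
    have "{x. \<exists>z\<in>A. \<forall>j. j \<notin> insert i I \<longrightarrow> z $ j = x $ j} =
        {x. \<exists>y. vec_upd x i y \<in> {x. \<exists>z\<in>A. \<forall>j. j \<notin> I \<longrightarrow> z $ j = x $ j}}"
      (is "?L = ?R")
    proof (intro Set.set_eqI iffI)
      fix x assume "x \<in> ?L"
      then obtain z where z: "z \<in> A" "\<forall>j. j \<notin> insert i I \<longrightarrow> z $ j = x $ j" by blast
      then have "\<forall>j. j \<notin> I \<longrightarrow> z $ j = vec_upd x i (z $ i) $ j" by (auto simp: vec_upd_nth)
      with z show "x \<in> ?R" by blast
    next
      fix x assume "x \<in> ?R"
      then obtain y z where "z \<in> A" "\<forall>j. j \<notin> I \<longrightarrow> z $ j = vec_upd x i y $ j" by blast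
      then show "x \<in> ?L" by (auto simp: vec_upd_nth intro!: bexI[of _ z])
    qed
    then show ?case using semialgebraic_project[OF insert.IH] by simp
  qed
qed

text \<open>
  Rational maps have to be admitted here because the changes of charts of projective space are
  of this kind.
\<close>

lemma semialgebraic_vimage:
  fixes f :: "real^'n::finite \<Rightarrow> real^'m::finite"
  assumes A: "semialgebraic A" and f: "\<And>i. (\<lambda>x. f x $ i) \<in> rational_functions"
  shows "semialgebraic {x. f x \<in> A}"
proof -
  have comp: "(\<lambda>x. p (f x)) \<in> rational_functions" if "real_polynomial_function p" for p
    using that
  proof induction
    case (linear p)
    then have "p (f x) = (\<Sum>j\<in>UNIV. f x $ j * p (axis j 1))" for x
      by (intro linear_functional_eq_sum bounded_linear.linear)
    moreover have "(\<lambda>x. \<Sum>j\<in>UNIV. f x $ j * p (axis j 1)) \<in> rational_functions"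
      by (intro rational.sum rational.mult f rational.const)
    ultimately show ?case by simp
  qed (auto intro: rational_functions.intros rational.const)
  show ?thesis using A unfolding semialgebraic_def[of A]
  proof induction
    case (base A)
    then obtain p where "A = {x. p x > 0}" "real_polynomial_function p" by blast
    then show ?case using semialgebraic_rational_pos[OF comp] by simp
  next
    case (Compl A)
    have "{x. f x \<in> - A} = - {x. f x \<in> A}" by auto
    then show ?case using semialgebraic_Compl Compl by simp
  next
    case (Un A B)
    have "{x. f x \<in> A \<union> B} = {x. f x \<in> A} \<union> {x. f x \<in> B}" by auto
    then show ?case using semialgebraic_Un Un by simp
  qed
qed

lemma semialgebraic_poly_vimage:
  fixes f :: "real^'n::finite \<Rightarrow> real^'m::finite"
  assumes "semialgebraic A" "\<And>i. real_polynomial_function (\<lambda>x. f x $ i)"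
  shows "semialgebraic {x. f x \<in> A}"
  by (rule semialgebraic_vimage) (use assms in \<open>auto intro: rational_functions.poly\<close>)

lemma polynomial_function_vec_nth:
  fixes f :: "real^'n::finite \<Rightarrow> real^'m::finite"
  assumes "\<And>i. real_polynomial_function (\<lambda>x. f x $ i)"
  shows "polynomial_function f"
  unfolding polynomial_function_iff_Basis_inner
  using assms by (auto simp: Basis_vec_def inner_axis)

lemma real_polynomial_function_substitute:
  fixes f :: "real^'n::finite \<Rightarrow> real^'m::finite"
  assumes "real_polynomial_function p" "\<And>i. real_polynomial_function (\<lambda>x. f x $ i)"
  shows "real_polynomial_function (\<lambda>x. p (f x))"
  using real_polynomial_function_compose[OF polynomial_function_vec_nth[of f, OF assms(2)] assms(1)]
  by (simp add: o_def)

text \<open>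
  The image is the projection of the graph. The coordinates indexed by \<open>Inr\<close> hold
  the point and are projected away; those indexed by \<open>Inl\<close> hold its image.
\<close>

theorem semialgebraic_image:
  fixes A :: "(real^'d::finite) set" and f :: "real^'d \<Rightarrow> real^'m::finite"
  assumes A: "semialgebraic A" and f: "\<And>i. real_polynomial_function (\<lambda>x. f x $ i)"
  shows "semialgebraic (f ` A)"
proof -
  define r :: "real^('m + 'd) \<Rightarrow> real^'d" where "r u = (\<chi> j. u $ Inr j)" for u
  have r: "real_polynomial_function (\<lambda>u. r u $ j)" for j by (auto simp: r_def)
  define B where "B = {u. r u \<in> A} \<inter> (\<Inter>i. {u. u $ Inl i - f (r u) $ i = 0})"
  have "semialgebraic B" unfolding B_def
    by (intro semialgebraic_Int semialgebraic_INTER semialgebraic_poly_vimage A r semialgebraic_zero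
        real_polynomial_function_diff real_polynomial_function_substitute[OF f] real_polynomial_function_nth) auto
  from semialgebraic_project_set[OF this, of "range Inr"]
  have P: "semialgebraic {u. \<exists>z\<in>B. \<forall>j. j \<notin> range Inr \<longrightarrow> z $ j = u $ j}" .
  define e :: "real^'m \<Rightarrow> real^('m + 'd)" where "e y = (\<chi> j. case j of Inl i \<Rightarrow> y $ i | Inr _ \<Rightarrow> 0)" for y
  have e: "real_polynomial_function (\<lambda>y. e y $ j)" for j
    by (cases j) (auto simp: e_def)
  have "semialgebraic {y. e y \<in> {u. \<exists>z\<in>B. \<forall>j. j \<notin> range Inr \<longrightarrow> z $ j = u $ j}}"
    by (rule semialgebraic_poly_vimage[OF P e])
  also have "{y. e y \<in> {u. \<exists>z\<in>B. \<forall>j. j \<notin> range Inr \<longrightarrow> z $ j = u $ j}} = f ` A"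
  proof (intro Set.set_eqI iffI)
    fix y assume "y \<in> {y. e y \<in> {u. \<exists>z\<in>B. \<forall>j. j \<notin> range Inr \<longrightarrow> z $ j = u $ j}}"
    then obtain z where z: "z \<in> B" "\<forall>j. j \<notin> range Inr \<longrightarrow> z $ j = e y $ j" by blast
    have "z $ Inl i = y $ i" for i using z(2)[rule_format, of "Inl i"] by (auto simp: e_def)
    with z(1) have "r z \<in> A" "y = f (r z)" by (auto simp: B_def vec_eq_iff)
    then show "y \<in> f ` A" by blast
  next
    fix y assume "y \<in> f ` A"
    then obtain x where x: "x \<in> A" "y = f x" by blast
    define z :: "real^('m + 'd)" where "z = (\<chi> j. case j of Inl i \<Rightarrow> y $ i | Inr i \<Rightarrow> x $ i)"
    have "r z = x" by (auto simp: r_def z_def vec_eq_iff)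
    then have "z \<in> B" using x by (auto simp: B_def) (simp add: z_def)
    moreover have "\<forall>j. j \<notin> range Inr \<longrightarrow> z $ j = e y $ j"
      by (auto simp: z_def e_def split: sum.split)
    ultimately show "y \<in> {y. e y \<in> {u. \<exists>z\<in>B. \<forall>j. j \<notin> range Inr \<longrightarrow> z $ j = u $ j}}" by blast
  qed
  finally show ?thesis .
qed

section \<open>Simple roots of polynomials with holomorphic coefficients\<close>

lemma polynomial_difference_quotient:
  fixes c :: "nat \<Rightarrow> complex"
  shows "(\<Sum>k\<le>n. c k * y ^ k) - (\<Sum>k\<le>n. c k * z ^ k) =
    (y - z) * (\<Sum>k\<le>n. c k * (\<Sum>i<k. z ^ (k - Suc i) * y ^ i))"
proof -
  have "(\<Sum>k\<le>n. c k * y ^ k) - (\<Sum>k\<le>n. c k * z ^ k) = (\<Sum>k\<le>n. c k * (y ^ k - z ^ k))"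
    by (simp add: sum_subtractf right_diff_distrib)
  also have "\<dots> = (\<Sum>k\<le>n. (y - z) * (c k * (\<Sum>i<k. z ^ (k - Suc i) * y ^ i)))"
    by (simp add: power_diff_sumr2 mult_ac)
  finally show ?thesis by (simp add: sum_distrib_left)
qed

text \<open>
  The implicit function theorem at a simple root, together with a disc in which the root is
  unique; the size of the disc can be kept below \<open>\<epsilon>\<close> to separate several
  roots. Everything follows from the factorisation \<open>f w y - f w z = (y - z) * Q w y
  z\<close>, where the values of \<open>Q\<close> near the given root are close to the
  derivative \<open>a\<close> of \<open>f\<close> in \<open>y\<close>, which is not 0. Thus
  \<open>y - f w y / a\<close> is a contraction, which gives existence, and \<open>Q\<close>
  does not vanish, which gives uniqueness. The same factorisation for two values of the root
  function \<open>r\<close> yields first its continuity and then its differentiability.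
\<close>

lemma holomorphic_simple_root:
  fixes c :: "nat \<Rightarrow> complex \<Rightarrow> complex" and f :: "complex \<Rightarrow> complex \<Rightarrow> complex"
  assumes f_def: "\<And>w y. f w y = (\<Sum>k\<le>n. c k w * y ^ k)"
    and S: "open S" "w0 \<in> S" and c: "\<And>k. c k holomorphic_on S"
    and y0: "f w0 y0 = 0" "(\<Sum>k\<le>n. c k w0 * (of_nat k * y0 ^ (k - 1))) \<noteq> 0"
    and \<epsilon>: "\<epsilon> > 0"
  shows "\<exists>\<rho> \<delta> r. 0 < \<rho> \<and> \<rho> \<le> \<epsilon> \<and> 0 < \<delta> \<and> ball w0 \<delta> \<subseteq> S \<and> r holomorphic_on ball w0 \<delta> \<and> r w0 = y0 \<and>
    (\<forall>w\<in>ball w0 \<delta>. r w \<in> ball y0 \<rho> \<and> (\<forall>y\<in>ball y0 \<rho>. f w y = 0 \<longleftrightarrow> y = r w))"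
proof -
  define Q where "Q w y z = (\<Sum>k\<le>n. c k w * (\<Sum>i<k. z ^ (k - Suc i) * y ^ i))" for w y z
  have fQ: "f w y - f w z = (y - z) * Q w y z" for w y z
    unfolding f_def Q_def by (rule polynomial_difference_quotient)
  define a where "a = Q w0 y0 y0"
  have "y0 ^ (k - Suc i) * y0 ^ i = y0 ^ (k - 1)" if "i < k" for i k
    using that by (simp flip: power_add)
  then have "a = (\<Sum>k\<le>n. c k w0 * (of_nat k * y0 ^ (k - 1)))"
    unfolding a_def Q_def by (intro sum.cong refl) simp
  then have a: "a \<noteq> 0" using y0 by simp
  have contc: "continuous_on S (c k)" for k using c holomorphic_on_imp_continuous_on by blast
  have contQ: "continuous_on (S \<times> UNIV \<times> UNIV) (\<lambda>u. Q (fst u) (fst (snd u)) (snd (snd u)))"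
    unfolding Q_def
    by (intro continuous_intros continuous_on_compose2[OF contc]) auto
  have "open (S \<times> (UNIV :: complex set) \<times> (UNIV :: complex set))" using S by (simp add: open_Times)
  then have "isCont (\<lambda>u. Q (fst u) (fst (snd u)) (snd (snd u))) (w0, y0, y0)"
    using contQ S(2) by (simp add: continuous_on_eq_continuous_at)
  then have "((\<lambda>u. Q (fst u) (fst (snd u)) (snd (snd u))) \<longlongrightarrow> a) (nhds (w0, y0, y0))"
    by (simp add: a_def isCont_def tendsto_nhds_iff)
  then have "\<forall>\<^sub>F u in nhds (w0, y0, y0). dist (Q (fst u) (fst (snd u)) (snd (snd u))) a < norm a / 2"
    using a by (intro tendstoD) auto
  then obtain e where e: "e > 0"
    "\<And>u. dist u (w0, y0, y0) < e \<Longrightarrow> dist (Q (fst u) (fst (snd u)) (snd (snd u))) a < norm a / 2"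
    by (auto simp: eventually_nhds_metric)
  have near: "dist (Q w y z) a < norm a / 2" if "dist w w0 < e / 3" "dist y y0 < e / 3" "dist z y0 < e / 3" for w y z
  proof -
    have "dist (w, y, z) (w0, y0, y0) \<le> dist w w0 + (dist y y0 + dist z y0)"
      unfolding dist_prod_def
      by (rule order_trans[OF sqrt_sum_squares_le_sum_abs]) (auto intro!: order_trans[OF sqrt_sum_squares_le_sum_abs])
    also have "\<dots> < e" using that by simp
    finally show ?thesis using e(2)[of "(w, y, z)"] by simp
  qed
  define \<rho> where "\<rho> = min \<epsilon> (e / 4)"
  have \<rho>: "0 < \<rho>" "\<rho> \<le> \<epsilon>" "\<rho> < e / 3" using \<epsilon> e(1) by (auto simp: \<rho>_def min_def)
  have contf: "continuous_on S (\<lambda>w. f w y)" for y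
    unfolding f_def by (intro continuous_intros contc)
  have "(\<lambda>w. f w y0) \<midarrow>w0\<rightarrow> 0"
    using contf[of y0] S y0(1) unfolding continuous_on_eq_continuous_at[OF S(1)] isCont_def by metis
  then have "((\<lambda>w. f w y0) \<longlongrightarrow> 0) (nhds w0)" using y0(1) by (simp add: tendsto_nhds_iff)
  then have "\<forall>\<^sub>F w in nhds w0. dist (f w y0) 0 < norm a * \<rho> / 4"
    using a \<rho> by (intro tendstoD) auto
  moreover have "\<forall>\<^sub>F w in nhds w0. w \<in> S" using S by (rule eventually_nhds_in_open)
  ultimately have "\<forall>\<^sub>F w in nhds w0. norm (f w y0) < norm a * \<rho> / 4 \<and> w \<in> S"
    by eventually_elim auto
  then obtain \<delta>0 where \<delta>0: "\<delta>0 > 0" "\<And>w. dist w w0 < \<delta>0 \<Longrightarrow> norm (f w y0) < norm a * \<rho> / 4 \<and> w \<in> S"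
    by (auto simp: eventually_nhds_metric)
  define \<delta> where "\<delta> = min \<delta>0 (e / 3)"
  have \<delta>: "\<delta> > 0" "\<delta> \<le> \<delta>0" "\<delta> \<le> e / 3" using \<delta>0 e by (auto simp: \<delta>_def)
  have Qnear: "dist (Q w y z) a < norm a / 2" if "w \<in> ball w0 \<delta>" "y \<in> cball y0 \<rho>" "z \<in> cball y0 \<rho>" for w y z
    using that \<delta> \<rho> by (intro near) (auto simp: dist_commute)
  have Qlow: "norm a / 2 \<le> norm (Q w y z)" if "w \<in> ball w0 \<delta>" "y \<in> cball y0 \<rho>" "z \<in> cball y0 \<rho>" for w y z
  proof -
    have "norm a \<le> norm (Q w y z) + norm (a - Q w y z)" by (metis add.commute diff_add_cancel norm_triangle_ineq)
    with Qnear[OF that] show ?thesis by (simp add: dist_norm norm_minus_commute)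
  qed
  have ex: "\<exists>y\<in>ball y0 \<rho>. f w y = 0" if w: "w \<in> ball w0 \<delta>" for w
  proof -
    define T where "T y = y - f w y / a" for y
    have lip: "dist (T y) (T z) \<le> (1/2) * dist y z" if yz: "y \<in> cball y0 \<rho>" "z \<in> cball y0 \<rho>" for y z
    proof -
      have "T y - T z = (y - z) - (f w y - f w z) / a" by (simp add: T_def diff_divide_distrib)
      also have "\<dots> = (y - z) * ((a - Q w y z) / a)" using a by (simp add: fQ field_simps)
      finally have "norm (T y - T z) = norm (y - z) * (norm (a - Q w y z) / norm a)"
        by (simp add: norm_mult norm_divide)
      also have "\<dots> \<le> norm (y - z) * (1/2)"
        using Qnear[OF w yz] a by (intro mult_left_mono) (auto simp: dist_norm norm_minus_commute field_simps)
      finally show ?thesis by (simp add: dist_norm)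
    qed
    have Ty0: "dist (T y0) y0 < \<rho> / 4"
    proof -
      have "norm (f w y0) < norm a * \<rho> / 4" using \<delta>0(2)[of w] w \<delta> by (auto simp: dist_commute)
      then show ?thesis using a by (simp add: T_def dist_norm norm_divide field_simps)
    qed
    have Tball: "T y \<in> ball y0 \<rho>" if "y \<in> cball y0 \<rho>" for y
    proof -
      have "dist (T y) y0 \<le> dist (T y) (T y0) + dist (T y0) y0" by (rule dist_triangle)
      also have "\<dots> < (1/2) * \<rho> + \<rho> / 4"
        using lip[of y y0] that \<rho> Ty0 by (auto simp: dist_commute)
      finally show ?thesis using \<rho> by (simp add: dist_commute)
    qed
    have Tsub: "T ` cball y0 \<rho> \<subseteq> cball y0 \<rho>" using Tball ball_subset_cball by blast
    have "\<exists>!y\<in>cball y0 \<rho>. T y = y"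
      by (rule Banach_fix[where c = "1/2"])
        (use \<rho> lip Tsub in \<open>simp_all add: compact_imp_complete\<close>)
    then obtain y where y: "y \<in> cball y0 \<rho>" "T y = y" by blast
    then have "f w y = 0" using a by (simp add: T_def)
    moreover have "y \<in> ball y0 \<rho>" using Tball[OF y(1)] y(2) by simp
    ultimately show ?thesis by blast
  qed
  then obtain r where r: "\<And>w. w \<in> ball w0 \<delta> \<Longrightarrow> r w \<in> ball y0 \<rho>" "\<And>w. w \<in> ball w0 \<delta> \<Longrightarrow> f w (r w) = 0"
    by metis
  have unique: "y = r w" if "w \<in> ball w0 \<delta>" "y \<in> ball y0 \<rho>" "f w y = 0" for w y
  proof -
    have "(y - r w) * Q w y (r w) = 0" using fQ[of w y "r w"] r(2)[OF that(1)] that(3) by simp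
    moreover have "Q w y (r w) \<noteq> 0" using Qlow[OF that(1), of y "r w"] that r(1)[OF that(1)] a by auto
    ultimately show ?thesis by simp
  qed
  have r0: "r w0 = y0" using unique[of w0 y0] \<delta> \<rho> y0 by simp
  have diffr: "(r w - r w1) * Q w (r w) (r w1) = - (f w (r w1) - f w1 (r w1))"
    if "w \<in> ball w0 \<delta>" "w1 \<in> ball w0 \<delta>" for w w1
    using fQ[of w "r w" "r w1"] r(2)[OF that(1)] r(2)[OF that(2)] by simp
  have subS: "ball w0 \<delta> \<subseteq> S" using \<delta>0(2) \<delta> by (auto simp: dist_commute)
  have contr: "isCont r w1" if w1: "w1 \<in> ball w0 \<delta>" for w1
  proof -
    have ev: "\<forall>\<^sub>F w in at w1. w \<in> ball w0 \<delta>" using w1 by (intro eventually_at_in_open') auto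
    have "(\<lambda>w. f w (r w1)) \<midarrow>w1\<rightarrow> f w1 (r w1)"
      using contf[of "r w1"] S subS w1 by (auto simp: continuous_on_eq_continuous_at isCont_def)
    then have "(\<lambda>w. norm (f w (r w1) - f w1 (r w1)) / (norm a / 2)) \<midarrow>w1\<rightarrow> norm (f w1 (r w1) - f w1 (r w1)) / (norm a / 2)"
      using a by (intro tendsto_intros) auto
    then have lim: "(\<lambda>w. norm (f w (r w1) - f w1 (r w1)) / (norm a / 2)) \<midarrow>w1\<rightarrow> 0" by simp
    have "\<forall>\<^sub>F w in at w1. norm (r w - r w1) \<le> norm (f w (r w1) - f w1 (r w1)) / (norm a / 2)"
      using ev
    proof eventually_elim
      case (elim w)
      have "norm (r w - r w1) * (norm a / 2) \<le> norm (r w - r w1) * norm (Q w (r w) (r w1))"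
        using Qlow[OF elim, of "r w" "r w1"] r(1)[OF elim] r(1)[OF w1] by (intro mult_left_mono) auto
      also have "\<dots> = norm (f w (r w1) - f w1 (r w1))"
        using diffr[OF elim w1] by (metis norm_minus_cancel norm_mult)
      finally show ?case using a by (subst pos_le_divide_eq) auto
    qed
    then have "(\<lambda>w. r w - r w1) \<midarrow>w1\<rightarrow> 0" by (rule Lim_null_comparison[OF _ lim])
    then show ?thesis by (simp add: isCont_def LIM_zero_iff)
  qed
  have "r field_differentiable (at w1)" if w1: "w1 \<in> ball w0 \<delta>" for w1
  proof -
    have ev: "\<forall>\<^sub>F w in at w1. w \<in> ball w0 \<delta>" using w1 by (intro eventually_at_in_open') auto
    have "(\<lambda>w. f w (r w1)) holomorphic_on S" unfolding f_def by (intro holomorphic_intros c)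
    then obtain D where "((\<lambda>w. f w (r w1)) has_field_derivative D) (at w1)"
      using S(1) subS w1 by (meson field_differentiable_def holomorphic_on_imp_differentiable_at subsetD)
    then have D: "(\<lambda>w. (f w (r w1) - f w1 (r w1)) / (w - w1)) \<midarrow>w1\<rightarrow> D"
      by (simp add: has_field_derivative_iff)
    have "isCont (\<lambda>w. Q w (r w) (r w1)) w1"
      unfolding Q_def using contr[OF w1] contc S subS w1
      by (intro continuous_intros) (auto simp: continuous_on_eq_continuous_at)
    then have QL: "(\<lambda>w. Q w (r w) (r w1)) \<midarrow>w1\<rightarrow> Q w1 (r w1) (r w1)" by (simp add: isCont_def)
    have Q0: "Q w (r w) (r w1) \<noteq> 0" if "w \<in> ball w0 \<delta>" for w
      using Qlow[OF that, of "r w" "r w1"] r(1)[OF that] r(1)[OF w1] a by auto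
    have "(\<lambda>w. - ((f w (r w1) - f w1 (r w1)) / (w - w1)) / Q w (r w) (r w1)) \<midarrow>w1\<rightarrow> - D / Q w1 (r w1) (r w1)"
      by (intro tendsto_intros D QL Q0 w1)
    moreover have "\<forall>\<^sub>F w in at w1. - ((f w (r w1) - f w1 (r w1)) / (w - w1)) / Q w (r w) (r w1) = (r w - r w1) / (w - w1)"
      using ev
    proof eventually_elim
      case (elim w)
      have "r w - r w1 = - (f w (r w1) - f w1 (r w1)) / Q w (r w) (r w1)"
        using diffr[OF elim w1] Q0[OF elim] by (metis nonzero_mult_div_cancel_right)
      then show ?case by (simp add: mult.commute minus_divide_left del: minus_divide_left[symmetric])
    qed
    ultimately have "(\<lambda>w. (r w - r w1) / (w - w1)) \<midarrow>w1\<rightarrow> - D / Q w1 (r w1) (r w1)"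
      by (rule Lim_transform_eventually)
    then show ?thesis by (auto simp: has_field_derivative_iff field_differentiable_def)
  qed
  then have "r holomorphic_on ball w0 \<delta>"
    by (simp add: holomorphic_on_def field_differentiable_at_within)
  then show ?thesis using \<rho> \<delta> subS r0 r unique
    by - (rule exI[of _ \<rho>], rule exI[of _ \<delta>], rule exI[of _ r], blast)
qed

section \<open>Meromorphic germs\<close>

lemma meromorphic_at_0_iff:
  "f meromorphic_on {0} \<longleftrightarrow> (\<exists>m r g. r > 0 \<and> g holomorphic_on ball 0 r \<and>
     (\<forall>z\<in>ball 0 r - {0}. f z = g z / z ^ m))"
proof
  assume "f meromorphic_on {0}"
  then obtain F where F: "f has_laurent_expansion F" by (auto simp: meromorphic_on_def)
  define m where "m = nat (- fls_subdegree F)"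
  have F': "(\<lambda>z. f z * z powi (int m)) has_laurent_expansion fls_shift (- int m) F"
    using F by (rule has_laurent_expansion_shift)
  have sd: "fls_subdegree (fls_shift (- int m) F) \<ge> 0"
    by (cases "F = 0") (auto simp: fls_shift_subdegree m_def)
  have "(\<lambda>z. if z = 0 then fls_nth (fls_shift (- int m) F) 0 else f z * z powi (int m)) analytic_on {0}"
    (is "?g analytic_on _")
    by (rule removable_singularity' has_laurent_expansion_imp_tendsto_0[OF F' sd]
        has_laurent_expansion_isolated_0[OF F'])+
  then obtain r where r: "r > 0" "?g holomorphic_on ball 0 r" by (auto simp: analytic_at_ball)
  then show "\<exists>m r g. r > 0 \<and> g holomorphic_on ball 0 r \<and> (\<forall>z\<in>ball 0 r - {0}. f z = g z / z ^ m)"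
    by (intro exI[of _ m] exI[of _ r] exI[of _ ?g]) simp
next
  assume "\<exists>m r g. r > 0 \<and> g holomorphic_on ball 0 r \<and> (\<forall>z\<in>ball 0 r - {0}. f z = g z / z ^ m)"
  then obtain m r g where *: "r > 0" "g holomorphic_on ball 0 r" "\<forall>z\<in>ball 0 r - {0}. f z = g z / z ^ m"
    by blast
  have "g meromorphic_on {0}"
    by (rule analytic_on_imp_meromorphic_on) (use * in \<open>auto simp: analytic_at_ball\<close>)
  then have "(\<lambda>z. g z / z ^ m) meromorphic_on {0}" by (intro meromorphic_intros)
  moreover have "\<forall>\<^sub>F z in at 0. f z = g z / z ^ m"
    unfolding eventually_at using * by (intro exI[of _ r]) (auto simp: dist_norm)
  ultimately show "f meromorphic_on {0}" by (subst meromorphic_on_cong) auto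
qed

interpretation meromorphic: function_field "{f. f meromorphic_on {0}}"
  by unfold_locales (auto intro!: meromorphic_intros)


lemma bex3I: "D \<in> S \<Longrightarrow> A \<in> S \<Longrightarrow> B \<in> S \<Longrightarrow> P D A B \<Longrightarrow> \<exists>D\<in>S. \<exists>A\<in>S. \<exists>B\<in>S. P D A B"
  by blast

context function_field
begin

text \<open>
  Euclid's algorithm, run at all parameters simultaneously and stopped where the remainder
  vanishes.
\<close>

lemma bezout_gcd:
  assumes "F \<in> families" "G \<in> families"
  shows "\<exists>D\<in>families. \<exists>A\<in>families. \<exists>B\<in>families.
    \<forall>x. D x dvd F x \<and> D x dvd G x \<and> D x = A x * F x + B x * G x"
proof -
  have "\<exists>D\<in>families. \<exists>A\<in>families. \<exists>B\<in>families.
    \<forall>x. D x dvd F x \<and> D x dvd G x \<and> D x = A x * F x + B x * G x"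
    if "F \<in> families" "G \<in> families" "\<forall>x. G x = 0 \<or> degree (G x) < n" for F G n
    using that
  proof (induction n arbitrary: F G)
    case 0
    then have "\<forall>x. F x dvd F x \<and> F x dvd G x \<and> F x = 1 * F x + 0 * G x" by auto
    then show ?case by (rule bex3I[OF 0(1) families_const families_const])
  next
    case (Suc n)
    obtain Q S where QS: "Q \<in> families" "S \<in> families" "\<And>x. G x \<noteq> 0 \<Longrightarrow>
        F x = Q x * G x + S x \<and> (S x = 0 \<or> degree (S x) < degree (G x))"
      using euclidean_division[OF Suc.prems(1,2)] by metis
    define S' where "S' x = (if G x = 0 then 0 else S x)" for x
    have S': "S' \<in> families" unfolding S'_def
      by (intro families_if decidable_poly_zero families_const QS Suc.prems)
    have "S' x = 0 \<or> degree (S' x) < n" for x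
    proof (cases "G x = 0 \<or> S x = 0")
      case False
      then have "degree (S x) < degree (G x)" "degree (G x) < Suc n" using QS(3)[of x] Suc.prems(3) by auto
      then show ?thesis using False by (simp add: S'_def)
    qed (auto simp: S'_def)
    then obtain D A B where D: "D \<in> families" "A \<in> families" "B \<in> families"
      "\<And>x. D x dvd G x \<and> D x dvd S' x \<and> D x = A x * G x + B x * S' x"
      using Suc.IH[OF Suc.prems(2) S'] by metis
    have "(if G x = 0 then F x else D x) dvd F x \<and> (if G x = 0 then F x else D x) dvd G x \<and>
      (if G x = 0 then F x else D x) =
        (if G x = 0 then 1 else B x) * F x + (if G x = 0 then 0 else A x - B x * Q x) * G x" for x
    proof (cases "G x = 0")
      case False
      have d: "D x dvd G x" "D x dvd S x" "D x = A x * G x + B x * S x"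
        using D(4)[of x] False by (auto simp: S'_def)
      have F: "F x = Q x * G x + S x" using QS(3)[OF False] by simp
      have "D x dvd F x" unfolding F using d by (intro dvd_add dvd_mult) auto
      moreover have "D x = B x * F x + (A x - B x * Q x) * G x" unfolding F d(3) by (simp add: algebra_simps)
      ultimately show ?thesis using False d by simp
    qed simp
    then have P: "\<forall>x. (if G x = 0 then F x else D x) dvd F x \<and> (if G x = 0 then F x else D x) dvd G x \<and>
      (if G x = 0 then F x else D x) =
        (if G x = 0 then 1 else B x) * F x + (if G x = 0 then 0 else A x - B x * Q x) * G x" by blast
    show ?case
      by (rule bex3I[where D = "\<lambda>x. if G x = 0 then F x else D x" and
          A = "\<lambda>x. if G x = 0 then 1 else B x" and B = "\<lambda>x. if G x = 0 then 0 else A x - B x * Q x"])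
        (rule P | intro families_if decidable_poly_zero families_const families_diff families_mult D QS Suc.prems)+
  qed
  moreover obtain n where "\<forall>x. degree (G x) \<le> n" using families_bound assms by blast
  then have "\<forall>x. G x = 0 \<or> degree (G x) < Suc n" by (simp add: less_Suc_eq_le)
  ultimately show ?thesis using assms by blast
qed

end

text \<open>
  The quotient of \<open>F\<close> by the greatest common divisor of \<open>F\<close> and its
  derivative.
\<close>

lemma meromorphic_squarefree_part:
  assumes F: "F \<in> meromorphic.families"
  shows "\<exists>Q\<in>meromorphic.families. \<forall>z. F z \<noteq> 0 \<longrightarrow>
    Q z \<noteq> 0 \<and> rsquarefree (Q z) \<and> (\<forall>y. poly (Q z) y = 0 \<longleftrightarrow> poly (F z) y = 0)"
proof -
  obtain D A B where D: "D \<in> meromorphic.families"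
    "\<And>z. D z dvd F z \<and> D z dvd pderiv (F z) \<and> D z = A z * F z + B z * pderiv (F z)"
    using meromorphic.bezout_gcd[OF F meromorphic.families_pderiv[OF F]] by metis
  obtain Q S where Q: "Q \<in> meromorphic.families"
    "\<And>z. D z \<noteq> 0 \<Longrightarrow> F z = Q z * D z + S z \<and> (S z = 0 \<or> degree (S z) < degree (D z))"
    using meromorphic.euclidean_division[OF F D(1)] by metis
  have "Q z \<noteq> 0 \<and> rsquarefree (Q z) \<and> (\<forall>y. poly (Q z) y = 0 \<longleftrightarrow> poly (F z) y = 0)" if Fz: "F z \<noteq> 0" for z
  proof -
    have Dz: "D z \<noteq> 0" using D(2)[of z] Fz by auto
    have "D z dvd S z" using D(2)[of z] Q(2)[OF Dz] by (metis dvd_add_right_iff dvd_triv_right)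
    then have "S z = 0" using Q(2)[OF Dz] by (metis dvd_imp_degree_le linorder_not_less)
    then have FQ: "F z = Q z * D z" using Q(2)[OF Dz] by simp
    then have Qz: "Q z \<noteq> 0" using Fz by auto
    obtain e where e: "pderiv (F z) = e * D z" using D(2)[of z] by (metis dvd_def mult.commute)
    show ?thesis
    proof (cases "pderiv (F z) = 0")
      case False
      then show ?thesis
        using poly_squarefree_decomp[OF False FQ e, of "A z" "B z"] D(2)[of z] Qz by blast
    next
      case True
      then have "degree (F z) = 0" by (simp add: pderiv_eq_0_iff)
      then have dQ: "degree (Q z) = 0" using FQ Qz Dz by (simp add: degree_mult_eq)
      obtain a b where ab: "F z = [:a:]" "Q z = [:b:]" using \<open>degree (F z) = 0\<close> dQ by (meson degree_eq_zeroE)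
      then show ?thesis using Fz Qz by (auto simp: rsquarefree_roots)
    qed
  qed
  then show ?thesis using Q(1) by blast
qed

section \<open>Analytic branches of roots over a convex domain\<close>

lemma card_roots_rsquarefree:
  fixes p :: "complex poly"
  assumes "rsquarefree p" shows "card {z. poly p z = 0} = degree p"
proof -
  have p0: "p \<noteq> 0" using assms by (auto simp: rsquarefree_def)
  have "degree p = degree (smult (lead_coeff p) (\<Prod>z|poly p z = 0. [:-z, 1:]))"
    using complex_poly_decompose_rsquarefree[OF assms] by simp
  also have "\<dots> = (\<Sum>z|poly p z = 0. degree [:-z, 1:])"
    using p0 by (simp add: degree_prod_eq_sum_degree)
  finally show ?thesis by simp
qed

lemma poly_eq_sum_upto:
  fixes p :: "'a::idom poly"
  assumes "degree p \<le> n" shows "poly p y = (\<Sum>k\<le>n. coeff p k * y ^ k)"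
proof -
  have "poly p y = poly (\<Sum>k\<le>n. monom (coeff p k) k) y"
    by (simp add: poly_as_sum_of_monoms'[OF assms])
  then show ?thesis by (simp add: poly_sum poly_monom)
qed

lemma poly_pderiv_eq_sum_upto:
  fixes p :: "'a::idom poly"
  assumes "degree p \<le> n" shows "poly (pderiv p) y = (\<Sum>k\<le>n. coeff p k * (of_nat k * y ^ (k - 1)))"
proof -
  have "poly (pderiv p) y = poly (pderiv (\<Sum>k\<le>n. monom (coeff p k) k)) y"
    by (simp add: poly_as_sum_of_monoms'[OF assms])
  also have "pderiv (\<Sum>k\<le>n. monom (coeff p k) k) = (\<Sum>k\<le>n. pderiv (monom (coeff p k) k))"
    using higher_pderiv_sum[of 1 "\<lambda>k. monom (coeff p k) k" "{..n}"] by simp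
  finally show ?thesis by (simp add: pderiv_monom poly_sum poly_monom mult_ac)
qed

text \<open>
  When all roots are simple and the degree is constant, the roots form a covering of
  \<open>H\<close> with \<open>n\<close> sheets. As \<open>H\<close> is simply connected, this
  covering splits into global sections, which are holomorphic.
\<close>

locale squarefree_family =
  fixes F :: "complex \<Rightarrow> complex poly" and H :: "complex set" and n :: nat
  assumes open_H: "open H" and conv: "convex H"
    and holo: "\<And>k. (\<lambda>w. coeff (F w) k) holomorphic_on H"
    and deg: "\<And>w. w \<in> H \<Longrightarrow> degree (F w) = n"
    and sqf: "\<And>w. w \<in> H \<Longrightarrow> rsquarefree (F w)"
    and n_pos: "n > 0"
begin

definition roots :: "complex \<Rightarrow> complex set" where
  "roots w = {y. poly (F w) y = 0}"

lemma roots_finite_card: "w \<in> H \<Longrightarrow> finite (roots w) \<and> card (roots w) = n"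
  unfolding roots_def using card_roots_rsquarefree[OF sqf] deg n_pos by (metis card.infinite less_irrefl)

lemma local_root:
  assumes "w0 \<in> H" "y0 \<in> roots w0" "\<epsilon> > 0"
  shows "\<exists>\<delta> \<rho> r. 0 < \<rho> \<and> \<rho> \<le> \<epsilon> \<and> 0 < \<delta> \<and> ball w0 \<delta> \<subseteq> H \<and> r holomorphic_on ball w0 \<delta> \<and> r w0 = y0 \<and>
    (\<forall>w\<in>ball w0 \<delta>. r w \<in> ball y0 \<rho> \<and> (\<forall>y\<in>ball y0 \<rho>. y \<in> roots w \<longleftrightarrow> y = r w))"
proof -
  define f where "f w y = (\<Sum>k\<le>n. coeff (F w) k * y ^ k)" for w y
  have f: "f w y = poly (F w) y" if "w \<in> H" for w y
    using poly_eq_sum_upto[of "F w" n y] deg[OF that] by (simp add: f_def)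
  have "poly (pderiv (F w0)) y0 \<noteq> 0"
    using sqf[OF assms(1)] assms(2) by (auto simp: rsquarefree_roots roots_def)
  then have "(\<Sum>k\<le>n. coeff (F w0) k * (of_nat k * y0 ^ (k - 1))) \<noteq> 0"
    using poly_pderiv_eq_sum_upto[of "F w0" n y0] deg[OF assms(1)] by simp
  moreover have "f w0 y0 = 0" using f assms by (simp add: roots_def)
  ultimately obtain \<rho> \<delta> r where *: "0 < \<rho>" "\<rho> \<le> \<epsilon>" "0 < \<delta>" "ball w0 \<delta> \<subseteq> H" "r holomorphic_on ball w0 \<delta>" "r w0 = y0"
    "\<forall>w\<in>ball w0 \<delta>. r w \<in> ball y0 \<rho> \<and> (\<forall>y\<in>ball y0 \<rho>. f w y = 0 \<longleftrightarrow> y = r w)"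
    using holomorphic_simple_root[OF f_def open_H assms(1) holo _ _ assms(3), of y0] by blast
  have "\<forall>w\<in>ball w0 \<delta>. r w \<in> ball y0 \<rho> \<and> (\<forall>y\<in>ball y0 \<rho>. y \<in> roots w \<longleftrightarrow> y = r w)"
    using *(4,7) f by (auto simp: roots_def subset_iff)
  with * show ?thesis by blast
qed

text \<open>
  Around the \<open>n\<close> roots at \<open>w0\<close> disjoint discs are chosen, each with a
  continuous branch of roots. At a nearby point the \<open>n\<close> branches have distinct
  values, so these are all the roots.
\<close>

lemma local_roots:
  assumes w0: "w0 \<in> H"
  shows "\<exists>\<delta> \<rho> r. 0 < \<delta> \<and> ball w0 \<delta> \<subseteq> H \<and>
    (\<forall>y\<in>roots w0. continuous_on (ball w0 \<delta>) (r y) \<and>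
       (\<forall>w\<in>ball w0 \<delta>. r y w \<in> ball y (\<rho> y) \<and> (\<forall>z\<in>ball y (\<rho> y). z \<in> roots w \<longleftrightarrow> z = r y w))) \<and>
    (\<forall>y\<in>roots w0. \<forall>y'\<in>roots w0. y \<noteq> y' \<longrightarrow> ball y (\<rho> y) \<inter> ball y' (\<rho> y') = {}) \<and>
    (\<forall>w\<in>ball w0 \<delta>. roots w = (\<lambda>y. r y w) ` roots w0)"
proof -
  let ?Y = "roots w0"
  have Y: "finite ?Y" "card ?Y = n" using roots_finite_card[OF w0] by auto
  define D where "D = (\<lambda>(y, y'). dist y y') ` (?Y \<times> ?Y) - {0}"
  have D: "finite D" "\<forall>d\<in>D. d > 0" using Y by (auto simp: D_def)
  define \<epsilon> where "\<epsilon> = Min (insert 1 D) / 2"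
  have \<epsilon>: "\<epsilon> > 0" using D by (simp add: \<epsilon>_def)
  have sep: "2 * \<epsilon> \<le> dist y y'" if "y \<in> ?Y" "y' \<in> ?Y" "y \<noteq> y'" for y y'
  proof -
    have "dist y y' \<in> D" using that by (auto simp: D_def)
    then show ?thesis using D by (simp add: \<epsilon>_def)
  qed
  have e0: "\<forall>y\<in>?Y. \<exists>\<delta> \<rho> r. 0 < \<rho> \<and> \<rho> \<le> \<epsilon> \<and> 0 < \<delta> \<and> ball w0 \<delta> \<subseteq> H \<and> r holomorphic_on ball w0 \<delta> \<and> r w0 = y \<and>
    (\<forall>w\<in>ball w0 \<delta>. r w \<in> ball y \<rho> \<and> (\<forall>z\<in>ball y \<rho>. z \<in> roots w \<longleftrightarrow> z = r w))"
    using local_root[OF w0 _ \<epsilon>] by blast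
  from bchoice[OF e0] obtain \<delta> where e1: "\<forall>y\<in>?Y. \<exists>\<rho> r. 0 < \<rho> \<and> \<rho> \<le> \<epsilon> \<and> 0 < \<delta> y \<and> ball w0 (\<delta> y) \<subseteq> H \<and>
      r holomorphic_on ball w0 (\<delta> y) \<and> r w0 = y \<and>
    (\<forall>w\<in>ball w0 (\<delta> y). r w \<in> ball y \<rho> \<and> (\<forall>z\<in>ball y \<rho>. z \<in> roots w \<longleftrightarrow> z = r w))"
    by (elim exE) (rule that)
  from bchoice[OF e1] obtain \<rho> where e2: "\<forall>y\<in>?Y. \<exists>r. 0 < \<rho> y \<and> \<rho> y \<le> \<epsilon> \<and> 0 < \<delta> y \<and> ball w0 (\<delta> y) \<subseteq> H \<and>
      r holomorphic_on ball w0 (\<delta> y) \<and> r w0 = y \<and>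
    (\<forall>w\<in>ball w0 (\<delta> y). r w \<in> ball y (\<rho> y) \<and> (\<forall>z\<in>ball y (\<rho> y). z \<in> roots w \<longleftrightarrow> z = r w))"
    by (elim exE) (rule that)
  from bchoice[OF e2] obtain r where r: "\<forall>y\<in>?Y. 0 < \<rho> y \<and> \<rho> y \<le> \<epsilon> \<and> 0 < \<delta> y \<and> ball w0 (\<delta> y) \<subseteq> H \<and>
      r y holomorphic_on ball w0 (\<delta> y) \<and> r y w0 = y \<and>
    (\<forall>w\<in>ball w0 (\<delta> y). r y w \<in> ball y (\<rho> y) \<and> (\<forall>z\<in>ball y (\<rho> y). z \<in> roots w \<longleftrightarrow> z = r y w))"
    by (elim exE) (rule that)
  \<comment> \<open>This selects the last conjunct, on the values of the branches, from the choice above.\<close>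
  note r_in = r[rule_format, THEN conjunct2, THEN conjunct2, THEN conjunct2, THEN conjunct2, THEN conjunct2,
      THEN conjunct2, rule_format]
  have Yne: "?Y \<noteq> {}" using Y n_pos by auto
  define d where "d = Min (\<delta> ` ?Y)"
  have d: "d > 0" "\<And>y. y \<in> ?Y \<Longrightarrow> d \<le> \<delta> y" using Y Yne r by (auto simp: d_def)
  have sub: "ball w0 d \<subseteq> ball w0 (\<delta> y)" if "y \<in> ?Y" for y using d(2)[OF that] by auto
  have dH: "ball w0 d \<subseteq> H"
  proof -
    obtain y where "y \<in> ?Y" using Yne by blast
    then show ?thesis using sub[of y] r by (meson order_trans)
  qed
  have r_loc: "r y w \<in> ball y (\<rho> y)" "\<And>z. z \<in> ball y (\<rho> y) \<Longrightarrow> z \<in> roots w \<longleftrightarrow> z = r y w"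
    if "y \<in> ?Y" "w \<in> ball w0 d" for y w
    using r_in[OF that(1)] sub[OF that(1)] that(2) by auto
  have disj: "ball y (\<rho> y) \<inter> ball y' (\<rho> y') = {}" if "y \<in> ?Y" "y' \<in> ?Y" "y \<noteq> y'" for y y'
  proof -
    have "\<rho> y + \<rho> y' \<le> dist y y'" using sep[OF that] bspec[OF r that(1)] bspec[OF r that(2)] by linarith
    then show ?thesis by (simp add: disjoint_ballI)
  qed
  have all: "roots w = (\<lambda>y. r y w) ` ?Y" if w: "w \<in> ball w0 d" for w
  proof (rule card_subset_eq[symmetric])
    have wH: "w \<in> H" using w dH by blast
    show "finite (roots w)" using roots_finite_card[OF wH] by simp
    show sub1: "(\<lambda>y. r y w) ` ?Y \<subseteq> roots w"
      using r_loc w by auto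
    have "inj_on (\<lambda>y. r y w) ?Y"
    proof (rule inj_onI, rule ccontr)
      fix y y' assume yy: "y \<in> ?Y" "y' \<in> ?Y" "r y w = r y' w" "y \<noteq> y'"
      have "r y w \<in> ball y (\<rho> y)" "r y' w \<in> ball y' (\<rho> y')" using r_loc(1)[OF yy(1) w] r_loc(1)[OF yy(2) w] by simp_all
      with disj[OF yy(1,2,4)] yy(3) show False by auto
    qed
    then show "card ((\<lambda>y. r y w) ` ?Y) = card (roots w)"
      using roots_finite_card[OF wH] Y by (simp add: card_image)
  qed
  have "continuous_on (ball w0 d) (r y)" if "y \<in> ?Y" for y
    using bspec[OF r that] sub[OF that] by (meson continuous_on_subset holomorphic_on_imp_continuous_on)
  then have *: "\<forall>y\<in>?Y. continuous_on (ball w0 d) (r y) \<and>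
       (\<forall>w\<in>ball w0 d. r y w \<in> ball y (\<rho> y) \<and> (\<forall>z\<in>ball y (\<rho> y). z \<in> roots w \<longleftrightarrow> z = r y w))"
    using r_loc by simp
  show ?thesis
    by (rule exI[of _ d], rule exI[of _ \<rho>], rule exI[of _ r], intro conjI d(1) dH *)
      (simp_all add: disj all)
qed

definition root_surface :: "(complex \<times> complex) set" where
  "root_surface = {(w, y). w \<in> H \<and> y \<in> roots w}"

lemma covering: "covering_space root_surface fst H"
proof
  show "continuous_on root_surface fst" by (intro continuous_intros)
  have "roots w \<noteq> {}" if "w \<in> H" for w using roots_finite_card[OF that] n_pos by auto
  then show "fst ` root_surface = H" unfolding root_surface_def by force
  fix w0 assume w0: "w0 \<in> H"
  obtain \<delta> \<rho> r where d: "0 < \<delta>" "ball w0 \<delta> \<subseteq> H"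
    and r0: "\<forall>y\<in>roots w0. continuous_on (ball w0 \<delta>) (r y) \<and>
       (\<forall>w\<in>ball w0 \<delta>. r y w \<in> ball y (\<rho> y) \<and> (\<forall>z\<in>ball y (\<rho> y). z \<in> roots w \<longleftrightarrow> z = r y w))"
    and disj0: "\<forall>y\<in>roots w0. \<forall>y'\<in>roots w0. y \<noteq> y' \<longrightarrow> ball y (\<rho> y) \<inter> ball y' (\<rho> y') = {}"
    and all0: "\<forall>w\<in>ball w0 \<delta>. roots w = (\<lambda>y. r y w) ` roots w0"
    using local_roots[OF w0] by (elim exE conjE) (rule that)
  have cont: "continuous_on (ball w0 \<delta>) (r y)" if "y \<in> roots w0" for y using r0 that by simp
  have r: "r y w \<in> ball y (\<rho> y) \<and> (\<forall>z\<in>ball y (\<rho> y). z \<in> roots w \<longleftrightarrow> z = r y w)"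
    if "y \<in> roots w0" "w \<in> ball w0 \<delta>" for y w using r0 that by simp
  have disj: "ball y (\<rho> y) \<inter> ball y' (\<rho> y') = {}" if "y \<in> roots w0" "y' \<in> roots w0" "y \<noteq> y'" for y y'
    using disj0 that by simp
  have all: "roots w = (\<lambda>y. r y w) ` roots w0" if "w \<in> ball w0 \<delta>" for w using all0 that by simp
  define T where "T = ball w0 \<delta>"
  define U where "U y = (\<lambda>w. (w, r y w)) ` T" for y
  have Ueq: "U y = root_surface \<inter> (T \<times> ball y (\<rho> y))" if "y \<in> roots w0" for y
    using r[OF that] d(2) by (auto simp: U_def T_def root_surface_def)
  show "\<exists>T. w0 \<in> T \<and> openin (top_of_set H) T \<and>
      (\<exists>v. \<Union>v = root_surface \<inter> fst -` T \<and> (\<forall>u\<in>v. openin (top_of_set root_surface) u) \<and>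
        pairwise disjnt v \<and> (\<forall>u\<in>v. \<exists>q. homeomorphism u T fst q))"
  proof (rule exI[of _ T], intro conjI exI[of _ "U ` roots w0"])
    show "w0 \<in> T" using d by (simp add: T_def)
    show "openin (top_of_set H) T" using d open_H by (simp add: T_def openin_open_eq)
    show "\<Union> (U ` roots w0) = root_surface \<inter> fst -` T"
    proof (intro subset_antisym subsetI)
      fix u assume "u \<in> \<Union> (U ` roots w0)"
      then show "u \<in> root_surface \<inter> fst -` T" using Ueq by auto
    next
      fix u assume u: "u \<in> root_surface \<inter> fst -` T"
      then have "snd u \<in> roots (fst u)" "fst u \<in> T" by (auto simp: root_surface_def)
      then obtain y where "y \<in> roots w0" "snd u = r y (fst u)" using all[of "fst u"] by (auto simp: T_def)
      then have "u = (fst u, r y (fst u))" by (simp add: prod_eq_iff)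
      then have "u \<in> U y" using \<open>fst u \<in> T\<close> unfolding U_def by (rule image_eqI)
      then show "u \<in> \<Union> (U ` roots w0)" using \<open>y \<in> roots w0\<close> by blast
    qed
    show "\<forall>u\<in>U ` roots w0. openin (top_of_set root_surface) u"
      using Ueq by (auto simp: openin_open T_def intro!: exI[of _ "ball w0 \<delta> \<times> ball _ (\<rho> _)"] open_Times)
    show "pairwise disjnt (U ` roots w0)"
    proof (rule pairwiseI)
      fix u u' assume "u \<in> U ` roots w0" "u' \<in> U ` roots w0" "u \<noteq> u'"
      then obtain y y' where y: "u = U y" "u' = U y'" "y \<in> roots w0" "y' \<in> roots w0" "y \<noteq> y'" by blast
      then show "disjnt u u'" using disj[OF y(3-5)] Ueq by (auto simp: disjnt_def)
    qed
    show "\<forall>u\<in>U ` roots w0. \<exists>q. homeomorphism u T fst q"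
    proof
      fix u assume "u \<in> U ` roots w0"
      then obtain y where y: "u = U y" "y \<in> roots w0" by blast
      have "homeomorphism (U y) T fst (\<lambda>w. (w, r y w))"
        using cont[OF y(2)] by (intro homeomorphismI) (auto simp: U_def T_def intro!: continuous_intros)
      then show "\<exists>q. homeomorphism u T fst q" using y by blast
    qed
  qed
qed

definition section_of_roots :: "(complex \<Rightarrow> complex) \<Rightarrow> bool" where
  "section_of_roots s \<longleftrightarrow> continuous_on H s \<and> (\<forall>w\<in>H. s w \<in> roots w)"

lemma section_exists:
  assumes "w0 \<in> H" "y0 \<in> roots w0"
  shows "\<exists>s. section_of_roots s \<and> s w0 = y0"
proof -
  obtain g where g: "continuous_on H g" "g \<in> H \<rightarrow> root_surface" "g w0 = (w0, y0)" "\<And>w. w \<in> H \<Longrightarrow> fst (g w) = w"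
  proof (rule covering_space_lift_strong[OF covering, of "(w0, y0)" w0 H "\<lambda>w. w"])
    show "simply_connected H" "locally path_connected H"
      using conv by (simp_all add: convex_imp_simply_connected convex_imp_locally_path_connected)
  qed (use assms in \<open>auto simp: root_surface_def\<close>)
  have "section_of_roots (\<lambda>w. snd (g w))"
    unfolding section_of_roots_def
  proof (intro conjI ballI)
    show "continuous_on H (\<lambda>w. snd (g w))" using g(1) by (intro continuous_intros)
    show "snd (g w) \<in> roots w" if "w \<in> H" for w
      using g(2,4) that by (force simp: root_surface_def Pi_def)
  qed
  then show ?thesis using g(3) by (intro exI[of _ "\<lambda>w. snd (g w)"]) simp
qed

lemma section_unique:
  assumes "section_of_roots s" "section_of_roots t" "w0 \<in> H" "s w0 = t w0" "w \<in> H"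
  shows "s w = t w"
proof -
  have "(w, s w) = (w, t w)"
    by (rule covering_space_lift_unique[OF covering, of "\<lambda>w. (w, s w)" w0 "\<lambda>w. (w, t w)" H "\<lambda>w. w"])
      (use assms conv in \<open>auto simp: section_of_roots_def root_surface_def convex_connected intro!: continuous_intros\<close>)
  then show ?thesis by simp
qed

lemma section_holomorphic:
  assumes s: "section_of_roots s" shows "s holomorphic_on H"
  unfolding holomorphic_on_def
proof
  fix w0 assume w0: "w0 \<in> H"
  have "s w0 \<in> roots w0" using s w0 by (simp add: section_of_roots_def)
  from local_root[OF w0 this zero_less_one]
  obtain \<delta> \<rho> r where r: "0 < \<rho>" "0 < \<delta>" "ball w0 \<delta> \<subseteq> H" "r holomorphic_on ball w0 \<delta>"
    "\<And>w y. w \<in> ball w0 \<delta> \<Longrightarrow> y \<in> ball (s w0) \<rho> \<Longrightarrow> y \<in> roots w \<longleftrightarrow> y = r w" by metis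
  have "isCont s w0" using s w0 open_H by (simp add: section_of_roots_def continuous_on_eq_continuous_at)
  then obtain e where e: "e > 0" "\<And>w. dist w w0 < e \<Longrightarrow> dist (s w) (s w0) < \<rho>"
    using r(1) by (auto simp: continuous_at_eps_delta)
  define d where "d = min e \<delta>"
  have d: "d > 0" using e r by (simp add: d_def)
  have eq: "r w = s w" if "w \<in> ball w0 d" for w
  proof -
    have "w \<in> ball w0 \<delta>" "s w \<in> ball (s w0) \<rho>" using that e(2)[of w] by (auto simp: d_def dist_commute)
    moreover have "s w \<in> roots w" using s that r(3) by (auto simp: section_of_roots_def d_def)
    ultimately show ?thesis using r(5) by metis
  qed
  have "r holomorphic_on ball w0 d" using r(4) by (rule holomorphic_on_subset) (auto simp: d_def)
  then have "s holomorphic_on ball w0 d" using eq by (rule holomorphic_transform)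
  then show "s field_differentiable at w0 within H"
    using d by (simp add: field_differentiable_at_within holomorphic_on_imp_differentiable_at)
qed

text \<open>
  Sections that differ at \<open>w0\<close> differ everywhere, so counting the roots suffices.
\<close>

lemma all_roots_from_sections:
  assumes w0: "w0 \<in> H" and s: "\<And>y. y \<in> roots w0 \<Longrightarrow> section_of_roots (s y) \<and> s y w0 = y" and w: "w \<in> H"
  shows "roots w = (\<lambda>y. s y w) ` roots w0"
proof (rule card_subset_eq[symmetric])
  show "finite (roots w)" using roots_finite_card[OF w] by simp
  show "(\<lambda>y. s y w) ` roots w0 \<subseteq> roots w" using s w by (auto simp: section_of_roots_def)
  have "inj_on (\<lambda>y. s y w) (roots w0)"
  proof (rule inj_onI)
    fix y y' assume y: "y \<in> roots w0" "y' \<in> roots w0" "s y w = s y' w"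
    then have "s y w0 = s y' w0" using s y(1,2) section_unique[of "s y" "s y'" w w0] w w0 y(3) by blast
    then show "y = y'" using s y by simp
  qed
  then show "card ((\<lambda>y. s y w) ` roots w0) = card (roots w)"
    using roots_finite_card[OF w0] roots_finite_card[OF w] by (simp add: card_image)
qed

text \<open>
  The translates of \<open>s\<close> by multiples of \<open>c\<close> are sections as well, and
  at \<open>w\<close> they take at most \<open>n\<close> values. Two of the first \<open>n +
  1\<close> translates therefore agree at \<open>w\<close>, hence everywhere. This gives a
  period \<open>N * c\<close> with \<open>N \<le> n\<close>, and \<open>fact n\<close> is a
  common multiple of all such \<open>N\<close>.
\<close>

lemma section_periodic:
  assumes per: "\<And>w. w \<in> H \<Longrightarrow> w + c \<in> H \<and> w - c \<in> H" "\<And>w. w \<in> H \<Longrightarrow> F (w + c) = F w"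
    and s: "section_of_roots s" and w: "w \<in> H"
  shows "s (w + of_nat (fact n) * c) = s w"
proof -
  have memH: "w + of_nat k * c \<in> H \<and> w - of_nat k * c \<in> H" if "w \<in> H" for k w
  proof (induction k)
    case (Suc k)
    then show ?case using per(1)[of "w + of_nat k * c"] per(1)[of "w - of_nat k * c"]
      by (simp add: algebra_simps)
  qed (use that in simp)
  have Fk: "F (w + of_nat k * c) = F w" if "w \<in> H" for k w
  proof (induction k)
    case (Suc k)
    then show ?case using per(2)[of "w + of_nat k * c"] memH[OF that, of k] by (simp add: algebra_simps)
  qed simp
  have shift: "section_of_roots (\<lambda>w. s (w + of_nat k * c))" for k
    unfolding section_of_roots_def
  proof (intro conjI ballI)
    show "continuous_on H (\<lambda>w. s (w + of_nat k * c))"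
      by (rule continuous_on_compose2[of H s])
        (use s memH in \<open>auto simp: section_of_roots_def intro!: continuous_intros\<close>)
    show "s (w + of_nat k * c) \<in> roots w" if "w \<in> H" for w
      using s memH[OF that, of k] Fk[OF that, of k] unfolding section_of_roots_def roots_def by fastforce
  qed
  have "\<not> inj_on (\<lambda>k. s (w + of_nat k * c)) {..n}"
  proof (rule pigeonhole)
    have "(\<lambda>k. s (w + of_nat k * c)) ` {..n} \<subseteq> roots w"
      using shift w by (auto simp: section_of_roots_def)
    then have "card ((\<lambda>k. s (w + of_nat k * c)) ` {..n}) \<le> n"
      using roots_finite_card[OF w] by (metis card_mono)
    then show "card ((\<lambda>k. s (w + of_nat k * c)) ` {..n}) < card {..n}" by simp
  qed
  then obtain k l where kl: "k < l" "l \<le> n" "s (w + of_nat k * c) = s (w + of_nat l * c)"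
    by (auto simp: inj_on_def) (metis linorder_neqE_nat)
  define N where "N = l - k"
  have N: "0 < N" "N \<le> n" using kl by (auto simp: N_def)
  have perN: "s (v + of_nat N * c) = s v" if v: "v \<in> H" for v
  proof -
    have v': "v - of_nat k * c \<in> H" using memH[OF v] by blast
    have "s (v - of_nat k * c + of_nat k * c) = s (v - of_nat k * c + of_nat l * c)"
      by (rule section_unique[OF shift shift w kl(3) v'])
    then show ?thesis using kl by (simp add: N_def of_nat_diff algebra_simps)
  qed
  have "s (w + of_nat (m * N) * c) = s w" for m
  proof (induction m)
    case (Suc m)
    then show ?case using perN[of "w + of_nat (m * N) * c"] memH[OF w, of "m * N"]
      by (simp add: algebra_simps)
  qed simp
  moreover have "N dvd fact n" using N by (simp add: dvd_fact)
  ultimately show ?thesis by (metis dvd_def mult.commute)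
qed

end

section \<open>Puiseux parametrisation of roots\<close>

lemma meromorphic_growth:
  assumes "f meromorphic_on {0}"
  shows "\<exists>m B. \<forall>\<^sub>F z in at 0. norm (f z) * norm z ^ m \<le> B"
proof -
  obtain m r g where g: "r > 0" "g holomorphic_on ball 0 r" "\<forall>z\<in>ball 0 r - {0}. f z = g z / z ^ m"
    using assms by (auto simp: meromorphic_at_0_iff)
  have "compact (g ` cball 0 (r/2))"
    using g by (intro compact_continuous_image holomorphic_on_imp_continuous_on holomorphic_on_subset[OF g(2)]) auto
  then obtain B where B: "\<forall>x\<in>g ` cball 0 (r/2). norm x \<le> B" using compact_imp_bounded bounded_iff by blast
  have "norm (f z) * norm z ^ m \<le> B" if "z \<noteq> 0" "dist z 0 < r / 2" for z
  proof -
    have "norm (f z) * norm z ^ m = norm (g z)" using g that by (simp add: norm_divide norm_power)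
    moreover have "norm (g z) \<le> B" using B that by auto
    ultimately show ?thesis by simp
  qed
  then show ?thesis using g(1) by (intro exI[of _ m] exI[of _ B]) (auto simp: eventually_at intro!: exI[of _ "r/2"])
qed

text \<open>Riemann's theorem on removable singularities, applied to \<open>f z * z ^ m\<close>.\<close>

lemma meromorphic_if_growth:
  assumes r: "r > 0" "f holomorphic_on ball 0 r - {0}"
    and b: "\<forall>\<^sub>F z in at 0. norm (f z) * norm z ^ m \<le> B"
  shows "f meromorphic_on {0}"
proof -
  have "\<exists>g. g holomorphic_on ball 0 r \<and> (\<forall>z\<in>ball 0 r - {0}. g z = f z * z ^ m)"
  proof (subst holomorphic_on_extend_bounded)
    show "(\<lambda>z. f z * z ^ m) holomorphic_on ball 0 r - {0}" using r by (intro holomorphic_intros)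
    show "0 \<in> interior (ball (0::complex) r)" using r by (simp add: interior_open)
    show "\<exists>B. \<forall>\<^sub>F z in at 0. norm (f z * z ^ m) \<le> B" using b by (auto simp: norm_mult norm_power)
  qed
  then obtain g where "g holomorphic_on ball 0 r" "\<forall>z\<in>ball 0 r - {0}. g z = f z * z ^ m" by blast
  then show ?thesis unfolding meromorphic_at_0_iff using r
    by (intro exI[of _ m] exI[of _ r] exI[of _ g]) auto
qed

lemma growth_sum:
  fixes f :: "'i \<Rightarrow> complex \<Rightarrow> real"
  assumes "finite I" "\<And>i. i \<in> I \<Longrightarrow> \<exists>m B. \<forall>\<^sub>F z in at 0. f i z * norm z ^ m \<le> B"
    and nonneg: "\<And>i z. i \<in> I \<Longrightarrow> 0 \<le> f i z"
  shows "\<exists>m B. \<forall>\<^sub>F z in at 0. (\<Sum>i\<in>I. f i z) * norm z ^ m \<le> B"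
  using assms
proof (induction I rule: finite_induct)
  case empty
  show ?case by (intro exI[of _ 0] exI[of _ "0::real"]) simp
next
  case (insert i I)
  obtain m B where 1: "\<forall>\<^sub>F z in at 0. f i z * norm z ^ m \<le> B" using insert.prems by blast
  obtain k C where 2: "\<forall>\<^sub>F z in at 0. (\<Sum>i\<in>I. f i z) * norm z ^ k \<le> C"
    using insert.IH insert.prems by (metis insertCI)
  have small: "\<forall>\<^sub>F z in at 0. norm (z::complex) < 1" unfolding eventually_at by (intro exI[of _ 1]) auto
  have "\<forall>\<^sub>F z in at 0. (\<Sum>i\<in>insert i I. f i z) * norm z ^ (m + k) \<le> B + C"
    using 1 2 small
  proof eventually_elim
    case (elim z)
    have p: "norm z ^ j \<le> 1" for j using elim by (intro power_le_one) auto
    have "0 \<le> f i z * norm z ^ m" "0 \<le> (\<Sum>i\<in>I. f i z) * norm z ^ k"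
      using insert.prems by (auto intro!: mult_nonneg_nonneg sum_nonneg)
    then have "f i z * norm z ^ m * norm z ^ k \<le> B * 1" "(\<Sum>i\<in>I. f i z) * norm z ^ k * norm z ^ m \<le> C * 1"
      using elim p[of k] p[of m] by (intro mult_mono; auto)+
    then show ?case using insert.hyps by (simp add: power_add algebra_simps)
  qed
  then show ?case by blast
qed

lemma cauchy_root_bound:
  fixes c :: "nat \<Rightarrow> complex"
  assumes "n > 0" "c n \<noteq> 0" "(\<Sum>k\<le>n. c k * y ^ k) = 0"
  shows "norm y \<le> 1 + (\<Sum>k<n. norm (c k * inverse (c n)))"
proof (cases "norm y \<le> 1")
  case True
  then show ?thesis by (smt (verit) norm_ge_zero sum_nonneg)
next
  case False
  have "(\<Sum>k\<le>n. c k * y ^ k) = c n * y ^ n + (\<Sum>k<n. c k * y ^ k)"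
    by (simp add: lessThan_Suc_atMost[symmetric])
  then have "y ^ n = - (\<Sum>k<n. c k * y ^ k) * inverse (c n)" using assms(2,3)
    by (simp add: field_simps eq_neg_iff_add_eq_0)
  also have "\<dots> = - (\<Sum>k<n. (c k * inverse (c n)) * y ^ k)"
    by (simp add: sum_distrib_left sum_distrib_right mult_ac)
  finally have "norm y ^ n \<le> (\<Sum>k<n. norm (c k * inverse (c n)) * norm y ^ k)"
    by (metis (no_types, lifting) norm_minus_cancel norm_mult norm_power norm_sum sum.cong)
  also have "\<dots> \<le> (\<Sum>k<n. norm (c k * inverse (c n)) * norm y ^ (n - 1))"
    using False by (intro sum_mono mult_left_mono power_increasing) auto
  also have "\<dots> = (\<Sum>k<n. norm (c k * inverse (c n))) * norm y ^ (n - 1)" by (simp add: sum_distrib_right)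
  finally have "norm y * norm y ^ (n - 1) \<le> (\<Sum>k<n. norm (c k * inverse (c n))) * norm y ^ (n - 1)"
    using assms(1) by (metis power_minus_mult mult.commute)
  moreover have "norm y ^ (n - 1) > 0" using False by (intro zero_less_power) linarith
  ultimately have "norm y \<le> (\<Sum>k<n. norm (c k * inverse (c n)))" by (rule mult_right_le_imp_le)
  then show ?thesis by simp
qed

lemma meromorphic_eventually_analytic:
  assumes "f meromorphic_on {z}" shows "\<forall>\<^sub>F w in at z. f analytic_on {w}"
proof -
  obtain r where r: "r > 0" "f analytic_on ball z r - {z}"
    using assms by (auto simp: meromorphic_at_iff isolated_singularity_at_def)
  then have "f analytic_on {w}" if "w \<noteq> z" "dist w z < r" for w
    using that by (intro analytic_on_subset[OF r(2)]) (auto simp: dist_commute)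
  with r(1) show ?thesis unfolding eventually_at by blast
qed

lemma meromorphic_eventually_zero_or_nonzero:
  assumes "f meromorphic_on {0}" shows "(\<forall>\<^sub>F z in at 0. f z = 0) \<or> (\<forall>\<^sub>F z in at 0. f z \<noteq> 0)"
proof -
  obtain F where F: "(\<lambda>w. f (0 + w)) has_laurent_expansion F" using assms by (auto simp: meromorphic_on_def)
  show ?thesis
    using has_laurent_expansion_eventually_zero_iff[OF F] has_laurent_expansion_eventually_nonzero_iff[OF F] by blast
qed

text \<open>The indicator function of a decidable condition is a meromorphic germ.\<close>

lemma meromorphic_decidable_eventually:
  assumes "meromorphic.decidable P" shows "(\<forall>\<^sub>F z in at 0. P z) \<or> (\<forall>\<^sub>F z in at 0. \<not> P z)"
proof -
  have "(\<lambda>z. if P z then 1 else 0 :: complex) meromorphic_on {0}"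
    using assms by (simp add: meromorphic.decidable_def)
  from meromorphic_eventually_zero_or_nonzero[OF this] show ?thesis
    by (auto elim!: eventually_mono split: if_splits)
qed

text \<open>
  The exponential function turns the punctured disc into a half plane, over which the roots of
  the squarefree part are given by holomorphic sections \<open>s\<close>. With \<open>N = fact
  n\<close> they have the period \<open>2 * pi * \<i> * N\<close>, so \<open>s (N * Ln
  z)\<close> is a well-defined function on the punctured disc. By Cauchy's bound for the roots
  it grows at most like a power of \<open>1 / norm z\<close>, so it is meromorphic at 0.
\<close>

theorem puiseux_roots:
  assumes P: "P \<in> meromorphic.families"
  shows "\<exists>N>0. \<exists>Y. finite Y \<and> (\<forall>\<eta>\<in>Y. \<eta> meromorphic_on {0}) \<and>
    (\<forall>\<^sub>F t in at_right 0. P (of_real t ^ N) \<noteq> 0 \<longrightarrow>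
       (\<forall>y. poly (P (of_real t ^ N)) y = 0 \<longrightarrow> (\<exists>\<eta>\<in>Y. y = \<eta> (of_real t))))"
proof -
  have lim: "filterlim (\<lambda>t. of_real t :: complex) (at 0) (at_right 0)"
    unfolding filterlim_at by (auto intro!: tendsto_eq_intros simp: eventually_at_filter)
  consider "\<forall>\<^sub>F z in at 0. P z = 0" | "\<forall>\<^sub>F z in at 0. P z \<noteq> 0"
    using meromorphic_decidable_eventually[OF meromorphic.decidable_poly_zero[OF P]] by blast
  then show ?thesis
  proof cases
    case 1
    then have "\<forall>\<^sub>F t in at_right 0. P (of_real t) = 0" using lim by (rule eventually_compose_filterlim)
    then show ?thesis by (intro exI[of _ 1] conjI exI[of _ "{}"]) (auto elim!: eventually_mono)
  next
    case 2
    obtain Q where Q: "Q \<in> meromorphic.families"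
      "\<And>z. P z \<noteq> 0 \<Longrightarrow> Q z \<noteq> 0 \<and> rsquarefree (Q z) \<and> (\<forall>y. poly (Q z) y = 0 \<longleftrightarrow> poly (P z) y = 0)"
      using meromorphic_squarefree_part[OF P] by blast
    obtain b where b: "\<And>z. degree (Q z) \<le> b" using meromorphic.families_bound[OF Q(1)] by blast
    \<comment> \<open>Each condition \<open>degree (Q z) = d\<close> holds near 0 or fails near 0, and only
      finitely many \<open>d\<close> are possible.\<close>
    obtain n where n: "\<forall>\<^sub>F z in at 0. degree (Q z) = n"
    proof -
      have "\<exists>d\<in>{..b}. \<forall>\<^sub>F z in at 0. degree (Q z) = d"
      proof (rule ccontr)
        assume "\<not> ?thesis"
        then have "\<forall>d\<in>{..b}. \<forall>\<^sub>F z in at 0. degree (Q z) \<noteq> d"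
          using meromorphic_decidable_eventually[OF meromorphic.decidable_degree[OF Q(1)], of "\<lambda>k. k = _"] by blast
        then have "\<forall>\<^sub>F z in at 0. \<forall>d\<in>{..b}. degree (Q z) \<noteq> d" by (simp add: eventually_ball_finite)
        then have "\<forall>\<^sub>F z::complex in at 0. False" by (rule eventually_mono) (use b in auto)
        then show False by simp
      qed
      then show thesis using that by blast
    qed
    have an: "\<forall>\<^sub>F z in at 0. \<forall>k\<in>{..b}. (\<lambda>z. coeff (Q z) k) analytic_on {z}"
      by (intro eventually_ball_finite) (use meromorphic_eventually_analytic meromorphic.familiesD[OF Q(1)] in auto)
    have "\<forall>\<^sub>F z in at 0. P z \<noteq> 0 \<and> degree (Q z) = n \<and> (\<forall>k\<in>{..b}. (\<lambda>z. coeff (Q z) k) analytic_on {z})"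
      using 2 n an by eventually_elim auto
    then obtain R where R: "R > 0" "\<And>z. z \<noteq> 0 \<Longrightarrow> norm z < R \<Longrightarrow>
        P z \<noteq> 0 \<and> degree (Q z) = n \<and> (\<forall>k\<in>{..b}. (\<lambda>z. coeff (Q z) k) analytic_on {z})"
      unfolding eventually_at by auto
    show ?thesis
    proof (cases "n = 0")
      case True
      have "poly (P z) y \<noteq> 0" if z: "z \<noteq> 0" "norm z < R" for z y
      proof -
        have "degree (Q z) = 0" "Q z \<noteq> 0" using R(2)[OF z] Q(2)[of z] True by auto
        then have "poly (Q z) y \<noteq> 0" by (metis degree_eq_zeroE pCons_0_0 poly_const_conv)
        then show ?thesis using R(2)[OF z] Q(2)[of z] by blast
      qed
      then have "\<forall>t. 0 < t \<longrightarrow> t < R \<longrightarrow> (\<forall>y. poly (P (of_real t)) y \<noteq> 0)" by auto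
      then have "\<forall>\<^sub>F t in at_right 0. \<forall>y. poly (P (of_real t)) y \<noteq> 0"
        using R(1) by (auto simp: eventually_at_right_field)
      then show ?thesis by (intro exI[of _ 1] conjI exI[of _ "{}"]) (auto elim!: eventually_mono)
    next
      case False
      define H where "H = {w::complex. Re w < ln R}"
      have expH: "exp w \<noteq> 0 \<and> norm (exp w) < R" if "w \<in> H" for w
        using that R(1) by (simp add: H_def) (metis exp_less_mono exp_ln)
      interpret squarefree_family "\<lambda>w. Q (exp w)" H n
      proof
        show "open H" unfolding H_def by (rule open_halfspace_Re_lt)
        show "convex H" unfolding H_def by (rule convex_halfspace_Re_lt)
        show "degree (Q (exp w)) = n" if "w \<in> H" for w using R(2) expH[OF that] by blast
        show "rsquarefree (Q (exp w))" if "w \<in> H" for w using R(2) Q(2) expH[OF that] by blast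
        show "0 < n" using False by simp
        show "(\<lambda>w. coeff (Q (exp w)) k) holomorphic_on H" for k
        proof (cases "k \<le> b")
          case True
          have "(\<lambda>w. coeff (Q (exp w)) k) analytic_on {w}" if "w \<in> H" for w
          proof -
            have "(\<lambda>z. coeff (Q z) k) analytic_on {exp w}" using R(2)[of "exp w"] expH[OF that] True by auto
            moreover have "exp analytic_on {w}"
              by (rule analytic_on_subset[OF _ subset_UNIV]) (simp add: analytic_on_open holomorphic_on_exp)
            ultimately show ?thesis
              using analytic_on_compose[of exp "{w}" "\<lambda>z. coeff (Q z) k"] by (simp add: o_def)
          qed
          then have "(\<lambda>w. coeff (Q (exp w)) k) analytic_on H" by (subst analytic_on_analytic_at) blast
          then show ?thesis by (rule analytic_imp_holomorphic)
        next
          case False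
          then have "coeff (Q (exp w)) k = 0" for w
            using b[of "exp w"] by (intro coeff_eq_0) auto
          then show ?thesis by simp
        qed
      qed
      define N where "N = (fact n :: nat)"
      have N: "N > 0" by (simp add: N_def)
      define w0 where "w0 = of_real (ln R - 1 :: real) + (0::complex)"
      have w0: "w0 \<in> H" by (simp add: w0_def H_def)
      obtain s where s: "\<And>y. y \<in> roots w0 \<Longrightarrow> section_of_roots (s y) \<and> s y w0 = y"
        using section_exists[OF w0] by metis
      define \<eta> where "\<eta> y z = s y (of_nat N * Ln z)" for y z
      define r where "r = min 1 R"
      have r: "r > 0" using R by (simp add: r_def)
      have small: "z ^ N \<noteq> 0 \<and> norm (z ^ N) < R \<and> of_nat N * Ln z \<in> H \<and> exp (of_nat N * Ln z) = z ^ N"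
        if "z \<noteq> 0" "norm z < r" for z :: complex
      proof -
        have "norm z ^ N \<le> norm z ^ 1" using that N by (intro power_decreasing) (auto simp: r_def)
        then have "norm z ^ N < R" using that by (simp add: r_def)
        moreover have e: "exp (of_nat N * Ln z) = z ^ N" using that by (simp add: exp_of_nat_mult)
        moreover have "of_nat N * Ln z \<in> H"
        proof -
          have "exp (Re (of_nat N * Ln z)) = norm (z ^ N)" using e by (metis norm_exp_eq_Re)
          then have "exp (Re (of_nat N * Ln z)) < exp (ln R)" using \<open>norm z ^ N < R\<close> R(1) by (simp add: norm_power)
          then show ?thesis unfolding H_def by (simp only: exp_less_cancel_iff mem_Collect_eq)
        qed
        ultimately show ?thesis using that by (simp add: norm_power)
      qed
      have \<eta>root: "\<eta> y z \<in> {x. poly (Q (z ^ N)) x = 0}" if "y \<in> roots w0" "z \<noteq> 0" "norm z < r" for y z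
        using s[OF that(1)] small[OF that(2,3)] by (auto simp: section_of_roots_def roots_def \<eta>_def)
      have periodic: "s y (w + of_nat N * (2 * of_real pi * \<i>)) = s y w" if "y \<in> roots w0" "w \<in> H" for y w
        unfolding N_def using s[OF that(1)] that(2)
        by (intro section_periodic) (auto simp: H_def exp_add exp_eq_1)
      have hol: "\<eta> y holomorphic_on ball 0 r - {0}" if y: "y \<in> roots w0" for y
      proof -
        have sh: "s y holomorphic_on H" using section_holomorphic s[OF y] by blast
        have fd: "\<eta> y field_differentiable (at z)" if z: "z \<noteq> 0" "norm z < r" for z
        proof (cases "z \<in> \<real>\<^sub>\<le>\<^sub>0")
          case False
          have "(s y \<circ> (\<lambda>z. of_nat N * Ln z)) field_differentiable (at z)"
          proof (rule field_differentiable_compose)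
            show "(\<lambda>z. of_nat N * Ln z) field_differentiable at z"
              using False by (intro derivative_intros field_differentiable_at_Ln)
            show "s y field_differentiable at (of_nat N * Ln z)"
              using sh small[OF z] open_H holomorphic_on_imp_differentiable_at by blast
          qed
          then show ?thesis by (simp add: \<eta>_def[abs_def] o_def)
        next
          case True
          \<comment> \<open>A logarithm that is holomorphic across the negative axis; periodicity makes the choice
            immaterial.\<close>
          define L where "L u = Ln (- u) + \<i> * of_real pi" for u
          have neg: "- z \<notin> \<real>\<^sub>\<le>\<^sub>0" using True z by (auto simp: complex_nonpos_Reals_iff complex_eq_iff)
          have eq: "s y (of_nat N * L u) = \<eta> y u \<and> of_nat N * L u \<in> H" if u: "u \<noteq> 0" "norm u < r" for u
          proof -
            have "L u = Ln u \<or> L u = Ln u + 2 * of_real pi * \<i>"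
              using Ln_minus[OF u(1)] by (auto simp: L_def algebra_simps split: if_splits)
            then have "of_nat N * L u = of_nat N * Ln u \<or>
                of_nat N * L u = of_nat N * Ln u + of_nat N * (2 * of_real pi * \<i>)"
              by (auto simp: algebra_simps)
            then consider "of_nat N * L u = of_nat N * Ln u"
              | "of_nat N * L u = of_nat N * Ln u + of_nat N * (2 * of_real pi * \<i>)" by blast
            then show ?thesis
            proof cases
              case 1
              have "s y (of_nat N * L u) = \<eta> y u" unfolding \<eta>_def by (rule arg_cong[OF 1])
              moreover have "of_nat N * L u \<in> H" using small[OF u] by (subst 1) blast
              ultimately show ?thesis by blast
            next
              case 2
              have "of_nat N * Ln u + of_nat N * (2 * of_real pi * \<i>) \<in> H"
                using small[OF u] by (simp add: H_def)
              then have "of_nat N * L u \<in> H" by (subst 2)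
              moreover have "s y (of_nat N * L u) = \<eta> y u"
                using periodic[OF y, of "of_nat N * Ln u"] small[OF u] unfolding \<eta>_def by (subst 2) blast
              ultimately show ?thesis by blast
            qed
          qed
          have "(s y \<circ> (\<lambda>u. of_nat N * L u)) field_differentiable (at z)"
          proof (rule field_differentiable_compose)
            have "(\<lambda>u. Ln (- u)) field_differentiable at z"
            proof -
              have "((\<lambda>u. - u) has_field_derivative - 1) (at z)" by (auto intro!: derivative_eq_intros)
              with has_field_derivative_Ln[OF neg]
              have "((\<lambda>u. Ln (- u)) has_field_derivative inverse (- z) * - 1) (at z)" by (rule DERIV_chain2)
              then show ?thesis by (auto simp: field_differentiable_def)
            qed
            then show "(\<lambda>u. of_nat N * L u) field_differentiable at z"
              unfolding L_def by (intro derivative_intros)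
            show "s y field_differentiable at (of_nat N * L z)"
              using sh eq[OF z] open_H holomorphic_on_imp_differentiable_at by blast
          qed
          then obtain D where "((\<lambda>u. s y (of_nat N * L u)) has_field_derivative D) (at z)"
            by (auto simp: field_differentiable_def o_def)
          then have "(\<eta> y has_field_derivative D) (at z)"
            by (rule has_field_derivative_transform_within_open[of _ _ _ "ball 0 r - {0}"]) (use z eq in auto)
          then show ?thesis by (auto simp: field_differentiable_def)
        qed
        show ?thesis unfolding holomorphic_on_def
          by (intro ballI, rule field_differentiable_at_within, rule fd) auto
      qed
      have mero: "\<eta> y meromorphic_on {0}" if y: "y \<in> roots w0" for y
      proof -
        \<comment> \<open>The coefficients after division by the leading one, which enter Cauchy's bound.\<close>
        define q where "q k z = coeff (Q (z ^ N)) k * inverse (coeff (Q (z ^ N)) n)" for k and z :: complex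
        have qm: "q k meromorphic_on {0}" for k
        proof -
          have "(\<lambda>z. coeff (Q (z ^ N)) k) meromorphic_on {0}" for k
            by (rule meromorphic_on_compose[of "\<lambda>z. coeff (Q z) k" "{0}" "\<lambda>z. z ^ N"])
              (use meromorphic.familiesD[OF Q(1)] N in \<open>auto intro!: analytic_intros\<close>)
          from meromorphic_on_mult[OF this[of k] meromorphic_on_inverse[OF this[of n]]]
          show ?thesis unfolding q_def .
        qed
        have "\<exists>m B. \<forall>\<^sub>F z in at 0. (\<Sum>k\<in>insert n {..<n}. norm (if k = n then 1 else q k z)) * norm z ^ m \<le> B"
        proof (rule growth_sum)
          fix k
          show "\<exists>m B. \<forall>\<^sub>F z in at 0. norm (if k = n then 1 else q k z) * norm z ^ m \<le> B"
          proof (cases "k = n")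
            case True
            then show ?thesis by (intro exI[of _ "0::nat"] exI[of _ "1::real"]) simp
          next
            case False
            then show ?thesis using meromorphic_growth[OF qm, of k] by simp
          qed
        qed auto
        then obtain m B where B: "\<forall>\<^sub>F z in at 0. (\<Sum>k\<in>insert n {..<n}. norm (if k = n then 1 else q k z)) * norm z ^ m \<le> B"
          by blast
        have "\<forall>\<^sub>F z in at 0. z \<noteq> 0 \<and> norm (z::complex) < r"
          unfolding eventually_at using r by (intro exI[of _ r]) auto
        with B have "\<forall>\<^sub>F z in at 0. norm (\<eta> y z) * norm z ^ m \<le> B"
        proof eventually_elim
          case (elim z)
          have sum: "(\<Sum>k\<in>insert n {..<n}. norm (if k = n then 1 else q k z)) = 1 + (\<Sum>k<n. norm (q k z))"
          proof -
            have "(\<Sum>k<n. norm (if k = n then 1 else q k z)) = (\<Sum>k<n. norm (q k z))"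
              by (intro sum.cong) auto
            then show ?thesis by simp
          qed
          have z: "z \<noteq> 0" "norm z < r" using elim by auto
          have d: "degree (Q (z ^ N)) = n" "Q (z ^ N) \<noteq> 0" using small[OF z] R(2)[of "z ^ N"] Q(2)[of "z ^ N"] by auto
          have "norm (\<eta> y z) \<le> 1 + (\<Sum>k<n. norm (q k z))"
            unfolding q_def
          proof (rule cauchy_root_bound)
            show "coeff (Q (z ^ N)) n \<noteq> 0" using d by (metis leading_coeff_0_iff)
            show "(\<Sum>k\<le>n. coeff (Q (z ^ N)) k * \<eta> y z ^ k) = 0"
              using \<eta>root[OF y z] poly_eq_sum_upto[of "Q (z ^ N)" n "\<eta> y z"] d by simp
          qed (use False in auto)
          then have "norm (\<eta> y z) * norm z ^ m \<le> (1 + (\<Sum>k<n. norm (q k z))) * norm z ^ m"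
            by (intro mult_right_mono) auto
          also have "\<dots> \<le> B" using elim unfolding sum by blast
          finally show ?case .
        qed
        then show ?thesis by (rule meromorphic_if_growth[OF r hol[OF y]])
      qed
      have "\<exists>\<eta>'\<in>\<eta> ` roots w0. y = \<eta>' (of_real t)"
        if t: "0 < t" "t < r" and y: "poly (P (of_real t ^ N)) y = 0" for t y
      proof -
        have z: "of_real t \<noteq> (0::complex)" "norm (of_real t :: complex) < r" using t by auto
        have "y \<in> roots (of_nat N * Ln (of_real t))"
          using y small[OF z] R(2)[of "of_real t ^ N"] Q(2)[of "of_real t ^ N"] by (auto simp: roots_def)
        also have "roots (of_nat N * Ln (of_real t)) = (\<lambda>y. s y (of_nat N * Ln (of_real t))) ` roots w0"
          by (rule all_roots_from_sections[OF w0 s]) (use small[OF z] in auto)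
        finally show ?thesis by (auto simp: \<eta>_def)
      qed
      then have "\<forall>\<^sub>F t in at_right 0. P (of_real t ^ N) \<noteq> 0 \<longrightarrow>
         (\<forall>y. poly (P (of_real t ^ N)) y = 0 \<longrightarrow> (\<exists>\<eta>'\<in>\<eta> ` roots w0. y = \<eta>' (of_real t)))"
        using r by (auto simp: eventually_at_right_field)
      then show ?thesis using N mero roots_finite_card[OF w0]
        by (intro exI[of _ N] conjI exI[of _ "\<eta> ` roots w0"]) auto
    qed
  qed
qed

section \<open>Germs of real functions and semialgebraic sets\<close>

text \<open>
  The traces on the positive half-line of meromorphic germs. They inherit the field operations,
  and they are what the coordinates of a parametrised semialgebraic branch turn out to be.
\<close>

definition real_germ :: "(real \<Rightarrow> real) \<Rightarrow> bool" where
  "real_germ u \<longleftrightarrow> (\<exists>f. f meromorphic_on {0} \<and> (\<forall>\<^sub>F t in at_right 0. of_real (u t) = f (of_real t)))"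

lemma filterlim_of_real_at_right_0:
  "filterlim (\<lambda>t. of_real t :: complex) (at 0) (at_right 0)"
  unfolding filterlim_at by (auto intro!: tendsto_eq_intros simp: eventually_at_filter)

lemma filterlim_power_at_right_0:
  assumes "N > 0" shows "filterlim (\<lambda>t::real. t ^ N) (at_right 0) (at_right 0)"
  unfolding filterlim_at using assms
  by (auto intro!: tendsto_eq_intros simp: eventually_at_filter zero_power)

lemma real_germ_const: "real_germ (\<lambda>t. c)"
  unfolding real_germ_def by (intro exI[of _ "\<lambda>z. of_real c"]) (auto intro: meromorphic_intros)

lemma real_germ_id: "real_germ (\<lambda>t. t)"
  unfolding real_germ_def by (intro exI[of _ "\<lambda>z. z"]) (auto intro: meromorphic_intros)

lemma real_germ_add:
  assumes "real_germ u" "real_germ v" shows "real_germ (\<lambda>t. u t + v t)"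
proof -
  obtain f g where "f meromorphic_on {0}" "\<forall>\<^sub>F t in at_right 0. of_real (u t) = f (of_real t)"
    "g meromorphic_on {0}" "\<forall>\<^sub>F t in at_right 0. of_real (v t) = g (of_real t)"
    using assms unfolding real_germ_def by blast
  then show ?thesis unfolding real_germ_def
    by (intro exI[of _ "\<lambda>z. f z + g z"] conjI meromorphic_intros) (auto elim: eventually_elim2)
qed

lemma real_germ_mult:
  assumes "real_germ u" "real_germ v" shows "real_germ (\<lambda>t. u t * v t)"
proof -
  obtain f g where "f meromorphic_on {0}" "\<forall>\<^sub>F t in at_right 0. of_real (u t) = f (of_real t)"
    "g meromorphic_on {0}" "\<forall>\<^sub>F t in at_right 0. of_real (v t) = g (of_real t)"
    using assms unfolding real_germ_def by blast
  then show ?thesis unfolding real_germ_def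
    by (intro exI[of _ "\<lambda>z. f z * g z"] conjI meromorphic_intros) (auto elim: eventually_elim2)
qed

lemma real_germ_inverse:
  assumes "real_germ u" shows "real_germ (\<lambda>t. inverse (u t))"
proof -
  obtain f where "f meromorphic_on {0}" "\<forall>\<^sub>F t in at_right 0. of_real (u t) = f (of_real t)"
    using assms unfolding real_germ_def by blast
  then show ?thesis unfolding real_germ_def
    by (intro exI[of _ "\<lambda>z. inverse (f z)"] conjI meromorphic_intros) (auto elim: eventually_mono)
qed

lemma real_germ_sum: "(\<And>i. i \<in> I \<Longrightarrow> real_germ (u i)) \<Longrightarrow> real_germ (\<lambda>t. \<Sum>i\<in>I. u i t)"
  by (induction I rule: infinite_finite_induct) (auto intro: real_germ_const real_germ_add)

lemma real_germ_power_substitution: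
  assumes "real_germ u" "N > 0" shows "real_germ (\<lambda>t. u (t ^ N))"
proof -
  obtain f where f: "f meromorphic_on {0}" "\<forall>\<^sub>F t in at_right 0. of_real (u t) = f (of_real t)"
    using assms unfolding real_germ_def by blast
  have "(\<lambda>z. f (z ^ N)) meromorphic_on {0}"
    by (rule meromorphic_on_compose[OF f(1)]) (use assms in \<open>auto intro!: analytic_intros\<close>)
  moreover have "\<forall>\<^sub>F t in at_right 0. of_real (u (t ^ N)) = f (of_real (t ^ N))"
    by (rule eventually_compose_filterlim[OF f(2) filterlim_power_at_right_0[OF assms(2)]])
  ultimately show ?thesis unfolding real_germ_def by (intro exI[of _ "\<lambda>z. f (z ^ N)"]) simp
qed

lemma meromorphic_cnj_cnj:
  assumes "f meromorphic_on {0}" shows "(\<lambda>z. cnj (f (cnj z))) meromorphic_on {0}"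
proof -
  obtain m r g where g: "r > 0" "g holomorphic_on ball 0 r" "\<forall>z\<in>ball 0 r - {0}. f z = g z / z ^ m"
    using assms by (auto simp: meromorphic_at_0_iff)
  have "cnj ` ball 0 r = ball (0::complex) r" by (auto simp: image_cnj_conv_vimage_cnj)
  then have "cnj \<circ> g \<circ> cnj holomorphic_on ball 0 r"
    using g by (intro holomorphic_on_compose_cnj_cnj) auto
  moreover have "cnj (f (cnj z)) = (cnj \<circ> g \<circ> cnj) z / z ^ m" if "z \<in> ball 0 r - {0}" for z
    using g(3) that by simp
  ultimately show ?thesis unfolding meromorphic_at_0_iff using g(1) by blast
qed

text \<open>
  On the real line the real part of \<open>f\<close> agrees with the mean of \<open>f\<close>
  and its conjugate, which is meromorphic.
\<close>

lemma real_germ_Re: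
  assumes "f meromorphic_on {0}" shows "real_germ (\<lambda>t. Re (f (of_real t)))"
  unfolding real_germ_def
proof (intro exI conjI)
  show "(\<lambda>z. (f z + cnj (f (cnj z))) / 2) meromorphic_on {0}"
    using assms meromorphic_cnj_cnj[OF assms] by (intro meromorphic_intros)
qed (simp add: complex_add_cnj)

text \<open>
  The zeros of a meromorphic germ that is not identically 0 do not accumulate at 0, so the
  intermediate value theorem applies.
\<close>

lemma real_germ_sign:
  assumes "real_germ u"
  shows "(\<forall>\<^sub>F t in at_right 0. u t = 0) \<or> (\<forall>\<^sub>F t in at_right 0. u t > 0) \<or> (\<forall>\<^sub>F t in at_right 0. u t < 0)"
proof -
  obtain f where f: "f meromorphic_on {0}" and uf: "\<forall>\<^sub>F t in at_right 0. of_real (u t) = f (of_real t)"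
    using assms unfolding real_germ_def by blast
  consider "\<forall>\<^sub>F z in at 0. f z = 0" | "\<forall>\<^sub>F z in at 0. f z \<noteq> 0"
    using meromorphic_eventually_zero_or_nonzero[OF f] by blast
  then show ?thesis
  proof cases
    case 1
    from eventually_compose_filterlim[OF this filterlim_of_real_at_right_0] uf
    have "\<forall>\<^sub>F t in at_right 0. u t = 0" by eventually_elim simp
    then show ?thesis by blast
  next
    case 2
    have "\<forall>\<^sub>F z in at 0. f z \<noteq> 0 \<and> f analytic_on {z}"
      using 2 meromorphic_eventually_analytic[OF f] by eventually_elim auto
    from eventually_compose_filterlim[OF this filterlim_of_real_at_right_0] uf
    have "\<forall>\<^sub>F t in at_right 0. of_real (u t) = f (of_real t) \<and> f (of_real t) \<noteq> 0 \<and> f analytic_on {of_real t}"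
      by eventually_elim auto
    then obtain R where R: "R > 0" "\<And>t. 0 < t \<Longrightarrow> t < R \<Longrightarrow>
        of_real (u t) = f (of_real t) \<and> f (of_real t) \<noteq> 0 \<and> f analytic_on {of_real t}"
      by (auto simp: eventually_at_right_field)
    have "continuous_on {0<..<R} (\<lambda>t. f (of_real t))"
    proof (rule continuous_at_imp_continuous_on, rule ballI)
      fix t assume "t \<in> {0<..<R}"
      then have "isCont f (of_real t)" using R(2) by (intro analytic_at_imp_isCont) auto
      then show "isCont (\<lambda>t. f (of_real t)) t" by (rule isCont_o2[where f = of_real, rotated]) (auto intro!: continuous_intros)
    qed
    then have "continuous_on {0<..<R} (\<lambda>t. Re (f (of_real t)))" by (intro continuous_intros)
    moreover have "Re (f (of_real t)) = u t" if "t \<in> {0<..<R}" for t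
      using R(2)[of t] that by (metis Re_complex_of_real greaterThanLessThan_iff)
    ultimately have cont: "continuous_on {0<..<R} u" by (rule continuous_on_eq)
    have nz: "u t \<noteq> 0" if "t \<in> {0<..<R}" for t using R(2)[of t] that by auto
    have conn: "connected (u ` {0<..<R})" using cont by (intro connected_continuous_image) auto
    have mem: "R / 2 \<in> {0<..<R}" using R(1) by auto
    have ev: "\<forall>\<^sub>F t in at_right 0. t \<in> {0<..<R}" using R(1) by (auto simp: eventually_at_right_field)
    show ?thesis
    proof (cases "u (R / 2) > 0")
      case True
      have "u t > 0" if t: "t \<in> {0<..<R}" for t
      proof (rule ccontr)
        assume "\<not> u t > 0"
        then have "0 \<in> u ` {0<..<R}"
          using connectedD_interval[OF conn, of "u t" "u (R/2)" 0] t mem True by force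
        then show False using nz by auto
      qed
      with ev have "\<forall>\<^sub>F t in at_right 0. u t > 0" by (auto elim: eventually_mono)
      then show ?thesis by blast
    next
      case False
      then have neg: "u (R / 2) < 0" using nz[OF mem] by auto
      have "u t < 0" if t: "t \<in> {0<..<R}" for t
      proof (rule ccontr)
        assume "\<not> u t < 0"
        then have "0 \<in> u ` {0<..<R}"
          using connectedD_interval[OF conn, of "u (R/2)" "u t" 0] t mem neg by force
        then show False using nz by auto
      qed
      with ev have "\<forall>\<^sub>F t in at_right 0. u t < 0" by (auto elim: eventually_mono)
      then show ?thesis by blast
    qed
  qed
qed

lemma real_germ_rational:
  fixes u :: "real \<Rightarrow> real^'n::finite"
  assumes "f \<in> rational_functions" "\<And>i. real_germ (\<lambda>t. u t $ i)"
  shows "real_germ (\<lambda>t. f (u t))"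
  using assms(1)
proof induction
  case (poly f)
  then show ?case
  proof induction
    case (linear f)
    then have "f (u t) = (\<Sum>j\<in>UNIV. u t $ j * f (axis j 1))" for t
      by (intro linear_functional_eq_sum bounded_linear.linear)
    moreover have "real_germ (\<lambda>t. \<Sum>j\<in>UNIV. u t $ j * f (axis j 1))"
      by (intro real_germ_sum real_germ_mult assms(2) real_germ_const)
    ultimately show ?case by simp
  qed (auto intro: real_germ_const real_germ_add real_germ_mult)
qed (auto intro: real_germ_inverse real_germ_add real_germ_mult)

lemma real_germ_semialgebraic:
  fixes u :: "real \<Rightarrow> real^'n::finite"
  assumes "semialgebraic A" "\<And>i. real_germ (\<lambda>t. u t $ i)"
  shows "(\<forall>\<^sub>F t in at_right 0. u t \<in> A) \<or> (\<forall>\<^sub>F t in at_right 0. u t \<notin> A)"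
  using assms(1) unfolding semialgebraic_def
proof induction
  case (base A)
  then obtain f where f: "A = {x. f x > 0}" "real_polynomial_function f" by blast
  have "real_germ (\<lambda>t. f (u t))"
    by (rule real_germ_rational[OF rational_functions.poly[OF f(2)] assms(2)])
  from real_germ_sign[OF this]
  consider "\<forall>\<^sub>F t in at_right 0. f (u t) = 0" | "\<forall>\<^sub>F t in at_right 0. f (u t) > 0"
    | "\<forall>\<^sub>F t in at_right 0. f (u t) < 0" by blast
  then show ?case
  proof cases
    case 1
    then have "\<forall>\<^sub>F t in at_right 0. u t \<notin> A" unfolding f(1) by eventually_elim simp
    then show ?thesis by blast
  next
    case 2
    then show ?thesis unfolding f(1) by simp
  next
    case 3
    then have "\<forall>\<^sub>F t in at_right 0. u t \<notin> A" unfolding f(1) by eventually_elim simp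
    then show ?thesis by blast
  qed
next
  case (Compl A)
  then show ?case by auto
next
  case (Un A B)
  have "\<forall>\<^sub>F t in at_right 0. u t \<in> A \<union> B"
    if "(\<forall>\<^sub>F t in at_right 0. u t \<in> A) \<or> (\<forall>\<^sub>F t in at_right 0. u t \<in> B)"
    using that by (elim disjE) (erule eventually_mono, simp)+
  moreover have "\<forall>\<^sub>F t in at_right 0. u t \<notin> A \<union> B"
    if "\<forall>\<^sub>F t in at_right 0. u t \<notin> A" "\<forall>\<^sub>F t in at_right 0. u t \<notin> B"
    using that by eventually_elim simp
  ultimately show ?case using Un.IH by argo
qed

section \<open>Choosing points of a semialgebraic set along germs\<close>

text \<open>
  The polynomials have constant signs on the intervals into which \<open>R\<close> divides the
  line. The candidates meet all of these: midpoints for the bounded ones, \<open>r + 1\<close>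
  and \<open>r - 1\<close> for the unbounded ones, and 0 if \<open>R\<close> is empty.
\<close>

lemma sample_point:
  fixes y :: real and R :: "real set"
  assumes fin: "finite R" and J: "\<And>p x. p \<in> J \<Longrightarrow> p \<noteq> 0 \<Longrightarrow> poly p x = 0 \<Longrightarrow> x \<in> R"
  shows "\<exists>s \<in> insert 0 (R \<union> (\<lambda>r. r + 1) ` R \<union> (\<lambda>r. r - 1) ` R \<union> (\<lambda>(r, r'). (r + r') / 2) ` (R \<times> R)).
    \<forall>p\<in>J. sgn (poly p s) = sgn (poly p y)"
proof -
  have same: "\<forall>p\<in>J. sgn (poly p s) = sgn (poly p y)"
    if "\<And>x. min s y \<le> x \<Longrightarrow> x \<le> max s y \<Longrightarrow> x \<notin> R" for s
  proof
    fix p assume p: "p \<in> J"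
    show "sgn (poly p s) = sgn (poly p y)"
    proof (cases "p = 0")
      case False
      then show ?thesis using J[OF p] that by (intro poly_sgn_eq_if_no_root_between) blast
    qed simp
  qed
  define A where "A = {r\<in>R. r < y}"
  define B where "B = {r\<in>R. y < r}"
  have AB: "finite A" "finite B" using fin by (auto simp: A_def B_def)
  consider "y \<in> R" | "y \<notin> R" "A = {}" "B = {}" | "y \<notin> R" "A \<noteq> {}" "B = {}"
    | "y \<notin> R" "A = {}" "B \<noteq> {}" | "y \<notin> R" "A \<noteq> {}" "B \<noteq> {}" by blast
  then show ?thesis
  proof cases
    case 1
    then show ?thesis by blast
  next
    case 2
    then have "R = {}" by (auto simp: A_def B_def) (metis linorder_neqE)
    then show ?thesis using same[of 0] by blast
  next
    case 3
    define a where "a = Max A"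
    have a: "a \<in> A" "\<And>x. x \<in> A \<Longrightarrow> x \<le> a" using 3 AB by (auto simp: a_def)
    have "x \<notin> R" if "min (a + 1) y \<le> x" "x \<le> max (a + 1) y" for x
    proof
      assume "x \<in> R"
      with 3 have "x \<in> A" unfolding A_def B_def by (metis (mono_tags, lifting) empty_Collect_eq linorder_neqE mem_Collect_eq)
      then have "x \<le> a" using a by blast
      moreover have "a < min (a + 1) y" using a(1) by (auto simp: A_def)
      ultimately show False using that by linarith
    qed
    then have "\<forall>p\<in>J. sgn (poly p (a + 1)) = sgn (poly p y)" by (rule same)
    moreover have "a \<in> R" using a by (simp add: A_def)
    ultimately show ?thesis by blast
  next
    case 4
    define b where "b = Min B"
    have b: "b \<in> B" "\<And>x. x \<in> B \<Longrightarrow> b \<le> x" using 4 AB by (auto simp: b_def)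
    have "x \<notin> R" if "min (b - 1) y \<le> x" "x \<le> max (b - 1) y" for x
    proof
      assume "x \<in> R"
      with 4 have "x \<in> B" unfolding A_def B_def by (metis (mono_tags, lifting) empty_Collect_eq linorder_neqE mem_Collect_eq)
      then have "b \<le> x" using b by blast
      moreover have "max (b - 1) y < b" using b(1) by (auto simp: B_def)
      ultimately show False using that by linarith
    qed
    then have "\<forall>p\<in>J. sgn (poly p (b - 1)) = sgn (poly p y)" by (rule same)
    moreover have "b \<in> R" using b by (simp add: B_def)
    ultimately show ?thesis by blast
  next
    case 5
    define a where "a = Max A"
    define b where "b = Min B"
    have a: "a \<in> A" "\<And>x. x \<in> A \<Longrightarrow> x \<le> a" using 5 AB by (auto simp: a_def)
    have b: "b \<in> B" "\<And>x. x \<in> B \<Longrightarrow> b \<le> x" using 5 AB by (auto simp: b_def)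
    have ab: "a < y" "y < b" using a b by (auto simp: A_def B_def)
    have "x \<notin> R" if "min ((a + b) / 2) y \<le> x" "x \<le> max ((a + b) / 2) y" for x
    proof
      assume xR: "x \<in> R"
      have "a < min ((a + b) / 2) y" "max ((a + b) / 2) y < b" using ab by auto
      then have "a < x" "x < b" using that by (blast intro: less_le_trans le_less_trans)+
      moreover have "x \<in> A \<or> x \<in> B" using xR 5 unfolding A_def B_def by (metis (mono_tags, lifting) linorder_neqE mem_Collect_eq)
      ultimately show False using a b by force
    qed
    then have "\<forall>p\<in>J. sgn (poly p ((a + b) / 2)) = sgn (poly p y)" by (rule same)
    moreover have "(a + b) / 2 \<in> (\<lambda>(r, r'). (r + r') / 2) ` (R \<times> R)"
      using a b by (auto simp: A_def B_def intro!: image_eqI[of _ _ "(a, b)"])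
    ultimately show ?thesis by blast
  qed
qed

text \<open>
  A real root is the value of one of the complex Puiseux branches, hence of its real part.
\<close>

lemma real_roots_along_germs:
  fixes P :: "real \<Rightarrow> real poly"
  assumes coeff: "\<And>k. real_germ (\<lambda>t. coeff (P t) k)" and deg: "\<And>t. degree (P t) \<le> n"
  shows "\<exists>N>0. \<exists>Y. finite Y \<and> (\<forall>v\<in>Y. real_germ v) \<and>
    (\<forall>\<^sub>F t in at_right 0. P (t ^ N) \<noteq> 0 \<longrightarrow> (\<forall>y. poly (P (t ^ N)) y = 0 \<longrightarrow> (\<exists>v\<in>Y. y = v t)))"
proof -
  have "\<forall>k. \<exists>f. f meromorphic_on {0} \<and> (\<forall>\<^sub>F t in at_right 0. of_real (coeff (P t) k) = f (of_real t))"
    using coeff unfolding real_germ_def by blast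
  then obtain f where f: "\<And>k. f k meromorphic_on {0}"
    "\<And>k. \<forall>\<^sub>F t in at_right 0. of_real (coeff (P t) k) = f k (of_real t)" by metis
  define Q where "Q z = (\<Sum>k\<le>n. monom (f k z) k)" for z
  have Qc: "coeff (Q z) k = (if k \<le> n then f k z else 0)" for z k
    by (auto simp: Q_def coeff_sum coeff_monom)
  have "Q \<in> meromorphic.families"
  proof (rule meromorphic.familiesI)
    show "(\<lambda>z. coeff (Q z) k) \<in> {f. f meromorphic_on {0}}" for k
      using f(1)[of k] by (cases "k \<le> n") (auto simp: Qc)
    show "degree (Q z) \<le> n" for z by (rule degree_le) (simp add: Qc)
  qed
  from puiseux_roots[OF this] obtain N Y where N: "N > 0" and Y: "finite Y" "\<forall>\<eta>\<in>Y. \<eta> meromorphic_on {0}"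
    and roots: "\<forall>\<^sub>F t in at_right 0. Q (of_real t ^ N) \<noteq> 0 \<longrightarrow>
       (\<forall>y. poly (Q (of_real t ^ N)) y = 0 \<longrightarrow> (\<exists>\<eta>\<in>Y. y = \<eta> (of_real t)))" by blast
  have "\<forall>\<^sub>F t in at_right 0. \<forall>k\<in>{..n}. of_real (coeff (P t) k) = f k (of_real t)"
    using f(2) by (intro eventually_ball_finite) auto
  from eventually_compose_filterlim[OF this filterlim_power_at_right_0[OF N]]
  have cf: "\<forall>\<^sub>F t in at_right 0. \<forall>k\<in>{..n}. of_real (coeff (P (t ^ N)) k) = f k (of_real (t ^ N))" .
  define Y' where "Y' = (\<lambda>\<eta> t. Re (\<eta> (of_real t :: complex))) ` Y"
  have "\<forall>\<^sub>F t in at_right 0. P (t ^ N) \<noteq> 0 \<longrightarrow> (\<forall>y. poly (P (t ^ N)) y = 0 \<longrightarrow> (\<exists>v\<in>Y'. y = v t))"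
    using roots cf
  proof eventually_elim
    case (elim t)
    have ev: "poly (Q (of_real t ^ N)) (of_real y) = of_real (poly (P (t ^ N)) y)" for y
    proof -
      have "poly (Q (of_real t ^ N)) (of_real y) = (\<Sum>k\<le>n. f k (of_real (t ^ N)) * of_real y ^ k)"
        by (simp add: Q_def poly_sum poly_monom)
      also have "\<dots> = (\<Sum>k\<le>n. of_real (coeff (P (t ^ N)) k) * of_real y ^ k)"
        using elim by (intro sum.cong) auto
      also have "\<dots> = of_real (poly (P (t ^ N)) y)"
        using poly_eq_sum_upto[OF deg, of "t ^ N" y] by simp
      finally show ?thesis .
    qed
    show ?case
    proof (intro impI allI)
      fix y assume "P (t ^ N) \<noteq> 0" "poly (P (t ^ N)) y = 0"
      then have "Q (of_real t ^ N) \<noteq> 0" using ev by (metis of_real_eq_0_iff poly_0 poly_all_0_iff_0)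
      moreover have "poly (Q (of_real t ^ N)) (of_real y) = 0" using ev \<open>poly (P (t ^ N)) y = 0\<close> by simp
      ultimately obtain \<eta> where "\<eta> \<in> Y" "of_real y = \<eta> (of_real t)" using elim(1) by blast
      then show "\<exists>v\<in>Y'. y = v t" unfolding Y'_def by (metis Re_complex_of_real image_eqI)
    qed
  qed
  moreover have "\<forall>v\<in>Y'. real_germ v" "finite Y'" using Y real_germ_Re by (auto simp: Y'_def)
  ultimately show ?thesis using N by blast
qed

lemma real_germ_poly_family:
  fixes u :: "real \<Rightarrow> real^'n::finite"
  assumes F: "F \<in> rational.families" and u: "\<And>i. real_germ (\<lambda>t. u t $ i)"
  shows "real_germ (\<lambda>t. coeff (F (u t)) k)"
  using real_germ_rational[OF rational.familiesD[OF F] u] .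

lemma eventually_poly_zero_or_nonzero:
  fixes P :: "real \<Rightarrow> real poly"
  assumes coeff: "\<And>k. real_germ (\<lambda>t. coeff (P t) k)" and deg: "\<And>t. degree (P t) \<le> n"
  shows "(\<forall>\<^sub>F t in at_right 0. P t = 0) \<or> (\<forall>\<^sub>F t in at_right 0. P t \<noteq> 0)"
proof (cases "\<forall>k\<in>{..n}. \<forall>\<^sub>F t in at_right 0. coeff (P t) k = 0")
  case True
  then have "\<forall>\<^sub>F t in at_right 0. \<forall>k\<in>{..n}. coeff (P t) k = 0" by (simp add: eventually_ball_finite)
  then have "\<forall>\<^sub>F t in at_right 0. P t = 0"
    by (rule eventually_mono) (metis atMost_iff deg leading_coeff_0_iff)
  then show ?thesis by blast
next
  case False
  then obtain k where "\<not> (\<forall>\<^sub>F t in at_right 0. coeff (P t) k = 0)" by blast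
  with real_germ_sign[OF coeff, of k] have "\<forall>\<^sub>F t in at_right 0. coeff (P t) k \<noteq> 0"
    by (auto elim: eventually_mono)
  then have "\<forall>\<^sub>F t in at_right 0. P t \<noteq> 0" by (auto elim: eventually_mono)
  then show ?thesis by blast
qed

text \<open>
  Along \<open>u\<close> the condition on the coordinate \<open>y\<close> is a condition on the
  signs of finitely many polynomials in \<open>y\<close> with coefficients that are germs. After
  the substitution of \<open>t ^ N\<close> their roots are germs, and so are the finitely many
  sample points built from these roots. For every small \<open>t\<close> one of the samples is
  admissible. As each of them is either eventually admissible or eventually not, one is
  admissible for all small \<open>t\<close>.
\<close>

lemma choose_coordinate:
  fixes u :: "real \<Rightarrow> real^'n::finite"
  assumes A: "semialgebraic A" and u: "\<And>i. real_germ (\<lambda>t. u t $ i)"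
    and ex: "\<forall>\<^sub>F t in at_right 0. \<exists>y. vec_upd (u t) k y \<in> A"
  shows "\<exists>N>0. \<exists>v. real_germ v \<and> (\<forall>\<^sub>F t in at_right 0. vec_upd (u (t ^ N)) k (v t) \<in> A)"
proof -
  obtain C where C: "finite C" "C \<subseteq> Collect real_polynomial_function"
    "\<And>x x'. (\<forall>c\<in>C. sgn (c x) = sgn (c x')) \<Longrightarrow> x \<in> A \<longleftrightarrow> x' \<in> A"
    using semialgebraic_imp_sign_determined[OF A] by blast
  have "\<forall>c\<in>C. \<exists>F\<in>rational.families. \<forall>x y. poly (F x) y = c (vec_upd x k y)"
    using C(2) poly_in_one_coordinate by blast
  then obtain F where F: "\<And>c. c \<in> C \<Longrightarrow> F c \<in> rational.families"
    "\<And>c x y. c \<in> C \<Longrightarrow> poly (F c x) y = c (vec_upd x k y)" by metis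
  \<comment> \<open>Polynomials that vanish identically along \<open>u\<close> impose no condition and would
    spoil the product \<open>P\<close>.\<close>
  define C0 where "C0 = {c\<in>C. \<forall>\<^sub>F t in at_right 0. F c (u t) \<noteq> 0}"
  define P where "P t = (\<Prod>c\<in>C0. F c (u t))" for t
  have "(\<lambda>x. \<Prod>c\<in>C0. F c x) \<in> rational.families"
    by (rule rational.families_prod) (use F in \<open>auto simp: C0_def\<close>)
  then obtain n where n: "\<And>t. degree (P t) \<le> n" and Pc: "\<And>k. real_germ (\<lambda>t. coeff (P t) k)"
    unfolding P_def using rational.families_bound real_germ_poly_family[OF _ u] by meson
  obtain N Y where N: "N > 0" and Y: "finite Y" "\<forall>v\<in>Y. real_germ v"
    and roots: "\<forall>\<^sub>F t in at_right 0. P (t ^ N) \<noteq> 0 \<longrightarrow> (\<forall>y. poly (P (t ^ N)) y = 0 \<longrightarrow> (\<exists>v\<in>Y. y = v t))"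
    using real_roots_along_germs[OF Pc n] by blast
  define S where "S = insert (\<lambda>t. 0) (Y \<union> (\<lambda>v t. v t + 1) ` Y \<union> (\<lambda>v t. v t - 1) ` Y \<union>
    (\<lambda>(v, v') t. (v t + v' t) / 2) ` (Y \<times> Y))"
  have finS: "finite S" using Y by (simp add: S_def)
  have germS: "real_germ v" if "v \<in> S" for v
  proof -
    have d: "real_germ (\<lambda>t. v t - 1)" if "real_germ v" for v
      using real_germ_add[OF that real_germ_const[of "-1"]] by simp
    have h: "real_germ (\<lambda>t. (v t + v' t) / 2)" if "real_germ v" "real_germ v'" for v v'
      using real_germ_mult[OF real_germ_add[OF that] real_germ_const[of "1/2"]] by simp
    show ?thesis using that Y by (auto simp: S_def intro: real_germ_const real_germ_add d h)
  qed
  have "\<forall>\<^sub>F t in at_right 0. \<forall>c\<in>C. F c (u t) = 0 \<or> c \<in> C0 \<and> F c (u t) \<noteq> 0"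
  proof (intro eventually_ball_finite C(1) ballI)
    fix c assume c: "c \<in> C"
    obtain m where "\<And>t. degree (F c (u t)) \<le> m" using rational.families_bound[OF F(1)[OF c]] by blast
    from eventually_poly_zero_or_nonzero[OF real_germ_poly_family[OF F(1)[OF c] u] this]
    show "\<forall>\<^sub>F t in at_right 0. F c (u t) = 0 \<or> c \<in> C0 \<and> F c (u t) \<noteq> 0"
      using c by (auto simp: C0_def elim: eventually_mono)
  qed
  moreover have "\<forall>\<^sub>F t in at_right 0. \<forall>c\<in>C0. F c (u t) \<noteq> 0"
    by (intro eventually_ball_finite) (use C(1) in \<open>auto simp: C0_def\<close>)
  ultimately have "\<forall>\<^sub>F t in at_right 0. (\<exists>y. vec_upd (u t) k y \<in> A) \<and>
      (\<forall>c\<in>C. F c (u t) = 0 \<or> c \<in> C0) \<and> (\<forall>c\<in>C0. F c (u t) \<noteq> 0)"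
    using ex by eventually_elim auto
  from eventually_compose_filterlim[OF this filterlim_power_at_right_0[OF N]] roots
  have some: "\<forall>\<^sub>F t in at_right 0. \<exists>v\<in>S. vec_upd (u (t ^ N)) k (v t) \<in> A"
  proof eventually_elim
    case (elim t)
    obtain y where y: "vec_upd (u (t ^ N)) k y \<in> A" using elim by blast
    have P0: "P (t ^ N) \<noteq> 0" using elim C(1) by (simp add: P_def C0_def)
    let ?R = "(\<lambda>v. v t) ` Y"
    have "\<exists>s\<in>insert 0 (?R \<union> (\<lambda>r. r + 1) ` ?R \<union> (\<lambda>r. r - 1) ` ?R \<union> (\<lambda>(r, r'). (r + r') / 2) ` (?R \<times> ?R)).
      \<forall>p\<in>(\<lambda>c. F c (u (t ^ N))) ` C. sgn (poly p s) = sgn (poly p y)"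
    proof (rule sample_point)
      fix p x assume "p \<in> (\<lambda>c. F c (u (t ^ N))) ` C" "p \<noteq> 0" "poly p x = 0"
      then obtain c where c: "c \<in> C" "p = F c (u (t ^ N))" by blast
      then have "c \<in> C0" using elim \<open>p \<noteq> 0\<close> by blast
      then have "poly (P (t ^ N)) x = 0"
        using \<open>poly p x = 0\<close> C(1) c by (auto simp: P_def C0_def poly_prod)
      then show "x \<in> ?R" using elim P0 by blast
    qed (use Y in simp)
    then obtain s where s: "s \<in> insert 0 (?R \<union> (\<lambda>r. r + 1) ` ?R \<union> (\<lambda>r. r - 1) ` ?R \<union> (\<lambda>(r, r'). (r + r') / 2) ` (?R \<times> ?R))"
      "\<forall>p\<in>(\<lambda>c. F c (u (t ^ N))) ` C. sgn (poly p s) = sgn (poly p y)" by (elim bexE) (rule that)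
    have "\<exists>v\<in>S. s = v t" using s(1) unfolding S_def by auto
    moreover have "vec_upd (u (t ^ N)) k s \<in> A" using s(2) F(2) C(3)[of "vec_upd (u (t ^ N)) k s" "vec_upd (u (t ^ N)) k y"] y by simp
    ultimately show ?case by blast
  qed
  have "\<exists>v\<in>S. \<forall>\<^sub>F t in at_right 0. vec_upd (u (t ^ N)) k (v t) \<in> A"
  proof (rule ccontr)
    assume neg: "\<not> ?thesis"
    have "\<forall>\<^sub>F t in at_right 0. vec_upd (u (t ^ N)) k (v t) \<notin> A" if "v \<in> S" for v
    proof -
      have "real_germ (\<lambda>t. vec_upd (u (t ^ N)) k (v t) $ i)" for i
        using germS[OF that] real_germ_power_substitution[OF u N, of i]
        by (cases "i = k") (auto simp: vec_upd_nth)
      from real_germ_semialgebraic[OF A this] neg that show ?thesis by blast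
    qed
    then have "\<forall>\<^sub>F t in at_right 0. \<forall>v\<in>S. vec_upd (u (t ^ N)) k (v t) \<notin> A"
      using finS by (intro eventually_ball_finite) auto
    with some have "\<forall>\<^sub>F t::real in at_right 0. False" by eventually_elim blast
    then show False by simp
  qed
  then show ?thesis using N germS by blast
qed

text \<open>
  The coordinates in \<open>I\<close> are chosen one at a time. That the remaining ones can
  still be chosen is a semialgebraic condition by the Tarski-Seidenberg theorem. The exponents
  of the substitutions multiply.
\<close>

theorem choose_along_germ:
  fixes u :: "real \<Rightarrow> real^'n::finite"
  assumes A: "semialgebraic A" and u: "\<And>i. real_germ (\<lambda>t. u t $ i)"
    and ex: "\<forall>\<^sub>F t in at_right 0. \<exists>x\<in>A. \<forall>j. j \<notin> I \<longrightarrow> x $ j = u t $ j"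
  shows "\<exists>N>0. \<exists>v. (\<forall>i. real_germ (\<lambda>t. v t $ i)) \<and>
    (\<forall>\<^sub>F t in at_right 0. v t \<in> A \<and> (\<forall>j. j \<notin> I \<longrightarrow> v t $ j = u (t ^ N) $ j))"
proof -
  have "finite I" by simp
  then show ?thesis using u ex
  proof (induction I arbitrary: u rule: finite_induct)
    case empty
    then have "\<forall>\<^sub>F t in at_right 0. u t \<in> A \<and> (\<forall>j. j \<notin> {} \<longrightarrow> u t $ j = u (t ^ 1) $ j)"
      by (auto elim!: eventually_mono simp: vec_eq_iff) (metis vec_eq_iff)
    then show ?case using empty.prems(1) by (intro exI[of _ 1] conjI exI[of _ u]) auto
  next
    case (insert i I)
    define B where "B = {x. \<exists>z\<in>A. \<forall>j. j \<notin> I \<longrightarrow> z $ j = x $ j}"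
    have B: "semialgebraic B" unfolding B_def by (rule semialgebraic_project_set[OF A])
    have "\<forall>\<^sub>F t in at_right 0. \<exists>y. vec_upd (u t) i y \<in> B"
      using insert.prems(2)
    proof eventually_elim
      case (elim t)
      then obtain x where x: "x \<in> A" "\<forall>j. j \<notin> insert i I \<longrightarrow> x $ j = u t $ j" by blast
      then have "\<forall>j. j \<notin> I \<longrightarrow> x $ j = vec_upd (u t) i (x $ i) $ j" by (auto simp: vec_upd_nth)
      with x show ?case unfolding B_def by blast
    qed
    from choose_coordinate[OF B insert.prems(1) this] obtain N1 s where N1: "N1 > 0" and s: "real_germ s"
      and inB: "\<forall>\<^sub>F t in at_right 0. vec_upd (u (t ^ N1)) i (s t) \<in> B" by blast
    define u' where "u' t = vec_upd (u (t ^ N1)) i (s t)" for t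
    have "real_germ (\<lambda>t. u' t $ j)" for j
      using s real_germ_power_substitution[OF insert.prems(1) N1, of j]
      by (cases "j = i") (auto simp: u'_def vec_upd_nth)
    moreover have "\<forall>\<^sub>F t in at_right 0. \<exists>x\<in>A. \<forall>j. j \<notin> I \<longrightarrow> x $ j = u' t $ j"
      using inB by (simp add: B_def u'_def)
    ultimately obtain N2 and v :: "real \<Rightarrow> real^'n" where N2: "N2 > 0" and v: "\<forall>i. real_germ (\<lambda>t. v t $ i)"
      "\<forall>\<^sub>F t in at_right 0. v t \<in> A \<and> (\<forall>j. j \<notin> I \<longrightarrow> v t $ j = u' (t ^ N2) $ j)"
      using insert.IH[of u'] by blast
    have "\<forall>\<^sub>F t in at_right 0. v t \<in> A \<and> (\<forall>j. j \<notin> insert i I \<longrightarrow> v t $ j = u (t ^ (N2 * N1)) $ j)"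
      using v(2) by (rule eventually_mono) (auto simp: u'_def vec_upd_nth power_mult)
    then show ?case using N1 N2 v(1) by (intro exI[of _ "N2 * N1"] conjI exI[of _ v]) auto
  qed
qed

section \<open>Analytic germs\<close>

text \<open>
  Analyticity is expressed by a holomorphic extension. This gives the identity theorem and the
  comparison with meromorphic germs; the power series definition is recovered in
  \<open>real_analytic_at_iff\<close>.
\<close>

definition analytic_germ :: "(real \<Rightarrow> real) \<Rightarrow> bool" where
  "analytic_germ u \<longleftrightarrow> (\<exists>f. f analytic_on {0} \<and> (\<forall>\<^sub>F s in nhds 0. of_real (u s) = f (of_real s)))"

definition analytic_curve :: "(real \<Rightarrow> real^'n::finite) \<Rightarrow> bool" where
  "analytic_curve \<alpha> \<longleftrightarrow> (\<forall>i. analytic_germ (\<lambda>s. \<alpha> s $ i))"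

lemma analytic_germ_const: "analytic_germ (\<lambda>s. c)"
  unfolding analytic_germ_def by (intro exI[of _ "\<lambda>z. of_real c"]) auto

lemma analytic_germ_add:
  assumes "analytic_germ u" "analytic_germ v" shows "analytic_germ (\<lambda>t. u t + v t)"
proof -
  obtain f g where "f analytic_on {0}" "\<forall>\<^sub>F t in nhds 0. of_real (u t) = f (of_real t)"
    "g analytic_on {0}" "\<forall>\<^sub>F t in nhds 0. of_real (v t) = g (of_real t)"
    using assms unfolding analytic_germ_def by blast
  then show ?thesis unfolding analytic_germ_def
    by (intro exI[of _ "\<lambda>z. f z + g z"] conjI analytic_intros) (auto elim: eventually_elim2)
qed

lemma analytic_germ_mult:
  assumes "analytic_germ u" "analytic_germ v" shows "analytic_germ (\<lambda>t. u t * v t)"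
proof -
  obtain f g where "f analytic_on {0}" "\<forall>\<^sub>F t in nhds 0. of_real (u t) = f (of_real t)"
    "g analytic_on {0}" "\<forall>\<^sub>F t in nhds 0. of_real (v t) = g (of_real t)"
    using assms unfolding analytic_germ_def by blast
  then show ?thesis unfolding analytic_germ_def
    by (intro exI[of _ "\<lambda>z. f z * g z"] conjI analytic_intros) (auto elim: eventually_elim2)
qed

lemma analytic_germ_inverse:
  assumes "analytic_germ u" "u 0 \<noteq> 0" shows "analytic_germ (\<lambda>t. inverse (u t))"
proof -
  obtain f where f: "f analytic_on {0}" "\<forall>\<^sub>F t in nhds 0. of_real (u t) = f (of_real t)"
    using assms unfolding analytic_germ_def by blast
  have "f 0 \<noteq> 0" using eventually_nhds_x_imp_x[OF f(2)] assms(2) by (metis of_real_0 of_real_eq_0_iff)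
  then have "(\<lambda>z. inverse (f z)) analytic_on {0}" using f(1) by (intro analytic_intros) auto
  moreover have "\<forall>\<^sub>F t in nhds 0. of_real (inverse (u t)) = inverse (f (of_real t))"
    using f(2) by eventually_elim simp
  ultimately show ?thesis unfolding analytic_germ_def by (intro exI[of _ "\<lambda>z. inverse (f z)"]) simp
qed

lemma analytic_germ_divide:
  "analytic_germ u \<Longrightarrow> analytic_germ v \<Longrightarrow> v 0 \<noteq> 0 \<Longrightarrow> analytic_germ (\<lambda>t. u t / v t)"
  using analytic_germ_mult[OF _ analytic_germ_inverse, of u v] by (simp add: divide_inverse)

lemma analytic_germ_sum: "(\<And>i. i \<in> I \<Longrightarrow> analytic_germ (u i)) \<Longrightarrow> analytic_germ (\<lambda>t. \<Sum>i\<in>I. u i t)"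
  by (induction I rule: infinite_finite_induct) (auto intro: analytic_germ_const analytic_germ_add)

lemma analytic_germ_power: "analytic_germ u \<Longrightarrow> analytic_germ (\<lambda>t. u t ^ n)"
  by (induction n) (auto intro: analytic_germ_const analytic_germ_mult)

lemma analytic_germ_isCont:
  assumes "analytic_germ u" shows "isCont u 0"
proof -
  obtain f where f: "f analytic_on {0}" "\<forall>\<^sub>F t in nhds 0. of_real (u t) = f (of_real t)"
    using assms unfolding analytic_germ_def by blast
  have "isCont f (of_real 0)" using f(1) by (simp add: analytic_at_imp_isCont)
  then have "isCont (\<lambda>t. f (of_real t)) 0"
    by (rule isCont_o2[where f = of_real, rotated]) (auto intro!: continuous_intros)
  then have *: "isCont (\<lambda>t. Re (f (of_real t))) 0" by (rule continuous_Re)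
  have "\<forall>\<^sub>F t in nhds 0. Re (f (of_real t)) = u t"
    using f(2) by eventually_elim (metis Re_complex_of_real)
  from isCont_cong[OF this] * show ?thesis by simp
qed

text \<open>
  The germ of \<open>u\<close> at 0 represents analytic germs at all nearby points
  \<open>t\<close>. The scaling by \<open>c\<close> serves to stretch a germ to an arc defined
  on a given interval.
\<close>

lemma analytic_germ_affine_substitution:
  assumes u: "analytic_germ u" shows "\<forall>\<^sub>F t in nhds 0. \<forall>c. analytic_germ (\<lambda>s. u (t + c * s))"
proof -
  obtain f where f: "f analytic_on {0}" "\<forall>\<^sub>F t in nhds 0. of_real (u t) = f (of_real t)"
    using u unfolding analytic_germ_def by blast
  obtain r where r: "r > 0" "f holomorphic_on ball 0 r" using f(1) by (auto simp: analytic_at_ball)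
  obtain e where e: "e > 0" "\<And>t. \<bar>t\<bar> < e \<Longrightarrow> of_real (u t) = f (of_real t)"
    using f(2) by (auto simp: eventually_nhds_metric)
  have "analytic_germ (\<lambda>s. u (t + c * s))" if t: "\<bar>t\<bar> < min r e" for t c
  proof -
    have "f analytic_on {of_real t}"
      using r t by (auto simp: analytic_at intro!: exI[of _ "ball 0 r"])
    then have "(f \<circ> (\<lambda>z. of_real t + of_real c * z)) analytic_on {0}"
      by (intro analytic_on_compose analytic_intros) auto
    moreover have "\<forall>\<^sub>F s in nhds 0. of_real (u (t + c * s)) = f (of_real t + of_real c * of_real s)"
    proof -
      have "((\<lambda>s. t + c * s) \<longlongrightarrow> t + c * 0) (nhds 0)" by (intro tendsto_intros filterlim_ident)
      then have "\<forall>\<^sub>F s in nhds 0. t + c * s \<in> {-e<..<e}"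
        by (rule topological_tendstoD) (use t in auto)
      then show ?thesis
      proof eventually_elim
        case (elim s)
        then show ?case using e(2)[of "t + c * s"] by (simp add: abs_less_iff)
      qed
    qed
    ultimately show ?thesis unfolding analytic_germ_def by (auto simp: o_def)
  qed
  then show ?thesis unfolding eventually_nhds_metric using r e
    by (intro exI[of _ "min r e"]) (auto simp: dist_norm)
qed

lemma analytic_germ_reflect:
  assumes "analytic_germ u" shows "analytic_germ (\<lambda>s. u (- s))"
  using eventually_nhds_x_imp_x[OF analytic_germ_affine_substitution[OF assms]]
  by (metis (no_types, lifting) add_0 ext mult_minus1)

lemma analytic_germ_imp_real_germ:
  assumes "analytic_germ u" shows "real_germ u"
proof -
  obtain f where f: "f analytic_on {0}" "\<forall>\<^sub>F t in nhds 0. of_real (u t) = f (of_real t)"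
    using assms unfolding analytic_germ_def by blast
  have "\<forall>\<^sub>F t in at_right 0. of_real (u t) = f (of_real t)"
    using f(2) unfolding eventually_at_filter by (rule eventually_mono) simp
  then show ?thesis unfolding real_germ_def using analytic_on_imp_meromorphic_on[OF f(1)] by blast
qed

lemma eventually_at_left_0_iff:
  "(\<forall>\<^sub>F s in at_left (0::real). P s) \<longleftrightarrow> (\<forall>\<^sub>F t in at_right 0. P (- t))"
  by (simp add: at_left_minus eventually_filtermap)

lemma eventually_nhds_imp_at_left: "\<forall>\<^sub>F s in nhds (0::real). P s \<Longrightarrow> \<forall>\<^sub>F s in at_left 0. P s"
  unfolding eventually_at_filter by (erule eventually_mono) blast

text \<open>
  The zeros of the holomorphic extension accumulate at 0 from the left, so it vanishes near 0.
\<close>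

lemma analytic_germ_identity:
  assumes u: "analytic_germ u" and z: "\<forall>\<^sub>F s in at_left 0. u s = 0"
  shows "\<forall>\<^sub>F s in nhds 0. u s = 0"
proof -
  obtain f where f: "f analytic_on {0}" "\<forall>\<^sub>F t in nhds 0. of_real (u t) = f (of_real t)"
    using u unfolding analytic_germ_def by blast
  have lim: "filterlim (\<lambda>t. of_real t :: complex) (at 0) (at_left 0)"
    "filterlim (\<lambda>t. of_real t :: complex) (at 0) (at_right 0)"
    unfolding filterlim_at by (auto intro!: tendsto_eq_intros simp: eventually_at_filter)
  have "\<not> (\<forall>\<^sub>F z in at 0. f z \<noteq> 0)"
  proof
    assume "\<forall>\<^sub>F z in at 0. f z \<noteq> 0"
    from eventually_compose_filterlim[OF this lim(1)] eventually_nhds_imp_at_left[OF f(2)] z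
    have "\<forall>\<^sub>F s::real in at_left 0. False" by eventually_elim auto
    then show False by simp
  qed
  then have f0: "\<forall>\<^sub>F z in at 0. f z = 0"
    using meromorphic_eventually_zero_or_nonzero[OF analytic_on_imp_meromorphic_on[OF f(1)]] by blast
  have "f \<midarrow>0\<rightarrow> f 0" using analytic_at_imp_isCont[OF f(1)] by (simp add: isCont_def)
  moreover have "f \<midarrow>0\<rightarrow> 0" using f0 by (rule tendsto_eventually)
  ultimately have "f 0 = 0" by (rule LIM_unique)
  with f0 have "\<forall>\<^sub>F z in nhds 0. f z = 0" by (simp add: eventually_nhds_conv_at)
  moreover have "filterlim (\<lambda>t. of_real t :: complex) (nhds 0) (nhds (0::real))"
    using tendsto_of_real[OF filterlim_ident[of "nhds (0::real)"], where 'a = complex] by simp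
  ultimately have "\<forall>\<^sub>F t in nhds (0::real). f (of_real t) = 0" by (rule eventually_compose_filterlim)
  with f(2) show ?thesis by eventually_elim simp
qed

lemma analytic_germ_Re:
  assumes "f analytic_on {0}" shows "analytic_germ (\<lambda>t. Re (f (of_real t)))"
proof -
  obtain r where r: "r > 0" "f holomorphic_on ball 0 r" using assms by (auto simp: analytic_at_ball)
  have "cnj ` ball 0 r = ball (0::complex) r" by (auto simp: image_cnj_conv_vimage_cnj)
  then have "cnj \<circ> f \<circ> cnj holomorphic_on ball 0 r"
    using r by (intro holomorphic_on_compose_cnj_cnj) auto
  then have "(\<lambda>z. cnj (f (cnj z))) holomorphic_on ball 0 r" by (simp add: o_def)
  with r have "(\<lambda>z. (f z + cnj (f (cnj z))) / 2) holomorphic_on ball 0 r" by (intro holomorphic_intros) auto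
  then have "(\<lambda>z. (f z + cnj (f (cnj z))) / 2) analytic_on {0}" using r(1) by (auto simp: analytic_at_ball)
  then show ?thesis unfolding analytic_germ_def
    by (intro exI[of _ "\<lambda>z. (f z + cnj (f (cnj z))) / 2"]) (simp add: complex_add_cnj)
qed

text \<open>The finite limit along the half-line excludes a pole.\<close>

lemma analytic_germ_from_meromorphic:
  assumes v: "real_germ v" and lim: "(v \<longlongrightarrow> c) (at_right 0)"
  shows "\<exists>u. analytic_germ u \<and> u 0 = c \<and> (\<forall>\<^sub>F t in at_right 0. u t = v t)"
proof -
  obtain f where f: "f meromorphic_on {0}" and vf: "\<forall>\<^sub>F t in at_right 0. of_real (v t) = f (of_real t)"
    using v unfolding real_germ_def by blast
  have limf: "((\<lambda>t. f (of_real t)) \<longlongrightarrow> of_real c) (at_right 0)"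
    using tendsto_of_real[OF lim, where 'a = complex] vf by (rule Lim_transform_eventually)
  have "\<not> is_pole f 0"
  proof
    assume "is_pole f 0"
    then have "filterlim (\<lambda>t. f (of_real t)) at_infinity (at_right (0::real))"
      unfolding is_pole_def using filterlim_of_real_at_right_0 by (rule filterlim_compose)
    with limf show False using not_tendsto_and_filterlim_at_infinity trivial_limit_at_right_real by blast
  qed
  then obtain l where l: "f \<midarrow>0\<rightarrow> l" using f by (auto simp: meromorphic_at_iff not_essential_def)
  define g where "g z = (if z = 0 then l else f z)" for z
  have g: "g analytic_on {0}" unfolding g_def
    by (rule removable_singularity'[OF _ l]) (use f in \<open>simp add: meromorphic_at_iff\<close>)
  have "((\<lambda>t. f (of_real t)) \<longlongrightarrow> l) (at_right (0::real))"
    using l filterlim_of_real_at_right_0 by (rule filterlim_compose)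
  then have lc: "l = of_real c" using limf by (rule tendsto_unique[OF trivial_limit_at_right_real])
  from g have "analytic_germ (\<lambda>t. Re (g (of_real t)))" by (rule analytic_germ_Re)
  moreover have "Re (g (of_real 0)) = c" by (simp add: g_def lc)
  moreover have "\<forall>\<^sub>F t in at_right 0. Re (g (of_real t)) = v t"
    using vf eventually_at_right_less
  proof eventually_elim
    case (elim t)
    then have "g (of_real t) = of_real (v t)" by (simp add: g_def)
    then show ?case by simp
  qed
  ultimately show ?thesis by (intro exI[of _ "\<lambda>t. Re (g (of_real t))"]) blast
qed

lemma real_analytic_at_shift:
  "real_analytic_at v t \<longleftrightarrow> real_analytic_at (\<lambda>s. v (t + s)) 0"
proof
  assume "real_analytic_at v t"
  then obtain r a where r: "r > 0" "\<And>s. \<bar>s - t\<bar> < r \<Longrightarrow> (\<lambda>n. (s - t) ^ n *\<^sub>R a n) sums v s"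
    unfolding real_analytic_at_def by blast
  have "(\<lambda>n. (s - 0) ^ n *\<^sub>R a n) sums v (t + s)" if "\<bar>s - 0\<bar> < r" for s
    using r(2)[of "t + s"] that by simp
  with r(1) show "real_analytic_at (\<lambda>s. v (t + s)) 0" unfolding real_analytic_at_def by blast
next
  assume "real_analytic_at (\<lambda>s. v (t + s)) 0"
  then obtain r a where r: "r > 0" "\<And>s. \<bar>s - 0\<bar> < r \<Longrightarrow> (\<lambda>n. (s - 0) ^ n *\<^sub>R a n) sums v (t + s)"
    unfolding real_analytic_at_def by blast
  have "(\<lambda>n. (s - t) ^ n *\<^sub>R a n) sums v s" if "\<bar>s - t\<bar> < r" for s
    using r(2)[of "s - t"] that by simp
  with r(1) show "real_analytic_at v t" unfolding real_analytic_at_def by blast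
qed

lemma real_analytic_at_0_imp_analytic_curve:
  fixes \<alpha> :: "real \<Rightarrow> real^'n::finite"
  assumes "real_analytic_at \<alpha> 0" shows "analytic_curve \<alpha>"
  unfolding analytic_curve_def
proof
  fix i
  obtain r a where r: "r > 0" "\<And>s. \<bar>s\<bar> < r \<Longrightarrow> (\<lambda>n. s ^ n *\<^sub>R a n) sums \<alpha> s"
    using assms unfolding real_analytic_at_def by auto
  have comp: "(\<lambda>n. a n $ i * s ^ n) sums (\<alpha> s $ i)" if "\<bar>s\<bar> < r" for s
    using bounded_linear.sums[OF bounded_linear_vec_nth[of i] r(2)[OF that]] by (simp add: mult.commute)
  have compc: "(\<lambda>n. of_real (a n $ i) * (of_real s :: complex) ^ n) sums of_real (\<alpha> s $ i)" if "\<bar>s\<bar> < r" for s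
    using sums_of_real[OF comp[OF that], where 'a = complex] by simp
  define f where "f z = (\<Sum>n. of_real (a n $ i) * z ^ n)" for z :: complex
  have sm: "(\<lambda>n. of_real (a n $ i) * (z - 0) ^ n) sums f z" if z: "z \<in> ball 0 r" for z
  proof -
    obtain s where s: "norm z < s" "s < r" using z dense[of "norm z" r] by auto
    have "summable (\<lambda>n. of_real (a n $ i) * (of_real s :: complex) ^ n)"
      using compc[of s] s norm_ge_zero[of z] by (auto simp: sums_iff)
    then have "summable (\<lambda>n. of_real (a n $ i) * z ^ n)"
      by (rule powser_inside) (use s norm_ge_zero[of z] in auto)
    then show ?thesis unfolding f_def by (simp add: summable_sums)
  qed
  then have "f holomorphic_on ball 0 r" by (rule power_series_holomorphic)
  then have "f analytic_on {0}" using r(1) by (auto simp: analytic_at_ball)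
  moreover have "of_real (\<alpha> s $ i) = f (of_real s)" if "\<bar>s\<bar> < r" for s
    using compc[OF that] by (simp add: f_def sums_iff)
  then have "\<forall>\<^sub>F s in nhds 0. of_real (\<alpha> s $ i) = f (of_real s)"
    unfolding eventually_nhds_metric using r(1) by (auto simp: dist_norm)
  ultimately show "analytic_germ (\<lambda>s. \<alpha> s $ i)" unfolding analytic_germ_def by blast
qed

lemma analytic_curve_imp_real_analytic_at_0:
  fixes \<alpha> :: "real \<Rightarrow> real^'n::finite"
  assumes "analytic_curve \<alpha>" shows "real_analytic_at \<alpha> 0"
proof -
  have "\<forall>i. \<exists>f. f analytic_on {0} \<and> (\<forall>\<^sub>F s in nhds 0. of_real (\<alpha> s $ i) = f (of_real s))"
    using assms unfolding analytic_curve_def analytic_germ_def by blast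
  then obtain f where f: "\<And>i. f i analytic_on {0}" "\<And>i. \<forall>\<^sub>F s in nhds 0. of_real (\<alpha> s $ i) = f i (of_real s)"
    by metis
  have "\<forall>i. \<exists>r>0. f i holomorphic_on ball 0 r" using f(1) by (simp add: analytic_at_ball)
  then obtain R where R: "\<And>i. R i > 0" "\<And>i. f i holomorphic_on ball 0 (R i)" by metis
  have "\<forall>\<^sub>F s in nhds 0. \<forall>i\<in>UNIV. of_real (\<alpha> s $ i) = f i (of_real s)"
    using f(2) by (intro eventually_ball_finite) auto
  moreover have "\<forall>\<^sub>F s::real in nhds 0. \<forall>i\<in>UNIV. \<bar>s\<bar> < R i"
  proof (intro eventually_ball_finite ballI)
    show "\<forall>\<^sub>F s::real in nhds 0. \<bar>s\<bar> < R i" for i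
      unfolding eventually_nhds_metric using R(1)[of i] by (auto simp: dist_norm)
  qed simp
  ultimately have "\<forall>\<^sub>F s in nhds 0. \<forall>i. of_real (\<alpha> s $ i) = f i (of_real s) \<and> \<bar>s\<bar> < R i"
    by eventually_elim auto
  then obtain r where r: "r > 0" "\<And>s i. \<bar>s\<bar> < r \<Longrightarrow> of_real (\<alpha> s $ i) = f i (of_real s) \<and> \<bar>s\<bar> < R i"
    by (auto simp: eventually_nhds_metric)
  define a :: "nat \<Rightarrow> real^'n" where "a n = (\<chi> i. Re ((deriv ^^ n) (f i) 0 / fact n))" for n
  have "(\<lambda>n. (s - 0) ^ n *\<^sub>R a n) sums \<alpha> s" if s: "\<bar>s - 0\<bar> < r" for s
  proof -
    have "(\<lambda>n. ((s - 0) ^ n *\<^sub>R a n) $ i) sums (\<alpha> s $ i)" for i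
    proof -
      have "(\<lambda>n. (deriv ^^ n) (f i) 0 / fact n * (of_real s - 0) ^ n) sums f i (of_real s)"
        by (rule holomorphic_power_series[OF R(2)]) (use r(2)[of s i] s in auto)
      from sums_Re[OF this] have "(\<lambda>n. Re ((deriv ^^ n) (f i) 0 / fact n * of_real (s ^ n))) sums (\<alpha> s $ i)"
        using r(2)[of s i] s by (metis (no_types, lifting) Re_complex_of_real diff_zero of_real_power sums_cong)
      moreover have "Re (x * of_real y) = y * Re x" for x and y :: real by simp
      ultimately show ?thesis by (simp only: a_def vector_scaleR_component vec_lambda_beta real_scaleR_def diff_zero)
    qed
    then show ?thesis unfolding sums_def by (intro vec_tendstoI) simp
  qed
  with r(1) show ?thesis unfolding real_analytic_at_def by blast
qed

lemma real_analytic_at_iff: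
  fixes v :: "real \<Rightarrow> real^'n::finite"
  shows "real_analytic_at v t \<longleftrightarrow> analytic_curve (\<lambda>s. v (t + s))"
  using real_analytic_at_shift[of v t] real_analytic_at_0_imp_analytic_curve
    analytic_curve_imp_real_analytic_at_0 by blast

lemma analytic_germ_poly:
  fixes \<alpha> :: "real \<Rightarrow> real^'n::finite"
  assumes "real_polynomial_function p" "analytic_curve \<alpha>"
  shows "analytic_germ (\<lambda>s. p (\<alpha> s))"
  using assms(1)
proof induction
  case (linear f)
  then have "f (\<alpha> s) = (\<Sum>j\<in>UNIV. \<alpha> s $ j * f (axis j 1))" for s
    by (intro linear_functional_eq_sum bounded_linear.linear)
  moreover have "analytic_germ (\<lambda>s. \<Sum>j\<in>UNIV. \<alpha> s $ j * f (axis j 1))"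
    using assms(2) by (intro analytic_germ_sum analytic_germ_mult analytic_germ_const) (auto simp: analytic_curve_def)
  ultimately show ?case by simp
qed (auto intro: analytic_germ_const analytic_germ_add analytic_germ_mult)

lemma analytic_curve_poly:
  fixes f :: "real^'n::finite \<Rightarrow> real^'m::finite"
  assumes "\<And>i. real_polynomial_function (\<lambda>x. f x $ i)" "analytic_curve \<alpha>"
  shows "analytic_curve (\<lambda>s. f (\<alpha> s))"
  unfolding analytic_curve_def using analytic_germ_poly[OF assms(1) assms(2)] by simp

lemma analytic_curve_semialgebraic_left:
  assumes "semialgebraic A" "analytic_curve \<alpha>"
  shows "(\<forall>\<^sub>F s in at_left 0. \<alpha> s \<in> A) \<or> (\<forall>\<^sub>F s in at_left 0. \<alpha> s \<notin> A)"
proof -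
  have "real_germ (\<lambda>t. \<alpha> (- t) $ i)" for i
    using assms(2) analytic_germ_reflect[of "\<lambda>s. \<alpha> s $ i"]
    by (intro analytic_germ_imp_real_germ) (simp add: analytic_curve_def)
  from real_germ_semialgebraic[OF assms(1) this] show ?thesis
    unfolding eventually_at_left_0_iff .
qed

section \<open>Locally arc-symmetric sets and curve selection\<close>

definition arc_closed :: "(real^'n::finite) set \<Rightarrow> bool" where
  "arc_closed S \<longleftrightarrow> (\<forall>\<alpha>. analytic_curve \<alpha> \<longrightarrow> (\<forall>\<^sub>F s in at_left 0. \<alpha> s \<in> S) \<longrightarrow> (\<forall>\<^sub>F s in nhds 0. \<alpha> s \<in> S))"

definition loc_arc_sym :: "(real^'n::finite) set \<Rightarrow> bool" where
  "loc_arc_sym S \<longleftrightarrow> semialgebraic S \<and> arc_closed S"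

lemma loc_arc_sym_UNIV: "loc_arc_sym UNIV"
  by (simp add: loc_arc_sym_def arc_closed_def semialgebraic_UNIV)

lemma loc_arc_sym_empty: "loc_arc_sym {}"
  by (simp add: loc_arc_sym_def arc_closed_def semialgebraic_empty)

lemma loc_arc_sym_Int:
  assumes "loc_arc_sym A" "loc_arc_sym B" shows "loc_arc_sym (A \<inter> B)"
proof -
  have "\<forall>\<^sub>F s in nhds 0. \<alpha> s \<in> A \<inter> B" if \<alpha>: "analytic_curve \<alpha>" and l: "\<forall>\<^sub>F s in at_left 0. \<alpha> s \<in> A \<inter> B" for \<alpha>
  proof -
    have "\<forall>\<^sub>F s in at_left 0. \<alpha> s \<in> A" "\<forall>\<^sub>F s in at_left 0. \<alpha> s \<in> B"
      using l by (eventually_elim, simp)+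
    with assms \<alpha> have "\<forall>\<^sub>F s in nhds 0. \<alpha> s \<in> A" "\<forall>\<^sub>F s in nhds 0. \<alpha> s \<in> B"
      by (auto simp: loc_arc_sym_def arc_closed_def)
    then show ?thesis by eventually_elim simp
  qed
  with assms show ?thesis by (auto simp: loc_arc_sym_def arc_closed_def intro: semialgebraic_Int)
qed

text \<open>
  An analytic curve that lies in the union for small negative parameters eventually lies in one
  of the two sets, as these are semialgebraic.
\<close>

lemma loc_arc_sym_Un:
  assumes "loc_arc_sym A" "loc_arc_sym B" shows "loc_arc_sym (A \<union> B)"
proof -
  have "\<forall>\<^sub>F s in nhds 0. \<alpha> s \<in> A \<union> B" if \<alpha>: "analytic_curve \<alpha>" and l: "\<forall>\<^sub>F s in at_left 0. \<alpha> s \<in> A \<union> B" for \<alpha>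
  proof -
    have "(\<forall>\<^sub>F s in at_left 0. \<alpha> s \<in> A) \<or> (\<forall>\<^sub>F s in at_left 0. \<alpha> s \<notin> A)"
      using assms(1) \<alpha> by (intro analytic_curve_semialgebraic_left) (auto simp: loc_arc_sym_def)
    then show ?thesis
    proof
      assume "\<forall>\<^sub>F s in at_left 0. \<alpha> s \<in> A"
      then have "\<forall>\<^sub>F s in nhds 0. \<alpha> s \<in> A" using assms(1) \<alpha> by (auto simp: loc_arc_sym_def arc_closed_def)
      then show ?thesis by eventually_elim simp
    next
      assume "\<forall>\<^sub>F s in at_left 0. \<alpha> s \<notin> A"
      with l have "\<forall>\<^sub>F s in at_left 0. \<alpha> s \<in> B" by eventually_elim simp
      then have "\<forall>\<^sub>F s in nhds 0. \<alpha> s \<in> B" using assms(2) \<alpha> by (auto simp: loc_arc_sym_def arc_closed_def)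
      then show ?thesis by eventually_elim simp
    qed
  qed
  moreover have "semialgebraic (A \<union> B)" using assms by (auto simp: loc_arc_sym_def intro: semialgebraic_Un)
  ultimately show ?thesis by (simp add: loc_arc_sym_def arc_closed_def)
qed

lemma loc_arc_sym_UNION:
  "finite I \<Longrightarrow> (\<And>i. i \<in> I \<Longrightarrow> loc_arc_sym (A i)) \<Longrightarrow> loc_arc_sym (\<Union>i\<in>I. A i)"
  by (induction I rule: finite_induct) (auto intro: loc_arc_sym_Un loc_arc_sym_empty)

lemma loc_arc_sym_INTER:
  "finite I \<Longrightarrow> (\<And>i. i \<in> I \<Longrightarrow> loc_arc_sym (A i)) \<Longrightarrow> loc_arc_sym (\<Inter>i\<in>I. A i)"
  by (induction I rule: finite_induct) (auto intro: loc_arc_sym_Int loc_arc_sym_UNIV)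

lemma loc_arc_sym_zero:
  assumes p: "real_polynomial_function p" shows "loc_arc_sym {x. p x = 0}"
  unfolding loc_arc_sym_def arc_closed_def
  using semialgebraic_zero[OF p] analytic_germ_identity[OF analytic_germ_poly[OF p]] by simp

lemma loc_arc_sym_vimage:
  fixes f :: "real^'n::finite \<Rightarrow> real^'m::finite"
  assumes f: "\<And>i. real_polynomial_function (\<lambda>x. f x $ i)" and S: "loc_arc_sym S"
  shows "loc_arc_sym {x. f x \<in> S}"
  using S semialgebraic_poly_vimage[OF _ f, of S] analytic_curve_poly[OF f]
  unfolding loc_arc_sym_def arc_closed_def by simp

text \<open>
  The auxiliary set \<open>A\<close> consists of the points \<open>(t, x)\<close> with \<open>x
  \<in> S\<close> and \<open>|x - x0|^2 < t\<close>. Choosing points of \<open>A\<close> over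
  the germ of the first coordinate gives meromorphic germs \<open>v\<close> with \<open>|v t -
  x0|^2 < t ^ N\<close>; their coordinates converge to those of \<open>x0\<close>, so they are
  analytic.
\<close>

theorem curve_selection:
  fixes S :: "(real^'d::finite) set"
  assumes S: "semialgebraic S" and x0: "x0 \<in> closure S"
  shows "\<exists>\<alpha>. analytic_curve \<alpha> \<and> \<alpha> 0 = x0 \<and> (\<forall>\<^sub>F t in at_right 0. \<alpha> t \<in> S)"
proof -
  define r :: "real^('d option) \<Rightarrow> real^'d" where "r w = (\<chi> j. w $ Some j)" for w
  have r: "real_polynomial_function (\<lambda>w. r w $ j)" for j by (auto simp: r_def)
  have rs: "real_polynomial_function (\<lambda>w. w $ None - (\<Sum>j\<in>UNIV. (r w $ j - x0 $ j) ^ 2))"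
    by (intro real_polynomial_function_diff real_polynomial_function_sum real_polynomial_function_power r
        real_polynomial_function_const real_polynomial_function_nth) auto
  define A where "A = {w. r w \<in> S} \<inter> {w. w $ None - (\<Sum>j\<in>UNIV. (r w $ j - x0 $ j) ^ 2) > 0}"
  have A: "semialgebraic A" unfolding A_def
    by (intro semialgebraic_Int semialgebraic_poly_vimage S r semialgebraic_pos rs)
  define u :: "real \<Rightarrow> real^('d option)" where "u t = (\<chi> j. t)" for t
  have u: "real_germ (\<lambda>t. u t $ i)" for i by (simp add: u_def real_germ_id)
  have nsq: "norm x ^ 2 = (\<Sum>j\<in>UNIV. (x $ j) ^ 2)" for x :: "real^'d"
    by (simp add: norm_vec_def L2_set_def sum_nonneg)
  have "\<exists>w\<in>A. \<forall>j. j \<notin> range Some \<longrightarrow> w $ j = u t $ j" if t: "t > 0" for t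
  proof -
    obtain x where x: "x \<in> S" "dist x x0 < sqrt t" using x0 t by (meson closure_approachable real_sqrt_gt_zero)
    then have "norm (x - x0) ^ 2 < t" using t
      by (metis dist_norm norm_ge_zero power_strict_mono real_sqrt_pow2 less_imp_le zero_less_numeral)
    then have lt: "(\<Sum>j\<in>UNIV. (x $ j - x0 $ j) ^ 2) < t" using nsq[of "x - x0"] by simp
    define w :: "real^('d option)" where "w = (\<chi> j. case j of None \<Rightarrow> t | Some i \<Rightarrow> x $ i)"
    have "r w = x" by (simp add: r_def w_def vec_eq_iff)
    then have "w \<in> A" using x lt by (simp add: A_def w_def)
    moreover have "\<forall>j. j \<notin> range Some \<longrightarrow> w $ j = u t $ j" by (auto simp: w_def u_def split: option.split)
    ultimately show ?thesis by blast
  qed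
  then have "\<forall>\<^sub>F t in at_right 0. \<exists>w\<in>A. \<forall>j. j \<notin> range Some \<longrightarrow> w $ j = u t $ j"
    by (auto intro: eventually_mono[OF eventually_at_right_less])
  from choose_along_germ[OF A u this] obtain N and v :: "real \<Rightarrow> real^('d option)"
    where N: "N > 0" and v: "\<And>i. real_germ (\<lambda>t. v t $ i)"
      and vA: "\<forall>\<^sub>F t in at_right 0. v t \<in> A \<and> (\<forall>j. j \<notin> range Some \<longrightarrow> v t $ j = u (t ^ N) $ j)" by blast
  have "\<exists>w. analytic_germ w \<and> w 0 = x0 $ j \<and> (\<forall>\<^sub>F t in at_right 0. w t = v t $ Some j)" for j
  proof (rule analytic_germ_from_meromorphic[OF v])
    have "\<forall>\<^sub>F t in at_right 0. norm (v t $ Some j - x0 $ j) \<le> sqrt (t ^ N)"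
      using vA
    proof eventually_elim
      case (elim t)
      have "(v t $ Some j - x0 $ j) ^ 2 \<le> (\<Sum>j\<in>UNIV. (v t $ Some j - x0 $ j) ^ 2)"
        by (rule member_le_sum) auto
      also have "(\<Sum>j\<in>UNIV. (v t $ Some j - x0 $ j) ^ 2) \<le> v t $ None"
      proof -
        have "v t \<in> A" using elim by blast
        then show ?thesis by (simp add: A_def r_def)
      qed
      also have "v t $ None = u (t ^ N) $ None" using elim by blast
      also have "\<dots> = t ^ N" by (simp add: u_def)
      finally have "sqrt ((v t $ Some j - x0 $ j) ^ 2) \<le> sqrt (t ^ N)" by (rule real_sqrt_le_mono)
      then show ?case by simp
    qed
    moreover have "((\<lambda>t::real. sqrt (t ^ N)) \<longlongrightarrow> 0) (at_right 0)"
      using N by (auto intro!: tendsto_eq_intros simp: zero_power)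
    ultimately have "((\<lambda>t. v t $ Some j - x0 $ j) \<longlongrightarrow> 0) (at_right 0)"
      by (rule Lim_null_comparison)
    then show "((\<lambda>t. v t $ Some j) \<longlongrightarrow> x0 $ j) (at_right 0)" by (rule LIM_zero_cancel)
  qed
  then obtain w where w: "\<And>j. analytic_germ (w j)" "\<And>j. w j 0 = x0 $ j"
    "\<And>j. \<forall>\<^sub>F t in at_right 0. w j t = v t $ Some j" by metis
  define \<alpha> :: "real \<Rightarrow> real^'d" where "\<alpha> t = (\<chi> j. w j t)" for t
  have "\<forall>\<^sub>F t in at_right 0. \<forall>j\<in>UNIV. w j t = v t $ Some j"
    using w(3) by (intro eventually_ball_finite) auto
  with vA have "\<forall>\<^sub>F t in at_right 0. \<alpha> t \<in> S"
  proof eventually_elim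
    case (elim t)
    then have "\<alpha> t = r (v t)" by (simp add: \<alpha>_def r_def vec_eq_iff)
    then show ?case using elim by (simp add: A_def)
  qed
  moreover have "analytic_curve \<alpha>" using w(1) by (simp add: analytic_curve_def \<alpha>_def)
  moreover have "\<alpha> 0 = x0" using w(2) by (simp add: \<alpha>_def vec_eq_iff)
  ultimately show ?thesis by blast
qed

text \<open>
  Run backwards, a curve selected at a point of the closure lies in \<open>S\<close> for
  negative parameters, hence also for the parameter 0.
\<close>

theorem loc_arc_sym_closed:
  assumes "loc_arc_sym S" shows "closed S"
proof -
  have "x \<in> S" if x: "x \<in> closure S" for x
  proof -
    obtain \<alpha> where \<alpha>: "analytic_curve \<alpha>" "\<alpha> 0 = x" "\<forall>\<^sub>F t in at_right 0. \<alpha> t \<in> S"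
      using curve_selection[OF _ x] assms by (auto simp: loc_arc_sym_def)
    have "analytic_curve (\<lambda>s. \<alpha> (- s))"
      using \<alpha>(1) analytic_germ_reflect by (auto simp: analytic_curve_def)
    moreover have "\<forall>\<^sub>F s in at_left 0. \<alpha> (- s) \<in> S" using \<alpha>(3) by (simp add: eventually_at_left_0_iff)
    ultimately have "\<forall>\<^sub>F s in nhds 0. \<alpha> (- s) \<in> S"
      using assms unfolding loc_arc_sym_def arc_closed_def by blast
    from eventually_nhds_x_imp_x[OF this] show ?thesis using \<alpha>(2) by simp
  qed
  then have "closure S \<subseteq> S" by blast
  then show ?thesis by (simp add: closure_subset_eq)
qed

section \<open>Affine space in projective space\<close>

lemma proportional_refl: "proportional v v \<longleftrightarrow> v \<noteq> 0"
  by (auto simp: proportional_def intro: exI[of _ 1])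

lemma proj_class_eq_iff:
  assumes "v \<noteq> 0" "w \<noteq> 0" shows "proj_class v = proj_class w \<longleftrightarrow> proportional v w"
  using Quotient3_rel[OF Quotient3_projective_space, of v w] assms by (simp add: proportional_refl)

definition homogenize :: "real^'d::finite \<Rightarrow> real^('d option)" where
  "homogenize x = (\<chi> j. case j of None \<Rightarrow> 1 | Some i \<Rightarrow> x $ i)"

lemma homogenize_nth [simp]: "homogenize x $ None = 1" "homogenize x $ Some i = x $ i"
  by (simp_all add: homogenize_def)

lemma homogenize_nonzero: "homogenize x \<noteq> 0"
  by (metis homogenize_nth(1) zero_index zero_neq_one)

lemma affine_embed_eq: "affine_embed x = proj_class (homogenize x)"
  by (simp add: affine_embed_def homogenize_def)

lemma proj_class_eq_affine_embed:
  assumes "v \<noteq> 0"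
  shows "proj_class v = affine_embed x \<longleftrightarrow> v $ None \<noteq> 0 \<and> x = (\<chi> i. v $ Some i / v $ None)"
proof -
  have "proj_class v = affine_embed x \<longleftrightarrow> (\<exists>c. homogenize x = c *\<^sub>R v)"
    using assms homogenize_nonzero[of x] by (simp add: affine_embed_eq proj_class_eq_iff proportional_def)
  also have "\<dots> \<longleftrightarrow> v $ None \<noteq> 0 \<and> x = (\<chi> i. v $ Some i / v $ None)"
  proof
    assume "\<exists>c. homogenize x = c *\<^sub>R v"
    then obtain c where c: "homogenize x = c *\<^sub>R v" by blast
    have 1: "1 = c * v $ None" using arg_cong[OF c, of "\<lambda>w. w $ None"] by simp
    have "x $ i = c * v $ Some i" for i using arg_cong[OF c, of "\<lambda>w. w $ Some i"] by simp
    moreover have "c = 1 / v $ None" using 1 by (metis mult_zero_right nonzero_eq_divide_eq zero_neq_one)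
    ultimately show "v $ None \<noteq> 0 \<and> x = (\<chi> i. v $ Some i / v $ None)" using 1 by (auto simp: vec_eq_iff)
  next
    assume *: "v $ None \<noteq> 0 \<and> x = (\<chi> i. v $ Some i / v $ None)"
    have "homogenize x $ j = (inverse (v $ None) *\<^sub>R v) $ j" for j
      using * by (cases j) (simp_all add: divide_inverse mult.commute)
    then show "\<exists>c. homogenize x = c *\<^sub>R v" by (metis vec_eq_iff)
  qed
  finally show ?thesis .
qed

lemma inj_affine_embed: "inj affine_embed"
proof (rule injI)
  fix x y :: "real^'d" assume "affine_embed x = affine_embed y"
  then have "proj_class (homogenize x) = affine_embed y" by (simp add: affine_embed_eq)
  then show "x = y" using proj_class_eq_affine_embed[OF homogenize_nonzero, of x y] by (simp add: vec_eq_iff)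
qed

lemma real_polynomial_function_homogenize: "real_polynomial_function (\<lambda>x. homogenize x $ j)"
  by (cases j) (auto intro: real_polynomial_function_const)

text \<open>A germ is rescaled to an arc on the whole interval from -1 to 1.\<close>

theorem loc_arc_sym_affine_part:
  assumes A: "arc_symmetric A" shows "loc_arc_sym {x::real^'d::finite. affine_embed x \<in> A}"
  unfolding loc_arc_sym_def arc_closed_def
proof (intro conjI allI impI)
  let ?S = "{x. affine_embed x \<in> A}"
  have "semialgebraic {v. v $ None = 1 \<and> proj_class v \<in> A}"
    using A by (auto simp: arc_symmetric_def semialgebraic_proj_def)
  from semialgebraic_poly_vimage[OF this real_polynomial_function_homogenize]
  show "semialgebraic ?S" by (simp add: affine_embed_eq)
  fix \<alpha> :: "real \<Rightarrow> real^'d"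
  assume \<alpha>: "analytic_curve \<alpha>" and left: "\<forall>\<^sub>F s in at_left 0. \<alpha> s \<in> ?S"
  have "\<forall>\<^sub>F t in nhds 0. \<forall>i\<in>UNIV. \<forall>c. analytic_germ (\<lambda>s. \<alpha> (t + c * s) $ i)"
    using \<alpha> by (intro eventually_ball_finite ballI analytic_germ_affine_substitution) (auto simp: analytic_curve_def)
  then obtain d1 where d1: "d1 > 0" "\<And>t c i. \<bar>t\<bar> < d1 \<Longrightarrow> analytic_germ (\<lambda>s. \<alpha> (t + c * s) $ i)"
    by (auto simp: eventually_nhds_metric)
  obtain d2 where d2: "d2 < 0" "\<And>s. d2 < s \<Longrightarrow> s < 0 \<Longrightarrow> \<alpha> s \<in> ?S"
    using left unfolding eventually_at_left_field by auto
  define d where "d = min d1 (- d2)"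
  have d: "d > 0" using d1 d2 by (simp add: d_def)
  define \<gamma> where "\<gamma> s = affine_embed (\<alpha> (d * s))" for s
  have "real_analytic_arc \<gamma>"
    unfolding real_analytic_arc_def
  proof
    fix t :: real assume t: "t \<in> {-1<..<1}"
    have dt: "\<bar>d * t\<bar> < d1" using t d by (auto simp: abs_mult d_def) (smt (verit) mult_less_cancel_left2)
    have "analytic_curve (\<lambda>s. homogenize (\<alpha> (d * (t + s))))"
      unfolding analytic_curve_def
    proof
      fix j
      show "analytic_germ (\<lambda>s. homogenize (\<alpha> (d * (t + s))) $ j)"
        using d1(2)[OF dt, of d] by (cases j) (simp_all add: analytic_germ_const distrib_left)
    qed
    then have "real_analytic_at (\<lambda>s. homogenize (\<alpha> (d * s))) t" by (simp add: real_analytic_at_iff)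
    then show "\<exists>i v. real_analytic_at v t \<and> (\<forall>\<^sub>F s in nhds t. v s $ i = 1 \<and> \<gamma> s = proj_class (v s))"
      by (intro exI[of _ None] exI[of _ "\<lambda>s. homogenize (\<alpha> (d * s))"]) (simp add: \<gamma>_def affine_embed_eq)
  qed
  moreover have "\<gamma> ` {-1<..<0} \<subseteq> A"
  proof -
    have "d * s > d2" if "s > -1" "s < 0" for s
    proof -
      have "d * s > d * (-1)" using that d by (simp only: mult_less_cancel_left_pos)
      then show ?thesis by (simp add: d_def)
    qed
    then show ?thesis using d2(2) d by (auto simp: \<gamma>_def mult_pos_neg)
  qed
  ultimately have all: "\<gamma> ` {-1<..<1} \<subseteq> A" using A unfolding arc_symmetric_def by blast
  have "\<alpha> t \<in> ?S" if "\<bar>t\<bar> < d" for t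
  proof -
    have "\<gamma> (t / d) \<in> A" using that d by (intro subsetD[OF all] imageI) (auto simp: divide_simps abs_less_iff)
    then show ?thesis using d by (simp add: \<gamma>_def)
  qed
  then show "\<forall>\<^sub>F s in nhds 0. \<alpha> s \<in> ?S" unfolding eventually_nhds_metric using d by (auto simp: dist_norm)
qed

lemma isCont_eventually_nonzero:
  fixes u :: "real \<Rightarrow> real" assumes "isCont u 0" "u 0 \<noteq> 0" shows "\<forall>\<^sub>F s in nhds 0. u s \<noteq> 0"
proof -
  have "(u \<longlongrightarrow> u 0) (nhds 0)" using assms(1) by (simp add: isCont_def tendsto_nhds_iff)
  then show ?thesis using assms(2) by (rule tendsto_imp_eventually_ne)
qed

text \<open>
  This is \<open>S\<close> in the chart of projective space with \<open>v $ i = 1\<close>. If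
  \<open>i = Some j\<close>, the affine coordinate with index \<open>j\<close> is \<open>1 / v $
  None\<close>. As \<open>S\<close> is bounded, \<open>v $ None\<close> stays away from 0 along
  the curve, so the limit point is not at infinity and the curve is analytic in the affine
  coordinates as well.
\<close>

lemma arc_closed_chart:
  fixes S :: "(real^'d::finite) set"
  assumes S: "loc_arc_sym S" and b: "bounded S"
  shows "arc_closed {v. v $ i = 1 \<and> v $ None \<noteq> 0 \<and> (\<chi> j. v $ Some j / v $ None) \<in> S}"
    (is "arc_closed ?C")
  unfolding arc_closed_def
proof (intro allI impI)
  fix w :: "real \<Rightarrow> real^('d option)"
  assume w: "analytic_curve w" and left: "\<forall>\<^sub>F s in at_left 0. w s \<in> ?C"
  have germ: "analytic_germ (\<lambda>s. w s $ k)" for k using w by (simp add: analytic_curve_def)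
  have i1: "\<forall>\<^sub>F s in nhds 0. w s $ i = 1"
  proof -
    have "analytic_germ (\<lambda>s. w s $ i - 1)"
      using analytic_germ_add[OF germ analytic_germ_const[of "-1"], of i] by simp
    moreover have "\<forall>\<^sub>F s in at_left 0. w s $ i - 1 = 0" using left by eventually_elim simp
    ultimately have "\<forall>\<^sub>F s in nhds 0. w s $ i - 1 = 0" by (rule analytic_germ_identity)
    then show ?thesis by eventually_elim simp
  qed
  obtain M where M: "M > 0" "\<And>x. x \<in> S \<Longrightarrow> norm x \<le> M" using b bounded_pos by blast
  have n0: "w 0 $ None \<noteq> 0"
  proof (cases i)
    case None
    then show ?thesis using eventually_nhds_x_imp_x[OF i1] by simp
  next
    case (Some j)
    have ge: "\<forall>\<^sub>F s in at_left 0. 1 / M \<le> \<bar>w s $ None\<bar>"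
      using left
    proof eventually_elim
      case (elim s)
      then have "\<bar>(\<chi> j. w s $ Some j / w s $ None) $ j\<bar> \<le> M"
        using M(2) component_le_norm_cart order_trans by blast
      then have "\<bar>1 / w s $ None\<bar> \<le> M" using elim Some by simp
      then show ?case using elim M(1) by (simp add: abs_divide divide_simps mult.commute)
    qed
    have "isCont (\<lambda>s. \<bar>w s $ None\<bar>) 0"
      using analytic_germ_isCont[OF germ] by (rule continuous_rabs)
    then have "((\<lambda>s. \<bar>w s $ None\<bar>) \<longlongrightarrow> \<bar>w 0 $ None\<bar>) (at_left 0)"
      unfolding isCont_def by (rule tendsto_mono[rotated]) (simp add: at_within_le_at)
    from tendsto_lowerbound[OF this ge] have "1 / M \<le> \<bar>w 0 $ None\<bar>" by simp
    then show ?thesis using M(1) by auto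
  qed
  have "analytic_curve (\<lambda>s. \<chi> j. w s $ Some j / w s $ None)"
    unfolding analytic_curve_def using analytic_germ_divide[OF germ germ n0] by simp
  moreover have "\<forall>\<^sub>F s in at_left 0. (\<chi> j. w s $ Some j / w s $ None) \<in> S" using left by eventually_elim simp
  ultimately have "\<forall>\<^sub>F s in nhds 0. (\<chi> j. w s $ Some j / w s $ None) \<in> S"
    using S unfolding loc_arc_sym_def arc_closed_def by blast
  moreover have "\<forall>\<^sub>F s in nhds 0. w s $ None \<noteq> 0"
    by (rule isCont_eventually_nonzero[OF analytic_germ_isCont[OF germ] n0])
  ultimately show "\<forall>\<^sub>F s in nhds 0. w s \<in> ?C" using i1 by eventually_elim simp
qed

text \<open>
  If an arc leaves the set, let \<open>t0\<close> be the infimum of the parameters outside. Just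
  before \<open>t0\<close> the arc is inside, so by the local property in a chart around its
  value at \<open>t0\<close> it is inside just after \<open>t0\<close> as well, a contradiction.
\<close>

theorem arc_symmetric_affine_embed:
  fixes S :: "(real^'d::finite) set"
  assumes S: "loc_arc_sym S" and b: "bounded S"
  shows "arc_symmetric (affine_embed ` S)"
proof -
  let ?A = "affine_embed ` S"
  define C where "C i = {v. v $ i = 1 \<and> v $ None \<noteq> 0 \<and> (\<chi> j. v $ Some j / v $ None) \<in> S}" for i
  have chart: "v $ i = 1 \<and> proj_class v \<in> ?A \<longleftrightarrow> v \<in> C i" for i v
  proof (cases "v $ i = 1")
    case True
    then have "v \<noteq> 0" by (metis zero_index zero_neq_one)
    then show ?thesis using True proj_class_eq_affine_embed[of v] by (auto simp: C_def image_iff)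
  qed (simp add: C_def)
  have "semialgebraic_proj ?A"
    unfolding semialgebraic_proj_def
  proof
    fix i :: "'d option"
    have "semialgebraic ({v::real^('d option). v $ i - 1 = 0} \<inter> - {v. v $ None = 0} \<inter>
        {v. (\<chi> j. v $ Some j / v $ None) \<in> S})"
    proof (intro semialgebraic_Int semialgebraic_Compl semialgebraic_zero)
      show "semialgebraic {v::real^('d option). (\<chi> j. v $ Some j / v $ None) \<in> S}"
      proof (rule semialgebraic_vimage)
        show "semialgebraic S" using S by (simp add: loc_arc_sym_def)
        show "(\<lambda>v::real^('d option). (\<chi> j. v $ Some j / v $ None) $ i) \<in> rational_functions" for i
          using rational_functions.mult[OF rational_functions.poly rational_functions.inverse[OF rational_functions.poly],
              OF real_polynomial_function_nth real_polynomial_function_nth, of "Some i" None]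
          by (simp add: divide_inverse)
      qed
    qed (auto intro: real_polynomial_function_const)
    also have "{v::real^('d option). v $ i - 1 = 0} \<inter> - {v. v $ None = 0} \<inter>
        {v. (\<chi> j. v $ Some j / v $ None) \<in> S} = {v. v $ i = 1 \<and> proj_class v \<in> ?A}"
      unfolding chart by (auto simp: C_def)
    finally show "semialgebraic {v. v $ i = 1 \<and> proj_class v \<in> ?A}" .
  qed
  moreover have "\<gamma> ` {-1<..<1} \<subseteq> ?A" if \<gamma>: "real_analytic_arc \<gamma>" and neg: "\<gamma> ` {-1<..<0} \<subseteq> ?A" for \<gamma>
  proof (rule ccontr)
    assume notsub: "\<not> \<gamma> ` {-1<..<1} \<subseteq> ?A"
    define T where "T = {t\<in>{-1<..<1}. \<gamma> t \<notin> ?A}"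
    have T: "T \<noteq> {}" using notsub by (auto simp: T_def)
    have T0: "0 \<le> t" if "t \<in> T" for t using that neg by (force simp: T_def)
    then have bdd: "bdd_below T" by (rule bdd_belowI)
    define t0 where "t0 = Inf T"
    have t0: "0 \<le> t0" unfolding t0_def by (rule cInf_greatest[OF T T0])
    obtain t1 where "t1 \<in> T" using T by blast
    then have "t0 < 1" using cInf_lower[OF _ bdd, of t1] by (auto simp: t0_def T_def)
    then have "t0 \<in> {-1<..<1}" using t0 by simp
    then obtain i v where v: "real_analytic_at v t0" "\<forall>\<^sub>F s in nhds t0. v s $ i = 1 \<and> \<gamma> s = proj_class (v s)"
      using \<gamma> unfolding real_analytic_arc_def by blast
    obtain e where e: "e > 0" "\<And>s. \<bar>s\<bar> < e \<Longrightarrow> v (t0 + s) $ i = 1 \<and> \<gamma> (t0 + s) = proj_class (v (t0 + s))"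
    proof -
      obtain e where "e > 0" "\<forall>s. dist s t0 < e \<longrightarrow> v s $ i = 1 \<and> \<gamma> s = proj_class (v s)"
        using v(2) unfolding eventually_nhds_metric by blast
      then show thesis by (intro that[of e]) (auto simp: dist_norm)
    qed
    have before: "\<gamma> t \<in> ?A" if "-1 < t" "t < t0" for t
    proof (rule ccontr)
      assume "\<gamma> t \<notin> ?A"
      then have "t \<in> T" using that \<open>t0 < 1\<close> by (simp add: T_def)
      then have "t0 \<le> t" unfolding t0_def using bdd by (rule cInf_lower)
      with that show False by simp
    qed
    have "v (t0 + s) \<in> C i" if s: "s < 0" "- min e 1 < s" for s
    proof -
      have "v (t0 + s) $ i = 1 \<and> \<gamma> (t0 + s) = proj_class (v (t0 + s))" using e(2)[of s] s by auto
      moreover have "\<gamma> (t0 + s) \<in> ?A" using before[of "t0 + s"] t0 s by auto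
      ultimately show ?thesis using chart[of "v (t0 + s)" i] by simp
    qed
    then have "\<forall>\<^sub>F s in at_left 0. v (t0 + s) \<in> C i"
      unfolding eventually_at_left_field using e(1) by (intro exI[of _ "- min e 1"]) auto
    moreover have "analytic_curve (\<lambda>s. v (t0 + s))" using v(1) by (simp add: real_analytic_at_iff)
    ultimately have "\<forall>\<^sub>F s in nhds 0. v (t0 + s) \<in> C i"
      using arc_closed_chart[OF S b, of i] unfolding arc_closed_def C_def by blast
    then obtain e' where e': "e' > 0" "\<And>s. \<bar>s\<bar> < e' \<Longrightarrow> v (t0 + s) \<in> C i"
      by (auto simp: eventually_nhds_metric)
    obtain t where t: "t \<in> T" "t < t0 + min e e'"
    proof -
      have "Inf T < t0 + min e e'" using e(1) e'(1) by (simp add: t0_def)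
      from cInf_lessD[OF T this] show thesis using that by blast
    qed
    have "t0 \<le> t" unfolding t0_def using t(1) bdd by (rule cInf_lower)
    then have "\<bar>t - t0\<bar> < e" "\<bar>t - t0\<bar> < e'" using t(2) by auto
    then have "\<gamma> t = proj_class (v t)" "v t \<in> C i" using e(2)[of "t - t0"] e'(2)[of "t - t0"] by simp_all
    then have "\<gamma> t \<in> ?A" using chart[of "v t" i] by simp
    with t(1) show False by (simp add: T_def)
  qed
  ultimately show ?thesis unfolding arc_symmetric_def by blast
qed

section \<open>Hilbert's basis theorem for rings of polynomial functions\<close>

inductive_set ideal_gen :: "('x \<Rightarrow> real) set \<Rightarrow> ('x \<Rightarrow> real) set \<Rightarrow> ('x \<Rightarrow> real) set"
  for R :: "('x \<Rightarrow> real) set" and S :: "('x \<Rightarrow> real) set"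
where
  zero: "(\<lambda>x. 0) \<in> ideal_gen R S"
| mult: "r \<in> R \<Longrightarrow> f \<in> S \<Longrightarrow> (\<lambda>x. r x * f x) \<in> ideal_gen R S"
| add: "f \<in> ideal_gen R S \<Longrightarrow> g \<in> ideal_gen R S \<Longrightarrow> (\<lambda>x. f x + g x) \<in> ideal_gen R S"

lemma expansionI: "a \<in> R \<Longrightarrow> g \<in> S \<Longrightarrow> f = (\<lambda>x. a x * X x ^ n + g x) \<Longrightarrow>
    \<exists>a\<in>R. \<exists>g\<in>S. f = (\<lambda>x. a x * X x ^ n + g x)"
  by blast

lemma realisationI: "h \<in> I \<Longrightarrow> g \<in> S \<Longrightarrow> h = (\<lambda>x. a x * X x ^ n + g x) \<Longrightarrow>
    \<exists>h\<in>I. \<exists>g\<in>S. h = (\<lambda>x. a x * X x ^ n + g x)"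
  by blast

text \<open>
  Polynomial rings are realised as rings of functions. Adjoining a function \<open>X\<close> to
  \<open>R\<close> then gives the functions that can be written as polynomials in
  \<open>X\<close> over \<open>R\<close>. The expression may fail to be unique, so the degree
  and the leading coefficient are those of a chosen expression.
\<close>

locale function_ring =
  fixes R :: "('x \<Rightarrow> real) set"
  assumes const: "(\<lambda>x. c) \<in> R"
    and add: "f \<in> R \<Longrightarrow> g \<in> R \<Longrightarrow> (\<lambda>x. f x + g x) \<in> R"
    and mult: "f \<in> R \<Longrightarrow> g \<in> R \<Longrightarrow> (\<lambda>x. f x * g x) \<in> R"

definition noetherian_functions :: "('x \<Rightarrow> real) set \<Rightarrow> bool" where
  "noetherian_functions R \<longleftrightarrow> (\<forall>I\<subseteq>R. \<exists>F\<subseteq>I. finite F \<and> I \<subseteq> ideal_gen R F)"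

lemma ideal_gen_mono: "f \<in> ideal_gen R S \<Longrightarrow> S \<subseteq> T \<Longrightarrow> f \<in> ideal_gen R T"
  by (induction rule: ideal_gen.induct) (auto intro: ideal_gen.intros)

lemma ideal_gen_finite: "f \<in> ideal_gen R S \<Longrightarrow> \<exists>F\<subseteq>S. finite F \<and> f \<in> ideal_gen R F"
proof (induction rule: ideal_gen.induct)
  case zero
  then show ?case by (intro exI[of _ "{}"]) (auto intro: ideal_gen.zero)
next
  case (mult r f)
  then show ?case by (intro exI[of _ "{f}"]) (auto intro: ideal_gen.mult)
next
  case (add f g)
  then obtain F G where "F \<subseteq> S" "finite F" "f \<in> ideal_gen R F" "G \<subseteq> S" "finite G" "g \<in> ideal_gen R G" by blast
  then show ?case by (intro exI[of _ "F \<union> G"]) (auto intro!: ideal_gen.add intro: ideal_gen_mono)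
qed

context function_ring
begin

lemma ideal_gen_base: "f \<in> S \<Longrightarrow> f \<in> ideal_gen R S"
  using ideal_gen.mult[OF const[of 1], of f S] by simp

lemma ideal_gen_times: "f \<in> ideal_gen R S \<Longrightarrow> r \<in> R \<Longrightarrow> (\<lambda>x. r x * f x) \<in> ideal_gen R S"
proof (induction rule: ideal_gen.induct)
  case zero
  then show ?case by (simp add: ideal_gen.zero)
next
  case (mult s f)
  then show ?case using ideal_gen.mult[OF function_ring.mult[OF function_ring_axioms mult.prems mult.hyps(1)] mult.hyps(2)]
    by (simp add: mult.assoc)
next
  case (add f g)
  then show ?case using ideal_gen.add[of "\<lambda>x. r x * f x" R S "\<lambda>x. r x * g x"] by (simp add: distrib_left)
qed

lemma ideal_gen_trans: "f \<in> ideal_gen R S \<Longrightarrow> S \<subseteq> ideal_gen R T \<Longrightarrow> f \<in> ideal_gen R T"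
  by (induction rule: ideal_gen.induct) (auto intro: ideal_gen.intros ideal_gen_times)

lemma ideal_gen_subset: "f \<in> ideal_gen R S \<Longrightarrow> S \<subseteq> R \<Longrightarrow> f \<in> R"
  by (induction rule: ideal_gen.induct) (auto intro: const add mult)

text \<open>The functions that have an expression of degree less than \<open>n\<close>.\<close>

definition adjoin_below :: "('x \<Rightarrow> real) \<Rightarrow> nat \<Rightarrow> ('x \<Rightarrow> real) set" where
  "adjoin_below X n = {f. \<exists>b. (\<forall>j. b j \<in> R) \<and> f = (\<lambda>x. \<Sum>j<n. b j x * X x ^ j)}"

definition adjoin :: "('x \<Rightarrow> real) \<Rightarrow> ('x \<Rightarrow> real) set" where
  "adjoin X = (\<Union>n. adjoin_below X n)"

lemma adjoinI: "f \<in> adjoin_below X n \<Longrightarrow> f \<in> adjoin X"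
  unfolding adjoin_def by blast

lemma adjoin_below_add:
  assumes "f \<in> adjoin_below X n" "g \<in> adjoin_below X n" shows "(\<lambda>x. f x + g x) \<in> adjoin_below X n"
proof -
  obtain b c where "\<forall>j. b j \<in> R" "f = (\<lambda>x. \<Sum>j<n. b j x * X x ^ j)" "\<forall>j. c j \<in> R" "g = (\<lambda>x. \<Sum>j<n. c j x * X x ^ j)"
    using assms unfolding adjoin_below_def by blast
  then show ?thesis unfolding adjoin_below_def
    by (intro CollectI exI[of _ "\<lambda>j x. b j x + c j x"]) (auto intro: add simp: sum.distrib distrib_right)
qed

lemma adjoin_below_mono:
  assumes "f \<in> adjoin_below X n" "n \<le> m" shows "f \<in> adjoin_below X m"
proof -
  obtain b where b: "\<forall>j. b j \<in> R" "f = (\<lambda>x. \<Sum>j<n. b j x * X x ^ j)"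
    using assms unfolding adjoin_below_def by blast
  have "(\<Sum>j<m. (if j < n then b j x else 0) * X x ^ j) = (\<Sum>j<n. b j x * X x ^ j)" for x
    using assms(2) by (intro sum.mono_neutral_cong_right) auto
  moreover have "\<forall>j. (\<lambda>x. if j < n then b j x else 0) \<in> R"
  proof
    fix j show "(\<lambda>x. if j < n then b j x else 0) \<in> R" using b(1) const by (cases "j < n") auto
  qed
  ultimately show ?thesis unfolding adjoin_below_def b(2)
    by (intro CollectI exI[of _ "\<lambda>j x. if j < n then b j x else 0"]) auto
qed

lemma adjoin_below_shift:
  assumes "f \<in> adjoin_below X n" "r \<in> R" shows "(\<lambda>x. r x * X x ^ m * f x) \<in> adjoin_below X (n + m)"
proof -
  obtain b where b: "\<forall>j. b j \<in> R" "f = (\<lambda>x. \<Sum>j<n. b j x * X x ^ j)"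
    using assms unfolding adjoin_below_def by blast
  define c where "c j = (if m \<le> j then \<lambda>x. r x * b (j - m) x else (\<lambda>x. 0))" for j
  have "(\<Sum>j<n + m. c j x * X x ^ j) = r x * X x ^ m * (\<Sum>j<n. b j x * X x ^ j)" for x
  proof -
    have "(\<Sum>j<n + m. c j x * X x ^ j) = (\<Sum>j\<in>{m..<n + m}. c j x * X x ^ j)"
      by (rule sum.mono_neutral_right) (auto simp: c_def)
    also have "\<dots> = (\<Sum>j\<in>{0..<n}. c (j + m) x * X x ^ (j + m))"
      using sum.shift_bounds_nat_ivl[of "\<lambda>j. c j x * X x ^ j" 0 m n] by simp
    also have "\<dots> = r x * X x ^ m * (\<Sum>j<n. b j x * X x ^ j)"
      by (simp add: c_def sum_distrib_left power_add mult_ac atLeast0LessThan)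
    finally show ?thesis .
  qed
  moreover have "\<forall>j. c j \<in> R" using b(1) assms(2) const mult by (auto simp: c_def)
  ultimately show ?thesis unfolding adjoin_below_def b(2) by (intro CollectI exI[of _ c]) auto
qed

lemma adjoin_below_Suc:
  "f \<in> adjoin_below X (Suc n) \<longleftrightarrow> (\<exists>a\<in>R. \<exists>g\<in>adjoin_below X n. f = (\<lambda>x. a x * X x ^ n + g x))"
proof
  assume "f \<in> adjoin_below X (Suc n)"
  then obtain b where b: "\<forall>j. b j \<in> R" "f = (\<lambda>x. \<Sum>j<Suc n. b j x * X x ^ j)"
    unfolding adjoin_below_def by blast
  then have eq: "f = (\<lambda>x. b n x * X x ^ n + (\<Sum>j<n. b j x * X x ^ j))" by (simp add: add.commute)
  have mem: "(\<lambda>x. \<Sum>j<n. b j x * X x ^ j) \<in> adjoin_below X n" using b unfolding adjoin_below_def by blast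
  show "\<exists>a\<in>R. \<exists>g\<in>adjoin_below X n. f = (\<lambda>x. a x * X x ^ n + g x)"
    by (rule expansionI[OF _ mem eq]) (use b(1) in blast)
next
  assume "\<exists>a\<in>R. \<exists>g\<in>adjoin_below X n. f = (\<lambda>x. a x * X x ^ n + g x)"
  then obtain a g where a: "a \<in> R" and g: "g \<in> adjoin_below X n" and f: "f = (\<lambda>x. a x * X x ^ n + g x)" by blast
  obtain b where b: "\<forall>j. b j \<in> R" "g = (\<lambda>x. \<Sum>j<n. b j x * X x ^ j)"
    using g unfolding adjoin_below_def by blast
  have "f = (\<lambda>x. \<Sum>j<Suc n. (b(n := a)) j x * X x ^ j)" unfolding f b(2) by (simp add: add.commute)
  moreover have "\<forall>j. (b(n := a)) j \<in> R" using a b by simp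
  ultimately show "f \<in> adjoin_below X (Suc n)" unfolding adjoin_below_def by blast
qed

lemma function_ring_adjoin: "function_ring (adjoin X)"
proof
  show c: "(\<lambda>x. c) \<in> adjoin X" for c
  proof -
    have "(\<lambda>x. c) \<in> adjoin_below X 1"
      unfolding adjoin_below_def by (intro CollectI exI[of _ "\<lambda>j x. c"]) (simp add: const)
    then show ?thesis by (auto simp: adjoin_def)
  qed
  show a: "(\<lambda>x. f x + g x) \<in> adjoin X" if fg: "f \<in> adjoin X" "g \<in> adjoin X" for f g
  proof -
    obtain n m where "f \<in> adjoin_below X n" "g \<in> adjoin_below X m" using fg unfolding adjoin_def by blast
    then have "f \<in> adjoin_below X (max n m)" "g \<in> adjoin_below X (max n m)" by (auto intro: adjoin_below_mono)
    then show ?thesis by (rule adjoinI[OF adjoin_below_add])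
  qed
  have s: "(\<lambda>x. \<Sum>i\<in>I. h i x) \<in> adjoin X" if "finite I" "\<And>i. i \<in> I \<Longrightarrow> h i \<in> adjoin X"
    for I :: "nat set" and h :: "nat \<Rightarrow> 'x \<Rightarrow> real"
    using that by (induction I rule: finite_induct) (auto intro: c a)
  show "(\<lambda>x. f x * g x) \<in> adjoin X" if fg: "f \<in> adjoin X" "g \<in> adjoin X" for f g
  proof -
    obtain n m where f: "f \<in> adjoin_below X n" and g: "g \<in> adjoin_below X m" using fg unfolding adjoin_def by blast
    then obtain b where b: "\<forall>j. b j \<in> R" "f = (\<lambda>x. \<Sum>j<n. b j x * X x ^ j)"
      unfolding adjoin_below_def by blast
    have "(\<lambda>x. \<Sum>j<n. b j x * X x ^ j * g x) \<in> adjoin X"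
      using adjoin_below_shift[OF g] b(1) by (intro s) (auto simp: adjoin_def)
    then show ?thesis by (simp add: b(2) sum_distrib_right)
  qed
qed

lemma adjoin_contains: "f \<in> R \<Longrightarrow> f \<in> adjoin X" "X \<in> adjoin X"
proof -
  have one: "(\<lambda>x. 1) \<in> adjoin_below X 1"
    unfolding adjoin_below_def by (intro CollectI exI[of _ "\<lambda>j x. 1"]) (simp add: const)
  show "f \<in> R \<Longrightarrow> f \<in> adjoin X"
    using adjoin_below_shift[OF one, of f 0] by (auto simp: adjoin_def)
  show "X \<in> adjoin X"
    using adjoin_below_shift[OF one const[of 1], of 1] by (auto simp: adjoin_def)
qed

text \<open>
  Hilbert's argument. The ideal of all leading coefficients is generated by a finite set
  \<open>F\<close>, whose elements occur in degrees at most \<open>N\<close>; for each smaller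
  degree \<open>n\<close> the leading coefficients are generated by a finite set \<open>E
  n\<close>. The elements of \<open>J\<close> realising these coefficients generate
  \<open>J\<close>, because the leading term of any element of \<open>J\<close> can be cancelled
  by a combination of them. Finally each generator involves only finitely many elements of
  \<open>I\<close>.
\<close>

theorem noetherian_adjoin:
  assumes noeth: "noetherian_functions R"
  shows "noetherian_functions (adjoin X)"
  unfolding noetherian_functions_def
proof (intro allI impI)
  fix I assume I: "I \<subseteq> adjoin X"
  interpret A: function_ring "adjoin X" by (rule function_ring_adjoin)
  define J where "J = ideal_gen (adjoin X) I"
  have Jadd: "(\<lambda>x. f x + g x) \<in> J" if "f \<in> J" "g \<in> J" for f g
    using that unfolding J_def by (rule ideal_gen.add)
  have Jmult: "(\<lambda>x. r x * f x) \<in> J" if "f \<in> J" "r \<in> adjoin X" for r f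
    using that unfolding J_def by (rule A.ideal_gen_times)
  \<comment> \<open>leading coefficients of the elements of \<open>J\<close> of formal degree \<open>n\<close>\<close>
  define L where "L n = {a\<in>R. \<exists>g\<in>adjoin_below X n. (\<lambda>x. a x * X x ^ n + g x) \<in> J}" for n
  have LR: "L n \<subseteq> R" for n by (auto simp: L_def)
  then have "(\<Union>n. L n) \<subseteq> R" by blast
  then have "\<exists>F\<subseteq>(\<Union>n. L n). finite F \<and> (\<Union>n. L n) \<subseteq> ideal_gen R F"
    by (rule noeth[unfolded noetherian_functions_def, rule_format])
  then obtain F where F: "F \<subseteq> (\<Union>n. L n)" "finite F" "(\<Union>n. L n) \<subseteq> ideal_gen R F" by blast
  have "\<forall>n. \<exists>F\<subseteq>L n. finite F \<and> L n \<subseteq> ideal_gen R F"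
    by (intro allI noeth[unfolded noetherian_functions_def, rule_format] LR)
  then obtain E where E: "\<And>n. E n \<subseteq> L n" "\<And>n. finite (E n)" "\<And>n. L n \<subseteq> ideal_gen R (E n)" by metis
  have "\<forall>a\<in>F. \<exists>n. a \<in> L n" using F(1) by blast
  then obtain d where d: "\<And>a. a \<in> F \<Longrightarrow> a \<in> L (d a)" by metis
  define N where "N = (\<Sum>a\<in>F. d a)"
  have dN: "d a \<le> N" if "a \<in> F" for a unfolding N_def using F(2) that by (intro member_le_sum) auto
  have "\<forall>n. \<forall>a\<in>L n. \<exists>f\<in>J. \<exists>g\<in>adjoin_below X n. f = (\<lambda>x. a x * X x ^ n + g x)" by (auto simp: L_def)
  then obtain w where w: "\<And>n a. a \<in> L n \<Longrightarrow> w n a \<in> J"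
    "\<And>n a. a \<in> L n \<Longrightarrow> \<exists>g\<in>adjoin_below X n. w n a = (\<lambda>x. a x * X x ^ n + g x)" by metis
  define G where "G = (\<lambda>a. w (d a) a) ` F \<union> (\<Union>n<N. w n ` E n)"
  have finG: "finite G" using F(2) E(2) by (simp add: G_def)
  have GJ: "G \<subseteq> J" using w(1) d E(1) by (auto simp: G_def subset_iff)
  \<comment> \<open>Any combination of leading coefficients is realised by a combination of \<open>G\<close>.\<close>
  have realise: "\<exists>h\<in>ideal_gen (adjoin X) G. \<exists>g\<in>adjoin_below X n. h = (\<lambda>x. a x * X x ^ n + g x)"
    if "a \<in> ideal_gen R D" and D: "\<And>c. c \<in> D \<Longrightarrow> \<exists>m\<le>n. c \<in> L m \<and> w m c \<in> G" for a n D
    using that(1)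
  proof induction
    case zero
    have "(\<lambda>x. 0) \<in> adjoin_below X n"
      unfolding adjoin_below_def by (intro CollectI exI[of _ "\<lambda>j x. 0"]) (simp add: const)
    then show ?case by (intro bexI[of _ "\<lambda>x. 0"] ideal_gen.zero) auto
  next
    case (mult r c)
    obtain m where m: "m \<le> n" "c \<in> L m" "w m c \<in> G" using D[OF mult.hyps(2)] by blast
    obtain g where g: "g \<in> adjoin_below X m" "w m c = (\<lambda>x. c x * X x ^ m + g x)" using w(2)[OF m(2)] by blast
    have "(\<lambda>x. 1) \<in> adjoin_below X 1"
      unfolding adjoin_below_def by (intro CollectI exI[of _ "\<lambda>j x. 1"]) (simp add: const)
    then have "(\<lambda>x. r x * X x ^ (n - m)) \<in> adjoin X"
      using adjoin_below_shift[OF _ mult.hyps(1), of "\<lambda>x. 1" X 1 "n - m"] by (auto simp: adjoin_def)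
    then have "(\<lambda>x. r x * X x ^ (n - m) * w m c x) \<in> ideal_gen (adjoin X) G" using m(3) by (rule ideal_gen.mult)
    then have h: "(\<lambda>x. r x * X x ^ (n - m) * w m c x) \<in> ideal_gen (adjoin X) G" .
    have g': "(\<lambda>x. r x * X x ^ (n - m) * g x) \<in> adjoin_below X n"
      using adjoin_below_shift[OF g(1) mult.hyps(1), of "n - m"] m(1) by simp
    have eq: "(\<lambda>x. r x * X x ^ (n - m) * w m c x) =
        (\<lambda>x. (r x * c x) * X x ^ n + r x * X x ^ (n - m) * g x)"
      unfolding g(2) using m(1) by (simp add: algebra_simps flip: power_add)
    show ?case by (rule realisationI[OF h g' eq])
  next
    case (add a b)
    then obtain h1 g1 h2 g2 where h: "h1 \<in> ideal_gen (adjoin X) G" "h2 \<in> ideal_gen (adjoin X) G"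
      and g: "g1 \<in> adjoin_below X n" "g2 \<in> adjoin_below X n"
      and eq: "h1 = (\<lambda>x. a x * X x ^ n + g1 x)" "h2 = (\<lambda>x. b x * X x ^ n + g2 x)" by blast
    have "(\<lambda>x. h1 x + h2 x) = (\<lambda>x. (a x + b x) * X x ^ n + (g1 x + g2 x))"
      unfolding eq by (simp add: algebra_simps)
    then show ?case by (rule realisationI[OF ideal_gen.add[OF h] adjoin_below_add[OF g]])
  qed
  have below: "f \<in> ideal_gen (adjoin X) G" if "f \<in> J" "f \<in> adjoin_below X n" for f n
    using that
  proof (induction n arbitrary: f)
    case 0
    then have "f = (\<lambda>x. 0)" by (simp add: adjoin_below_def)
    then show ?case by (simp add: ideal_gen.zero)
  next
    case (Suc n)
    obtain a g where a: "a \<in> R" and g: "g \<in> adjoin_below X n" and f: "f = (\<lambda>x. a x * X x ^ n + g x)"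
      using Suc.prems(2) adjoin_below_Suc by blast
    have aL: "a \<in> L n" using a g Suc.prems(1) f by (auto simp: L_def)
    have "\<exists>h\<in>ideal_gen (adjoin X) G. \<exists>g\<in>adjoin_below X n. h = (\<lambda>x. a x * X x ^ n + g x)"
    proof (cases "n < N")
      case True
      show ?thesis
      proof (rule realise)
        show "a \<in> ideal_gen R (E n)" using aL E(3) by blast
        show "\<exists>m\<le>n. c \<in> L m \<and> w m c \<in> G" if "c \<in> E n" for c
          using that E(1) True by (intro exI[of _ n]) (auto simp: G_def)
      qed
    next
      case False
      show ?thesis
      proof (rule realise)
        show "a \<in> ideal_gen R F" using aL F(3) by blast
        show "\<exists>m\<le>n. c \<in> L m \<and> w m c \<in> G" if "c \<in> F" for c
          using that d dN[OF that] False by (intro exI[of _ "d c"]) (auto simp: G_def)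
      qed
    qed
    then obtain h g' where h: "h \<in> ideal_gen (adjoin X) G" "g' \<in> adjoin_below X n" "h = (\<lambda>x. a x * X x ^ n + g' x)" by blast
    have "G \<subseteq> adjoin X" using GJ A.ideal_gen_subset I unfolding J_def by blast
    have "h \<in> J" using A.ideal_gen_trans[OF h(1), of I] GJ unfolding J_def by blast
    then have "(\<lambda>x. f x + -1 * h x) \<in> J" using Suc.prems(1) Jadd Jmult[OF _ A.const[of "-1"]] by blast
    moreover have "(\<lambda>x. f x + -1 * h x) \<in> adjoin_below X n"
    proof -
      have "(\<lambda>x. -1 * X x ^ 0 * g' x) \<in> adjoin_below X (n + 0)" by (rule adjoin_below_shift[OF h(2) const])
      from adjoin_below_add[OF g, of "\<lambda>x. -1 * X x ^ 0 * g' x"] this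
      show ?thesis by (simp add: f h(3))
    qed
    ultimately have "(\<lambda>x. f x + -1 * h x) \<in> ideal_gen (adjoin X) G" by (rule Suc.IH)
    from ideal_gen.add[OF this h(1)] show ?case by simp
  qed
  have JG: "J \<subseteq> ideal_gen (adjoin X) G"
  proof
    fix f assume f: "f \<in> J"
    then have "f \<in> adjoin X" unfolding J_def using I by (rule A.ideal_gen_subset)
    then obtain n where "f \<in> adjoin_below X n" unfolding adjoin_def by blast
    with f show "f \<in> ideal_gen (adjoin X) G" by (rule below)
  qed
  have "\<forall>g\<in>G. \<exists>K\<subseteq>I. finite K \<and> g \<in> ideal_gen (adjoin X) K" using GJ ideal_gen_finite unfolding J_def by blast
  then obtain K where K: "\<And>g. g \<in> G \<Longrightarrow> K g \<subseteq> I \<and> finite (K g) \<and> g \<in> ideal_gen (adjoin X) (K g)" by metis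
  have "f \<in> ideal_gen (adjoin X) (\<Union>g\<in>G. K g)" if "f \<in> I" for f
  proof (rule A.ideal_gen_trans)
    show "f \<in> ideal_gen (adjoin X) G" using JG A.ideal_gen_base[OF that] by (auto simp: J_def)
    show "G \<subseteq> ideal_gen (adjoin X) (\<Union>g\<in>G. K g)" using K by (blast intro: ideal_gen_mono)
  qed
  then show "\<exists>F\<subseteq>I. finite F \<and> I \<subseteq> ideal_gen (adjoin X) F"
    using K finG by (intro exI[of _ "\<Union>g\<in>G. K g"]) blast
qed

end

text \<open>The coordinates are adjoined to the constants one at a time.\<close>

lemma noetherian_polynomial_functions:
  "\<exists>R. function_ring R \<and> noetherian_functions R \<and> R \<subseteq> Collect real_polynomial_function \<and>
     (\<forall>i\<in>V. (\<lambda>x::real^'n::finite. x $ i) \<in> R)"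
proof -
  have "finite V" by simp
  then show ?thesis
  proof (induction V rule: finite_induct)
    case empty
    define R :: "(real^'n \<Rightarrow> real) set" where "R = range (\<lambda>c x. c)"
    have "function_ring R" by unfold_locales (auto simp: R_def)
    moreover have "noetherian_functions R"
      unfolding noetherian_functions_def
    proof (intro allI impI)
      fix I assume I: "I \<subseteq> R"
      show "\<exists>F\<subseteq>I. finite F \<and> I \<subseteq> ideal_gen R F"
      proof (cases "I \<subseteq> {\<lambda>x. 0}")
        case True
        then show ?thesis by (intro exI[of _ "{}"]) (auto intro: ideal_gen.zero)
      next
        case False
        then obtain f where f: "f \<in> I" "f \<noteq> (\<lambda>x. 0)" by blast
        then obtain c where c: "f = (\<lambda>x. c)" "c \<noteq> 0" using I by (auto simp: R_def)
        have "g \<in> ideal_gen R {f}" if gI: "g \<in> I" for g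
        proof -
          obtain e where e: "g = (\<lambda>x. e)" using gI I by (auto simp: R_def)
          have "(\<lambda>x. (e / c) * f x) \<in> ideal_gen R {f}" by (rule ideal_gen.mult) (auto simp: R_def)
          then show ?thesis using c e by simp
        qed
        then show ?thesis using f by (intro exI[of _ "{f}"]) auto
      qed
    qed
    ultimately show ?case by (intro exI[of _ R]) (auto simp: R_def intro: real_polynomial_function_const)
  next
    case (insert i V)
    then obtain R :: "(real^'n \<Rightarrow> real) set" where R: "function_ring R" "noetherian_functions R"
      "R \<subseteq> Collect real_polynomial_function" "\<forall>i\<in>V. (\<lambda>x. x $ i) \<in> R" by blast
    interpret function_ring R by fact
    have "adjoin (\<lambda>x. x $ i) \<subseteq> Collect real_polynomial_function"
    proof
      fix f assume "f \<in> adjoin (\<lambda>x. x $ i)"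
      then obtain n b where "\<forall>j. b j \<in> R" "f = (\<lambda>x. \<Sum>j<n. b j x * x $ i ^ j)"
        unfolding adjoin_def adjoin_below_def by blast
      then show "f \<in> Collect real_polynomial_function"
        using R(3) by (auto intro!: real_polynomial_function_sum real_polynomial_function_mult real_polynomial_function_power)
    qed
    then show ?case using function_ring_adjoin noetherian_adjoin[OF R(2)] adjoin_contains R(4)
      by (intro exI[of _ "adjoin (\<lambda>x. x $ i)"]) auto
  qed
qed

text \<open>
  The ideal of \<open>X\<close> is generated by finitely many polynomials, whose sum of squares
  has the same real zeros.
\<close>

theorem zariski_closure_one_equation:
  fixes X :: "(real^'n::finite) set"
  shows "\<exists>f. real_polynomial_function f \<and> zariski_closure X = {x. f x = 0}"
proof -
  obtain R :: "(real^'n \<Rightarrow> real) set" where R: "function_ring R" "noetherian_functions R"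
    "R \<subseteq> Collect real_polynomial_function" "\<forall>i. (\<lambda>x. x $ i) \<in> R"
    using noetherian_polynomial_functions[of UNIV] by blast
  interpret function_ring R by fact
  have sumR: "(\<lambda>x. \<Sum>j\<in>J. h j x) \<in> R" if "finite J" "\<And>j. j \<in> J \<Longrightarrow> h j \<in> R"
    for J :: "'n set" and h :: "'n \<Rightarrow> real^'n \<Rightarrow> real"
    using that by (induction J rule: finite_induct) (auto intro: const add)
  have all: "f \<in> R" if "real_polynomial_function f" for f
    using that
  proof induction
    case (linear f)
    have eq: "(\<lambda>x. \<Sum>j\<in>UNIV. x $ j * f (axis j 1)) = f"
      by (rule ext, rule linear_functional_eq_sum[OF bounded_linear.linear[OF linear], symmetric])
    have "(\<lambda>x. \<Sum>j\<in>UNIV. x $ j * f (axis j 1)) \<in> R"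
      using R(4) by (intro sumR mult const) auto
    then show ?case by (rule back_subst[OF _ eq])
  qed (auto intro: const add mult)
  define I where "I = {f. real_polynomial_function f \<and> (\<forall>y\<in>X. f y = 0)}"
  have "I \<subseteq> R" using all by (auto simp: I_def)
  then obtain F where F: "F \<subseteq> I" "finite F" "I \<subseteq> ideal_gen R F"
    using R(2) unfolding noetherian_functions_def by blast
  have vanish: "f x = 0" if "f \<in> ideal_gen R F" "\<forall>g\<in>F. g x = 0" for f x
    using that by induction auto
  define f where "f x = (\<Sum>g\<in>F. g x ^ 2)" for x
  have f: "real_polynomial_function f" unfolding f_def
    using F(1,2) by (intro real_polynomial_function_sum real_polynomial_function_power) (auto simp: I_def)
  have f0: "f x = 0 \<longleftrightarrow> (\<forall>g\<in>F. g x = 0)" for x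
    unfolding f_def using F(2) by (simp add: sum_nonneg_eq_0_iff)
  have "zariski_closure X = {x. \<forall>g\<in>I. g x = 0}" by (simp add: zariski_closure_def I_def)
  also have "\<dots> = {x. f x = 0}"
  proof (intro subset_antisym subsetI CollectI)
    show "f x = 0" if "x \<in> {x. \<forall>g\<in>I. g x = 0}" for x using that F(1) f0 by blast
    show "\<forall>g\<in>I. g x = 0" if "x \<in> {x. f x = 0}" for x
    proof
      fix g assume "g \<in> I"
      then have "g \<in> ideal_gen R F" using F(3) by blast
      then show "g x = 0" by (rule vanish) (use that f0 in simp)
    qed
  qed
  finally show ?thesis using f by blast
qed

section \<open>Boolean combinations\<close>

lemma boolean_combinations_Int:
  "A \<in> boolean_combinations F \<Longrightarrow> B \<in> boolean_combinations F \<Longrightarrow> A \<inter> B \<in> boolean_combinations F"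
  using boolean_combinations.Compl[OF boolean_combinations.Un[OF boolean_combinations.Compl boolean_combinations.Compl]]
  by (metis Compl_Un double_compl)

lemma boolean_combinations_Diff:
  "A \<in> boolean_combinations F \<Longrightarrow> B \<in> boolean_combinations F \<Longrightarrow> A - B \<in> boolean_combinations F"
  unfolding Diff_eq by (intro boolean_combinations_Int boolean_combinations.Compl)

lemma boolean_combinations_UNION:
  assumes "{} \<in> F" "finite I" "\<And>i. i \<in> I \<Longrightarrow> A i \<in> boolean_combinations F"
  shows "(\<Union>i\<in>I. A i) \<in> boolean_combinations F"
  using assms(2,3) by (induction I rule: finite_induct) (auto intro: boolean_combinations.intros assms(1))

lemma boolean_combinations_determined:
  assumes "X \<in> boolean_combinations F"
  shows "\<exists>\<A>\<subseteq>F. finite \<A> \<and> (\<forall>x y. (\<forall>A\<in>\<A>. x \<in> A \<longleftrightarrow> y \<in> A) \<longrightarrow> (x \<in> X \<longleftrightarrow> y \<in> X))"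
  using assms
proof induction
  case (base A)
  then show ?case by (intro exI[of _ "{A}"]) auto
next
  case (Compl A)
  then show ?case by auto
next
  case (Un A B)
  then obtain \<A> \<B> where
    \<A>: "\<A> \<subseteq> F" "finite \<A>" "\<forall>x y. (\<forall>C\<in>\<A>. x \<in> C \<longleftrightarrow> y \<in> C) \<longrightarrow> (x \<in> A \<longleftrightarrow> y \<in> A)"
    and \<B>: "\<B> \<subseteq> F" "finite \<B>" "\<forall>x y. (\<forall>A\<in>\<B>. x \<in> A \<longleftrightarrow> y \<in> A) \<longrightarrow> (x \<in> B \<longleftrightarrow> y \<in> B)" by blast
  show ?case
  proof (intro exI[of _ "\<A> \<union> \<B>"] conjI allI impI)
    fix x y assume "\<forall>C\<in>\<A> \<union> \<B>. x \<in> C \<longleftrightarrow> y \<in> C"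
    then have "x \<in> A \<longleftrightarrow> y \<in> A" "x \<in> B \<longleftrightarrow> y \<in> B" using \<A>(3) \<B>(3) by simp_all
    then show "x \<in> A \<union> B \<longleftrightarrow> y \<in> A \<union> B" by simp
  qed (use \<A> \<B> in auto)
qed

lemma boolean_combinations_affine_part:
  assumes "B \<in> boolean_combinations (Collect arc_symmetric)"
  shows "{x::real^'d::finite. affine_embed x \<in> B} \<in> boolean_combinations (Collect loc_arc_sym)"
  using assms
proof induction
  case (base A)
  then show ?case using loc_arc_sym_affine_part by (intro boolean_combinations.base) auto
next
  case (Compl A)
  have "{x::real^'d. affine_embed x \<in> - A} = - {x. affine_embed x \<in> A}" by auto
  then show ?case using boolean_combinations.Compl[OF Compl.IH] by simp
next
  case (Un A B)
  have "{x::real^'d. affine_embed x \<in> A \<union> B} = {x. affine_embed x \<in> A} \<union> {x. affine_embed x \<in> B}" by auto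
  then show ?case using boolean_combinations.Un[OF Un.IH] by simp
qed

section \<open>Invariants of a finite group of permutations\<close>

definition polynomial_coeffs :: "(real^'n::finite \<Rightarrow> real poly) \<Rightarrow> bool" where
  "polynomial_coeffs F \<longleftrightarrow> (\<forall>k. real_polynomial_function (\<lambda>x. coeff (F x) k))"

lemma polynomial_coeffs_const: "polynomial_coeffs (\<lambda>x. p)"
  by (simp add: polynomial_coeffs_def real_polynomial_function_const)

lemma polynomial_coeffs_pCons:
  assumes "real_polynomial_function f" "polynomial_coeffs F"
  shows "polynomial_coeffs (\<lambda>x. pCons (f x) (F x))"
  unfolding polynomial_coeffs_def
proof
  fix k show "real_polynomial_function (\<lambda>x. coeff (pCons (f x) (F x)) k)"
    using assms by (cases k) (auto simp: polynomial_coeffs_def)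
qed

lemma polynomial_coeffs_mult:
  assumes "polynomial_coeffs F" "polynomial_coeffs H"
  shows "polynomial_coeffs (\<lambda>x. F x * H x)"
  using assms unfolding polynomial_coeffs_def coeff_mult
  by (intro allI real_polynomial_function_sum real_polynomial_function_mult) auto

lemma polynomial_coeffs_prod:
  "(\<And>i. i \<in> I \<Longrightarrow> polynomial_coeffs (F i)) \<Longrightarrow> polynomial_coeffs (\<lambda>x. \<Prod>i\<in>I. F i x)"
  by (induction I rule: infinite_finite_induct) (auto intro: polynomial_coeffs_const polynomial_coeffs_mult)

lemma polynomial_coeffs_sum:
  assumes "finite I" "\<And>i. i \<in> I \<Longrightarrow> polynomial_coeffs (F i)" shows "polynomial_coeffs (\<lambda>x. \<Sum>i\<in>I. F i x)"
  using assms unfolding polynomial_coeffs_def coeff_sum by (auto intro: real_polynomial_function_sum)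

lemma polynomial_coeffs_smult:
  assumes "real_polynomial_function f" "polynomial_coeffs F" shows "polynomial_coeffs (\<lambda>x. smult (f x) (F x))"
  using assms unfolding polynomial_coeffs_def coeff_smult by (auto intro: real_polynomial_function_mult)

definition sq_dist :: "real^'d::finite \<Rightarrow> real^'d \<Rightarrow> real" where
  "sq_dist y x = (\<Sum>j\<in>UNIV. (x $ j - y $ j) ^ 2)"

lemma sq_dist_nonneg: "0 \<le> sq_dist y x" by (simp add: sq_dist_def sum_nonneg)

lemma sq_dist_eq_0: "sq_dist y x = 0 \<longleftrightarrow> x = y"
  by (simp add: sq_dist_def sum_nonneg_eq_0_iff vec_eq_iff)

lemma real_polynomial_function_sq_dist: "real_polynomial_function (sq_dist y)"
  unfolding sq_dist_def[abs_def]
  by (intro real_polynomial_function_sum real_polynomial_function_power real_polynomial_function_diff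
      real_polynomial_function_nth real_polynomial_function_const) auto

locale permutation_quotient =
  fixes G :: "('g, 'b) monoid_scheme" and \<sigma> :: "'g \<Rightarrow> 'd::finite \<Rightarrow> 'd"
    and p :: "'m::finite \<Rightarrow> real^'d \<Rightarrow> real"
  assumes grp: "group G" and fin: "finite (carrier G)" and act: "group_action G UNIV \<sigma>"
    and gen: "generated_subalgebra (range p) = invariant_polynomials G (perm_action G \<sigma>)"
begin

abbreviation eG where "eG \<equiv> \<one>\<^bsub>G\<^esub>"
abbreviation ac :: "'g \<Rightarrow> real^'d \<Rightarrow> real^'d" where "ac \<equiv> perm_action G \<sigma>"

definition quot :: "real^'d \<Rightarrow> real^'m" where "quot x = (\<chi> i. p i x)"

lemma one_in: "eG \<in> carrier G" using grp by (simp add: group.is_monoid monoid.one_closed)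

lemma mult_in: "g \<in> carrier G \<Longrightarrow> h \<in> carrier G \<Longrightarrow> g \<otimes>\<^bsub>G\<^esub> h \<in> carrier G"
  using grp by (simp add: group.is_monoid monoid.m_closed)

lemma ac_one: "ac eG x = x"
proof -
  have "\<sigma> eG i = i" for i using group_action.id_eq_one[OF act] by (metis UNIV_I restrict_apply')
  moreover have "inv\<^bsub>G\<^esub> eG = eG" using grp by (simp add: group.is_monoid monoid.inv_one)
  ultimately show ?thesis by (simp add: perm_action_def vec_eq_iff)
qed

lemma ac_mult:
  assumes "g \<in> carrier G" "h \<in> carrier G" shows "ac g (ac h x) = ac (g \<otimes>\<^bsub>G\<^esub> h) x"
proof -
  have "inv\<^bsub>G\<^esub> (g \<otimes>\<^bsub>G\<^esub> h) = inv\<^bsub>G\<^esub> h \<otimes>\<^bsub>G\<^esub> inv\<^bsub>G\<^esub> g"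
    using grp assms by (simp add: group.inv_mult_group)
  moreover have "\<sigma> (inv\<^bsub>G\<^esub> h \<otimes>\<^bsub>G\<^esub> inv\<^bsub>G\<^esub> g) i = \<sigma> (inv\<^bsub>G\<^esub> h) (\<sigma> (inv\<^bsub>G\<^esub> g) i)" for i
    using group_action.composition_rule[OF act] grp assms by (simp add: group.inv_closed)
  ultimately show ?thesis by (simp add: perm_action_def vec_eq_iff)
qed

lemma bij_right_mult:
  assumes h: "h \<in> carrier G" shows "bij_betw (\<lambda>g. g \<otimes>\<^bsub>G\<^esub> h) (carrier G) (carrier G)"
proof -
  interpret group G by (rule grp)
  show ?thesis
    by (rule bij_betw_byWitness[where f' = "\<lambda>g. g \<otimes>\<^bsub>G\<^esub> inv\<^bsub>G\<^esub> h"]) (use h in \<open>auto simp: m_assoc\<close>)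
qed

lemma inverse_action: "g \<in> carrier G \<Longrightarrow> \<exists>h\<in>carrier G. ac h (ac g x) = x"
proof -
  interpret group G by (rule grp)
  assume g: "g \<in> carrier G"
  then have "ac (inv\<^bsub>G\<^esub> g) (ac g x) = x" by (simp add: ac_mult ac_one)
  then show ?thesis using g by blast
qed

lemma ac_poly: "real_polynomial_function (\<lambda>x. ac g x $ i)"
  by (auto simp: perm_action_def)

lemma ac_poly_compose: "real_polynomial_function q \<Longrightarrow> real_polynomial_function (\<lambda>x. q (ac g x))"
  by (rule real_polynomial_function_substitute[OF _ ac_poly])

lemma invariant_poly_of_quot:
  assumes f: "real_polynomial_function f" "\<And>g x. g \<in> carrier G \<Longrightarrow> f (ac g x) = f x"
  shows "\<exists>P. real_polynomial_function P \<and> (\<forall>x. f x = P (quot x))"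
proof -
  have "f \<in> generated_subalgebra (range p)" using f by (simp add: gen invariant_polynomials_def)
  then show ?thesis
  proof induction
    case (gen f)
    then obtain i where "f = p i" by blast
    then show ?case by (intro exI[of _ "\<lambda>y. y $ i"]) (auto simp: quot_def)
  next
    case (const c)
    show ?case by (intro exI[of _ "\<lambda>y. c"]) (auto intro: real_polynomial_function_const)
  next
    case (add f h)
    then obtain P Q where "real_polynomial_function P" "\<forall>x. f x = P (quot x)"
      "real_polynomial_function Q" "\<forall>x. h x = Q (quot x)" by blast
    then show ?case by (intro exI[of _ "\<lambda>y. P y + Q y"]) auto
  next
    case (mult f h)
    then obtain P Q where "real_polynomial_function P" "\<forall>x. f x = P (quot x)"
      "real_polynomial_function Q" "\<forall>x. h x = Q (quot x)" by blast
    then show ?case by (intro exI[of _ "\<lambda>y. P y * Q y"]) auto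
  qed
qed

lemma p_invariant: "real_polynomial_function (p i)" "g \<in> carrier G \<Longrightarrow> p i (ac g x) = p i x"
proof -
  have "p i \<in> invariant_polynomials G ac"
    using generated_subalgebra.gen[of "p i" "range p"] gen by auto
  then show "real_polynomial_function (p i)" "g \<in> carrier G \<Longrightarrow> p i (ac g x) = p i x"
    by (auto simp: invariant_polynomials_def)
qed

lemma quot_invariant: "g \<in> carrier G \<Longrightarrow> quot (ac g x) = quot x"
  by (simp add: quot_def p_invariant vec_eq_iff)

lemma quot_poly: "real_polynomial_function (\<lambda>x. quot x $ i)"
  by (simp add: quot_def p_invariant(1))

text \<open>
  The polynomial that sends \<open>z\<close> to the product of the squared distances of all
  \<open>ac g z\<close> to \<open>y\<close> is invariant and vanishes exactly on the orbit of
  \<open>y\<close>, so the invariants separate the orbits.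
\<close>

lemma quot_eq_imp_orbit:
  assumes "quot x = quot y" shows "\<exists>g\<in>carrier G. ac g x = y"
proof -
  define f where "f z = (\<Prod>g\<in>carrier G. sq_dist y (ac g z))" for z
  have "f (ac h z) = f z" if h: "h \<in> carrier G" for h z
  proof -
    have "f (ac h z) = (\<Prod>g\<in>carrier G. sq_dist y (ac (g \<otimes>\<^bsub>G\<^esub> h) z))"
      unfolding f_def using h by (intro prod.cong) (auto simp: ac_mult)
    also have "\<dots> = f z" unfolding f_def by (rule prod.reindex_bij_betw[OF bij_right_mult[OF h]])
    finally show ?thesis .
  qed
  moreover have "real_polynomial_function f" unfolding f_def
    by (intro real_polynomial_function_prod fin ac_poly_compose real_polynomial_function_sq_dist)
  ultimately obtain P where P: "\<forall>x. f x = P (quot x)" using invariant_poly_of_quot by blast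
  have "f y = 0" unfolding f_def using fin one_in ac_one sq_dist_eq_0 by (metis prod_zero)
  then have "f x = 0" using P assms by simp
  then show ?thesis using fin by (auto simp: f_def sq_dist_eq_0)
qed

definition factor :: "(real^'d \<Rightarrow> real) \<Rightarrow> 'g \<Rightarrow> real^'d \<Rightarrow> real poly" where
  "factor l g x = [:- l (ac g x), 1:]"

text \<open>The roots are the values of \<open>l\<close> on the orbit of \<open>x\<close>.\<close>

definition orbit_poly :: "(real^'d \<Rightarrow> real) \<Rightarrow> real^'d \<Rightarrow> real poly" where
  "orbit_poly l x = (\<Prod>g\<in>carrier G. factor l g x)"

text \<open>
  Lagrange interpolation of the values \<open>q (ac g x)\<close> at the nodes \<open>l (ac g
  x)\<close>, without the denominators. The coefficients are therefore polynomial in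
  \<open>x\<close>, also where nodes coincide, and the value at the node \<open>l x\<close> is
  \<open>q x\<close> times the derivative of the orbit polynomial at \<open>l x\<close>.
\<close>

definition lagrange :: "(real^'d \<Rightarrow> real) \<Rightarrow> (real^'d \<Rightarrow> real) \<Rightarrow> real^'d \<Rightarrow> real poly" where
  "lagrange l q x = (\<Sum>g\<in>carrier G. smult (q (ac g x)) (\<Prod>k\<in>carrier G. if k = g then 1 else factor l k x))"

lemma factor_shift: "g \<in> carrier G \<Longrightarrow> h \<in> carrier G \<Longrightarrow> factor l g (ac h x) = factor l (g \<otimes>\<^bsub>G\<^esub> h) x"
  by (simp add: factor_def ac_mult)

lemma orbit_poly_invariant:
  assumes h: "h \<in> carrier G" shows "orbit_poly l (ac h x) = orbit_poly l x"
proof -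
  have "orbit_poly l (ac h x) = (\<Prod>g\<in>carrier G. factor l (g \<otimes>\<^bsub>G\<^esub> h) x)"
    unfolding orbit_poly_def using h by (intro prod.cong) (auto simp: factor_shift)
  also have "\<dots> = orbit_poly l x"
    unfolding orbit_poly_def by (rule prod.reindex_bij_betw[OF bij_right_mult[OF h]])
  finally show ?thesis .
qed

lemma lagrange_invariant:
  assumes h: "h \<in> carrier G" shows "lagrange l q (ac h x) = lagrange l q x"
proof -
  let ?t = "\<lambda>g. smult (q (ac g x)) (\<Prod>k\<in>carrier G. if k = g then 1 else factor l k x)"
  have inj: "inj_on (\<lambda>g. g \<otimes>\<^bsub>G\<^esub> h) (carrier G)" using bij_right_mult[OF h] by (rule bij_betw_imp_inj_on)
  have "lagrange l q (ac h x) = (\<Sum>g\<in>carrier G. ?t (g \<otimes>\<^bsub>G\<^esub> h))"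
    unfolding lagrange_def
  proof (rule sum.cong[OF refl])
    fix g assume g: "g \<in> carrier G"
    have "(\<Prod>k\<in>carrier G. if k = g then 1 else factor l k (ac h x)) =
        (\<Prod>k\<in>carrier G. if k \<otimes>\<^bsub>G\<^esub> h = g \<otimes>\<^bsub>G\<^esub> h then 1 else factor l (k \<otimes>\<^bsub>G\<^esub> h) x)"
      using g h inj by (intro prod.cong refl) (auto simp: factor_shift inj_on_def)
    also have "\<dots> = (\<Prod>k\<in>carrier G. if k = g \<otimes>\<^bsub>G\<^esub> h then 1 else factor l k x)"
      by (rule prod.reindex_bij_betw[OF bij_right_mult[OF h]])
    finally show "smult (q (ac g (ac h x))) (\<Prod>k\<in>carrier G. if k = g then 1 else factor l k (ac h x)) = ?t (g \<otimes>\<^bsub>G\<^esub> h)"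
      using g h by (simp add: ac_mult)
  qed
  also have "\<dots> = lagrange l q x"
    unfolding lagrange_def by (rule sum.reindex_bij_betw[OF bij_right_mult[OF h]])
  finally show ?thesis .
qed

lemma factor_coeffs: "real_polynomial_function l \<Longrightarrow> polynomial_coeffs (\<lambda>x. factor l g x)"
  unfolding factor_def
  by (rule polynomial_coeffs_pCons[OF real_polynomial_function_minus[OF ac_poly_compose] polynomial_coeffs_const])

lemma orbit_poly_coeffs:
  assumes "real_polynomial_function l"
  shows "\<exists>P. \<forall>k. real_polynomial_function (P k) \<and> (\<forall>x. coeff (orbit_poly l x) k = P k (quot x))"
proof -
  have "polynomial_coeffs (orbit_poly l)" unfolding orbit_poly_def[abs_def]
    by (intro polynomial_coeffs_prod factor_coeffs assms)
  then have "\<exists>P. real_polynomial_function P \<and> (\<forall>x. coeff (orbit_poly l x) k = P (quot x))" for k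
    by (intro invariant_poly_of_quot) (auto simp: polynomial_coeffs_def orbit_poly_invariant)
  then show ?thesis by metis
qed

lemma lagrange_coeffs:
  assumes "real_polynomial_function l" "real_polynomial_function q"
  shows "\<exists>P. \<forall>k. real_polynomial_function (P k) \<and> (\<forall>x. coeff (lagrange l q x) k = P k (quot x))"
proof -
  have f: "polynomial_coeffs (\<lambda>x. if k = g then 1 else factor l k x)" for k g
    using factor_coeffs[OF assms(1)] polynomial_coeffs_const by (cases "k = g") auto
  have "polynomial_coeffs (lagrange l q)" unfolding lagrange_def[abs_def]
    by (rule polynomial_coeffs_sum[OF fin],
        rule polynomial_coeffs_smult[OF ac_poly_compose[OF assms(2)] polynomial_coeffs_prod[OF f]])
  then have "\<exists>P. real_polynomial_function P \<and> (\<forall>x. coeff (lagrange l q x) k = P (quot x))" for k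
    by (intro invariant_poly_of_quot) (auto simp: polynomial_coeffs_def lagrange_invariant)
  then show ?thesis by metis
qed

lemma degree_factor_prod:
  "degree (\<Prod>k\<in>carrier G. if Q k then 1 else factor l k x) \<le> card (carrier G)"
proof -
  have "degree (\<Prod>k\<in>carrier G. if Q k then 1 else factor l k x) \<le>
      (\<Sum>k\<in>carrier G. (degree \<circ> (\<lambda>k. if Q k then 1 else factor l k x)) k)"
    by (rule degree_prod_sum_le[OF fin])
  also have "\<dots> \<le> (\<Sum>k\<in>carrier G. 1)" by (intro sum_mono) (simp add: factor_def)
  finally show ?thesis by simp
qed

lemma degree_orbit_poly: "degree (orbit_poly l x) \<le> card (carrier G)"
  using degree_factor_prod[of "\<lambda>k. False" l x] by (simp add: orbit_poly_def)

lemma degree_lagrange: "degree (lagrange l q x) \<le> card (carrier G)"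
  unfolding lagrange_def
  by (intro degree_sum_le fin order_trans[OF degree_smult_le] degree_factor_prod)

lemma poly_orbit_poly: "poly (orbit_poly l x) t = (\<Prod>g\<in>carrier G. t - l (ac g x))"
  by (simp add: orbit_poly_def poly_prod factor_def)

lemma poly_lagrange:
  "poly (lagrange l q x) (l x) = q x * (\<Prod>k\<in>carrier G - {eG}. l x - l (ac k x))"
proof -
  have summand: "poly (smult (q (ac g x)) (\<Prod>k\<in>carrier G. if k = g then 1 else factor l k x)) (l x) =
      (if g = eG then q x * (\<Prod>k\<in>carrier G - {eG}. l x - l (ac k x)) else 0)" if g: "g \<in> carrier G" for g
  proof -
    have eq: "poly (\<Prod>k\<in>carrier G. if k = g then 1 else factor l k x) (l x) =
      (\<Prod>k\<in>carrier G. if k = g then 1 else l x - l (ac k x))"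
      unfolding poly_prod by (intro prod.cong) (auto simp: factor_def)
    show ?thesis
    proof (cases "g = eG")
      case True
      have "(\<Prod>k\<in>carrier G. if k = eG then 1 else l x - l (ac k x)) = (\<Prod>k\<in>carrier G - {eG}. l x - l (ac k x))"
        by (subst prod.remove[OF fin one_in]) (auto intro: prod.cong)
      then show ?thesis using True eq by (simp add: ac_one)
    next
      case False
      have "(\<Prod>k\<in>carrier G. if k = g then 1 else l x - l (ac k x)) = 0"
        by (rule prod_zero[OF fin]) (use one_in False ac_one in \<open>auto intro!: bexI[of _ eG]\<close>)
      then show ?thesis using False eq by simp
    qed
  qed
  have "poly (lagrange l q x) (l x) =
      (\<Sum>g\<in>carrier G. if g = eG then q x * (\<Prod>k\<in>carrier G - {eG}. l x - l (ac k x)) else 0)"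
    unfolding lagrange_def poly_sum using summand by (intro sum.cong) auto
  also have "\<dots> = q x * (\<Prod>k\<in>carrier G - {eG}. l x - l (ac k x))"
    using fin one_in by (simp add: sum.delta)
  finally show ?thesis .
qed

lemma pderiv_orbit_poly:
  "poly (pderiv (orbit_poly l x)) (l x) = (\<Prod>k\<in>carrier G - {eG}. l x - l (ac k x))"
proof -
  define r where "r = (\<Prod>k\<in>carrier G - {eG}. factor l k x)"
  have "orbit_poly l x = factor l eG x * r"
    unfolding orbit_poly_def r_def by (rule prod.remove[OF fin one_in])
  then have "pderiv (orbit_poly l x) = factor l eG x * pderiv r + r * pderiv (factor l eG x)"
    by (simp only: pderiv_mult)
  moreover have "poly (factor l eG x) (l x) = 0" "pderiv (factor l eG x) = 1"
    by (simp_all add: factor_def ac_one pderiv_pCons)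
  ultimately have "poly (pderiv (orbit_poly l x)) (l x) = poly r (l x)" by simp
  then show ?thesis by (simp add: r_def poly_prod factor_def)
qed

section \<open>Lifting analytic curves through the quotient map\<close>

definition stable :: "(real^'d) set \<Rightarrow> bool" where
  "stable S \<longleftrightarrow> (\<forall>g\<in>carrier G. \<forall>x\<in>S. ac g x \<in> S)"

definition free :: "(real^'d) set \<Rightarrow> bool" where
  "free S \<longleftrightarrow> (\<forall>x\<in>S. \<forall>g\<in>carrier G. ac g x = x \<longrightarrow> g = eG)"

text \<open>
  Let \<open>l\<close> be the squared distance to \<open>x0\<close>. The orbit polynomial of
  \<open>l\<close> descends to the quotient, so along \<open>y\<close> its coefficients are
  analytic. At the parameter 0 it has the simple root 0, since the other points of the orbit of
  \<open>x0\<close> have positive distance to \<open>x0\<close>, and this root continues to an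
  analytic function \<open>\<tau>\<close>. For small negative parameters some point of the fibre
  in \<open>B\<close> has \<open>l\<close> equal to \<open>\<tau>\<close>, and its coordinates
  are analytic functions of \<open>y\<close> and \<open>\<tau>\<close> by Lagrange
  interpolation.
\<close>

lemma local_lift:
  assumes B: "stable B" "free B" and x0: "x0 \<in> B" "quot x0 = y 0"
    and y: "analytic_curve y" and left: "\<forall>\<^sub>F s in at_left 0. y s \<in> quot ` B"
  shows "\<exists>\<alpha>. analytic_curve \<alpha> \<and> (\<forall>\<^sub>F s in at_left 0. \<alpha> s \<in> B \<and> quot (\<alpha> s) = y s)"
proof -
  define l where "l = sq_dist x0"
  have l: "real_polynomial_function l" unfolding l_def by (rule real_polynomial_function_sq_dist)
  have l0: "l x0 = 0" by (simp add: l_def sq_dist_eq_0)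
  define n where "n = card (carrier G)"
  define d0 where "d0 = (\<Prod>k\<in>carrier G - {eG}. l x0 - l (ac k x0))"
  have d0: "d0 \<noteq> 0"
  proof -
    have "l (ac k x0) \<noteq> 0" if "k \<in> carrier G - {eG}" for k
      using that B(2) x0(1) by (auto simp: l_def sq_dist_eq_0 free_def)
    then show ?thesis using fin by (simp add: d0_def l0)
  qed
  obtain C where C: "\<And>k. real_polynomial_function (C k)" "\<And>k x. coeff (orbit_poly l x) k = C k (quot x)"
    using orbit_poly_coeffs[OF l] by metis
  have "\<forall>k. \<exists>f. f analytic_on {0} \<and> (\<forall>\<^sub>F s in nhds 0. of_real (C k (y s)) = f (of_real s))"
    using analytic_germ_poly[OF C(1) y] unfolding analytic_germ_def by blast
  then obtain f where f: "\<And>k. f k analytic_on {0}" "\<And>k. \<forall>\<^sub>F s in nhds 0. of_real (C k (y s)) = f k (of_real s)"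
    by metis
  have "\<forall>k. \<exists>r>0. f k holomorphic_on ball 0 r" using f(1) by (simp add: analytic_at_ball)
  then obtain R where R: "\<And>k. R k > 0" "\<And>k. f k holomorphic_on ball 0 (R k)" by metis
  define r where "r = Min (R ` {..n})"
  have r: "r > 0" "\<And>k. k \<le> n \<Longrightarrow> r \<le> R k" using R(1) by (auto simp: r_def)
  define c where "c k = (if k \<le> n then f k else (\<lambda>_. 0))" for k
  have c: "c k holomorphic_on ball 0 r" for k
    using R(2)[of k] r(2)[of k] by (auto simp: c_def intro: holomorphic_on_subset subset_ball)
  have ceq: "\<forall>\<^sub>F s in nhds 0. \<forall>k\<in>{..n}. of_real (C k (y s)) = c k (of_real s)"
    using f(2) by (intro eventually_ball_finite) (auto simp: c_def)
  define \<Phi> where "\<Phi> w t = (\<Sum>k\<le>n. c k w * t ^ k)" for w t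
  have \<Phi>: "\<forall>\<^sub>F s in nhds 0. \<forall>x. quot x = y s \<longrightarrow> (\<forall>t. \<Phi> (of_real s) (of_real t) = of_real (poly (orbit_poly l x) t))"
    using ceq
  proof eventually_elim
    case (elim s)
    show ?case
    proof (intro allI impI)
      fix x t assume x: "quot x = y s"
      have "\<Phi> (of_real s) (of_real t) = (\<Sum>k\<le>n. of_real (C k (y s)) * of_real t ^ k)"
        unfolding \<Phi>_def using elim by (intro sum.cong) auto
      also have "\<dots> = of_real (\<Sum>k\<le>n. coeff (orbit_poly l x) k * t ^ k)" by (simp add: C(2) x)
      also have "\<dots> = of_real (poly (orbit_poly l x) t)"
        using poly_eq_sum_upto[OF degree_orbit_poly, of l x t] by (simp add: n_def)
      finally show "\<Phi> (of_real s) (of_real t) = of_real (poly (orbit_poly l x) t)" .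
    qed
  qed
  have c0: "c k 0 = of_real (coeff (orbit_poly l x0) k)" if "k \<le> n" for k
    using eventually_nhds_x_imp_x[OF ceq] that by (simp add: C(2) x0(2))
  have root0: "\<Phi> 0 0 = 0"
  proof -
    have "\<Phi> 0 0 = of_real (poly (orbit_poly l x0) 0)"
      using eventually_nhds_x_imp_x[OF \<Phi>] x0(2) by (metis of_real_0)
    also have "poly (orbit_poly l x0) 0 = 0"
      unfolding poly_orbit_poly by (rule prod_zero[OF fin]) (use one_in ac_one l0 in \<open>auto intro!: bexI[of _ eG]\<close>)
    finally show ?thesis by simp
  qed
  have simple: "(\<Sum>k\<le>n. c k 0 * (of_nat k * 0 ^ (k - 1))) \<noteq> 0"
  proof -
    have "(\<Sum>k\<le>n. c k 0 * (of_nat k * 0 ^ (k - 1))) =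
        of_real (\<Sum>k\<le>n. coeff (orbit_poly l x0) k * (of_nat k * 0 ^ (k - 1)))"
      unfolding of_real_sum by (intro sum.cong) (auto simp: c0)
    also have "\<dots> = of_real (poly (pderiv (orbit_poly l x0)) 0)"
      using poly_pderiv_eq_sum_upto[OF degree_orbit_poly, of l x0 0] by (simp add: n_def)
    also have "\<dots> = of_real d0" using pderiv_orbit_poly[of l x0] by (simp add: l0 d0_def)
    finally show ?thesis using d0 by simp
  qed
  have "0 \<in> ball (0::complex) r" using r(1) by simp
  from holomorphic_simple_root[OF \<Phi>_def open_ball this c root0 simple zero_less_one]
  obtain \<rho> \<delta> \<tau>c where \<tau>c: "0 < \<rho>" "0 < \<delta>" "\<tau>c holomorphic_on ball 0 \<delta>" "\<tau>c 0 = 0"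
    "\<And>w t. w \<in> ball 0 \<delta> \<Longrightarrow> t \<in> ball 0 \<rho> \<Longrightarrow> \<Phi> w t = 0 \<longleftrightarrow> t = \<tau>c w" by blast
  define \<tau> where "\<tau> s = Re (\<tau>c (of_real s))" for s
  have "\<tau>c analytic_on {0}" using \<tau>c(2,3) by (auto simp: analytic_at_ball)
  then have \<tau>: "analytic_germ \<tau>" unfolding \<tau>_def[abs_def] by (rule analytic_germ_Re)
  have \<tau>0: "\<tau> 0 = 0" by (simp add: \<tau>_def \<tau>c(4))
  \<comment> \<open>For small negative parameters some point of the fibre is close to \<open>x0\<close>.\<close>
  have near: "\<forall>\<^sub>F s in nhds 0. \<bar>C 0 (y s)\<bar> < \<rho> ^ n"
  proof -
    have "C 0 (y 0) = poly (orbit_poly l x0) 0" using C(2)[of x0 0] x0(2) by (simp add: poly_0_coeff_0)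
    also have "\<dots> = 0"
      unfolding poly_orbit_poly by (rule prod_zero[OF fin]) (use one_in ac_one l0 in \<open>auto intro!: bexI[of _ eG]\<close>)
    finally have "C 0 (y 0) = 0" .
    moreover have "isCont (\<lambda>s. C 0 (y s)) 0" by (rule analytic_germ_isCont[OF analytic_germ_poly[OF C(1) y]])
    ultimately have "((\<lambda>s. C 0 (y s)) \<longlongrightarrow> 0) (nhds 0)" by (simp add: isCont_def tendsto_nhds_iff)
    from tendstoD[OF this, of "\<rho> ^ n"] \<tau>c(1) show ?thesis by simp
  qed
  have small: "\<forall>\<^sub>F s::real in nhds 0. of_real s \<in> ball (0::complex) \<delta>"
    unfolding eventually_nhds_metric using \<tau>c(2) by (auto simp: dist_norm)
  have lifted: "\<forall>\<^sub>F s in at_left 0. \<exists>x\<in>B. quot x = y s \<and> l x = \<tau> s"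
    using left eventually_nhds_imp_at_left[OF near] eventually_nhds_imp_at_left[OF small]
      eventually_nhds_imp_at_left[OF \<Phi>]
  proof eventually_elim
    case (elim s)
    obtain x where x: "x \<in> B" "quot x = y s" using elim(1) by auto
    \<comment> \<open>The product of the values of \<open>l\<close> over the orbit tends to 0, so one of them is
      small.\<close>
    have "\<exists>g\<in>carrier G. l (ac g x) < \<rho>"
    proof (rule ccontr)
      assume "\<not> ?thesis"
      then have "(\<Prod>g\<in>carrier G. \<rho>) \<le> (\<Prod>g\<in>carrier G. l (ac g x))"
        using \<tau>c(1) by (intro prod_mono) (auto simp: not_less)
      also have "\<dots> = \<bar>\<Prod>g\<in>carrier G. 0 - l (ac g x)\<bar>"
        by (simp add: abs_prod l_def sq_dist_nonneg)
      also have "\<dots> = \<bar>C 0 (y s)\<bar>"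
        using poly_orbit_poly[of l x 0] C(2)[of x 0] x(2) by (simp add: poly_0_coeff_0)
      finally show False using elim(2) by (simp add: n_def)
    qed
    then obtain g where g: "g \<in> carrier G" "l (ac g x) < \<rho>" by blast
    define x' where "x' = ac g x"
    have x': "x' \<in> B" "quot x' = y s" "l x' < \<rho>"
      using x g B(1) by (auto simp: x'_def stable_def quot_invariant)
    have "poly (orbit_poly l x') (l x') = 0"
      unfolding poly_orbit_poly by (rule prod_zero[OF fin]) (use one_in ac_one in \<open>auto intro!: bexI[of _ eG]\<close>)
    then have "\<Phi> (of_real s) (of_real (l x')) = 0" using elim(4) x'(2) by simp
    moreover have "of_real (l x') \<in> ball (0::complex) \<rho>" using x'(3) by (simp add: l_def sq_dist_nonneg)
    ultimately have "of_real (l x') = \<tau>c (of_real s)" using \<tau>c(5) elim(3) by blast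
    then have "l x' = \<tau> s" by (metis Re_complex_of_real \<tau>_def)
    then show ?case using x' by blast
  qed
  \<comment> \<open>The point is recovered from its image and from the root by Lagrange interpolation.\<close>
  have "\<forall>q. \<exists>P. real_polynomial_function q \<longrightarrow>
      (\<forall>k. real_polynomial_function (P k) \<and> (\<forall>x. coeff (lagrange l q x) k = P k (quot x)))"
    using lagrange_coeffs[OF l] by blast
  then obtain E where E: "\<And>q k. real_polynomial_function q \<Longrightarrow> real_polynomial_function (E q k)"
    "\<And>q k x. real_polynomial_function q \<Longrightarrow> coeff (lagrange l q x) k = E q k (quot x)" by metis
  define L where "L q s = (\<Sum>k\<le>n. E q k (y s) * \<tau> s ^ k)" for q s
  have Lgerm: "analytic_germ (L q)" if "real_polynomial_function q" for q
    unfolding L_def[abs_def]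
    by (intro analytic_germ_sum analytic_germ_mult analytic_germ_power \<tau> analytic_germ_poly[OF E(1)[OF that] y])
  have Leq: "L q s = poly (lagrange l q x) (\<tau> s)" if "real_polynomial_function q" "quot x = y s" for q s x
    using poly_eq_sum_upto[OF degree_lagrange, of l q x "\<tau> s"] that by (simp add: L_def E(2) n_def)
  have one: "real_polynomial_function (\<lambda>x::real^'d. 1)" by (rule real_polynomial_function_const)
  have L1: "L (\<lambda>x. 1) 0 \<noteq> 0"
    using Leq[OF one x0(2)] poly_lagrange[of l "\<lambda>x. 1" x0] d0 by (simp add: \<tau>0 l0 d0_def)
  define \<alpha> :: "real \<Rightarrow> real^'d" where "\<alpha> s = (\<chi> i. L (\<lambda>x. x $ i) s / L (\<lambda>x. 1) s)" for s
  have "analytic_curve \<alpha>" unfolding analytic_curve_def \<alpha>_def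
    using analytic_germ_divide[OF Lgerm[OF real_polynomial_function_nth] Lgerm[OF one] L1] by simp
  moreover have "\<forall>\<^sub>F s in nhds 0. L (\<lambda>x. 1) s \<noteq> 0"
    by (rule isCont_eventually_nonzero[OF analytic_germ_isCont[OF Lgerm[OF one]] L1])
  from lifted eventually_nhds_imp_at_left[OF this]
  have "\<forall>\<^sub>F s in at_left 0. \<alpha> s \<in> B \<and> quot (\<alpha> s) = y s"
  proof eventually_elim
    case (elim s)
    obtain x where x: "x \<in> B" "quot x = y s" "l x = \<tau> s" using elim(1) by blast
    have Lx: "L q s = q x * (\<Prod>k\<in>carrier G - {eG}. l x - l (ac k x))" if "real_polynomial_function q" for q
      using Leq[OF that x(2)] poly_lagrange[of l q x] x(3) by simp
    have "\<alpha> s = x"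
      using elim(2) Lx[OF one] Lx[OF real_polynomial_function_nth] by (simp add: \<alpha>_def vec_eq_iff)
    then show ?case using x by simp
  qed
  ultimately show ?thesis by blast
qed

text \<open>
  By compactness a curve in the image starts at the image of a point of \<open>B\<close>, so it
  can be lifted. The lift stays in \<open>B\<close>, and that it is a lift persists by the
  identity theorem.
\<close>

theorem loc_arc_sym_quot_image:
  assumes B: "loc_arc_sym B" "bounded B" "stable B" "free B"
  shows "loc_arc_sym (quot ` B)" "bounded (quot ` B)"
proof -
  have cpt: "compact B" using B loc_arc_sym_closed compact_eq_bounded_closed by blast
  have "continuous_on B quot"
    by (rule continuous_on_polymonial_function[OF polynomial_function_vec_nth[OF quot_poly]])
  then have cpt2: "compact (quot ` B)" using cpt by (rule compact_continuous_image)
  then show "bounded (quot ` B)" by (rule compact_imp_bounded)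
  have "\<forall>\<^sub>F s in nhds 0. y s \<in> quot ` B"
    if y: "analytic_curve y" and left: "\<forall>\<^sub>F s in at_left 0. y s \<in> quot ` B" for y
  proof -
    have "(y \<longlongrightarrow> y 0) (at_left 0)"
    proof (rule vec_tendstoI)
      fix i
      have "isCont (\<lambda>s. y s $ i) 0" using y by (intro analytic_germ_isCont) (simp add: analytic_curve_def)
      then show "((\<lambda>s. y s $ i) \<longlongrightarrow> y 0 $ i) (at_left 0)"
        unfolding isCont_def by (rule tendsto_mono[rotated]) (simp add: at_within_le_at)
    qed
    then have "y 0 \<in> quot ` B"
      using left by (intro Lim_in_closed_set[OF compact_imp_closed[OF cpt2]]) auto
    then obtain x0 where "x0 \<in> B" "quot x0 = y 0" by auto
    from local_lift[OF B(3,4) this y left] obtain \<alpha> where \<alpha>: "analytic_curve \<alpha>"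
      and l: "\<forall>\<^sub>F s in at_left 0. \<alpha> s \<in> B \<and> quot (\<alpha> s) = y s" by blast
    have "\<forall>\<^sub>F s in at_left 0. \<alpha> s \<in> B" using l by eventually_elim simp
    then have inB: "\<forall>\<^sub>F s in nhds 0. \<alpha> s \<in> B" using B(1) \<alpha> by (auto simp: loc_arc_sym_def arc_closed_def)
    have "\<forall>\<^sub>F s in nhds 0. \<forall>i\<in>UNIV. p i (\<alpha> s) + -1 * y s $ i = 0"
    proof (intro eventually_ball_finite ballI)
      fix i
      show "\<forall>\<^sub>F s in nhds 0. p i (\<alpha> s) + -1 * y s $ i = 0"
      proof (rule analytic_germ_identity)
        show "analytic_germ (\<lambda>s. p i (\<alpha> s) + -1 * y s $ i)"
          using y by (intro analytic_germ_add analytic_germ_mult analytic_germ_const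
              analytic_germ_poly[OF p_invariant(1) \<alpha>]) (simp add: analytic_curve_def)
        show "\<forall>\<^sub>F s in at_left 0. p i (\<alpha> s) + -1 * y s $ i = 0"
          using l by eventually_elim (auto simp: quot_def vec_eq_iff)
      qed
    qed simp
    with inB show ?thesis
    proof eventually_elim
      case (elim s)
      have "y s = quot (\<alpha> s)" using elim(2) by (simp add: quot_def vec_eq_iff)
      then show ?case using elim(1) by blast
    qed
  qed
  then show "loc_arc_sym (quot ` B)"
    using B(1) semialgebraic_image[OF _ quot_poly, of B] by (simp add: loc_arc_sym_def arc_closed_def)
qed

text \<open>The fibres of \<open>quot\<close> are orbits, and a stable set is a union of orbits.\<close>

lemma quot_image_Diff:
  assumes "stable B" shows "quot ` (A - B) = quot ` A - quot ` B"
proof (intro subset_antisym subsetI)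
  fix y assume "y \<in> quot ` (A - B)"
  then obtain x where x: "x \<in> A" "x \<notin> B" "y = quot x" by blast
  have "y \<notin> quot ` B"
  proof
    assume "y \<in> quot ` B"
    then obtain b where "b \<in> B" "quot b = quot x" using x by auto
    then obtain g where "g \<in> carrier G" "ac g b = x" using quot_eq_imp_orbit by blast
    with assms \<open>b \<in> B\<close> x show False by (auto simp: stable_def)
  qed
  with x show "y \<in> quot ` A - quot ` B" by blast
qed blast

lemma loc_arc_sym_translate: "loc_arc_sym A \<Longrightarrow> loc_arc_sym {x. ac g x \<in> A}"
  by (rule loc_arc_sym_vimage[OF ac_poly])

section \<open>Quotients of AS-sets\<close>

text \<open>
  The fixed points of nontrivial elements form a closed set, which meets the Zariski closure in
  a compact set. The AS-closure avoids it and is an intersection of closed sets, so a finite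
  subintersection avoids it. Intersecting all translates makes this hull stable.
\<close>

lemma exists_free_hull:
  assumes X: "stable X" and Z: "compact (zariski_closure X)"
    and fr: "free_on G ac {x. affine_embed x \<in> AS_closure (affine_embed ` X)}"
  shows "\<exists>C. loc_arc_sym C \<and> bounded C \<and> stable C \<and> free C \<and> X \<subseteq> C"
proof -
  define Fx where "Fx = (\<Union>g\<in>carrier G - {eG}. {x. (\<Sum>i\<in>UNIV. (ac g x $ i - x $ i) ^ 2) = 0})"
  have Fx: "x \<in> Fx \<longleftrightarrow> (\<exists>g\<in>carrier G. g \<noteq> eG \<and> ac g x = x)" for x
    by (auto simp: Fx_def sum_nonneg_eq_0_iff vec_eq_iff)
  have "closed Fx" unfolding Fx_def
  proof (intro closed_UN ballI)
    show "finite (carrier G - {eG})" using fin by simp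
    show "closed {x. (\<Sum>i\<in>UNIV. (ac g x $ i - x $ i) ^ 2) = 0}" for g
      by (intro loc_arc_sym_closed loc_arc_sym_zero real_polynomial_function_sum
          real_polynomial_function_power real_polynomial_function_diff ac_poly real_polynomial_function_nth) simp
  qed
  with Z have cpt: "compact (zariski_closure X \<inter> Fx)" by (rule compact_Int_closed)
  define \<H> where "\<H> = {{x. affine_embed x \<in> A} | A. arc_symmetric A \<and> affine_embed ` X \<subseteq> A}"
  have \<H>: "loc_arc_sym H \<and> X \<subseteq> H" if "H \<in> \<H>" for H
    using that loc_arc_sym_affine_part by (auto simp: \<H>_def)
  have "\<Inter>\<H> = {x. affine_embed x \<in> AS_closure (affine_embed ` X)}"
    by (auto simp: \<H>_def AS_closure_def hull_def)
  moreover have "x \<notin> Fx" if "affine_embed x \<in> AS_closure (affine_embed ` X)" for x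
    using fr that unfolding free_on_def Fx by (auto simp: stabilizer_def)
  ultimately have empty: "(zariski_closure X \<inter> Fx) \<inter> \<Inter>\<H> = {}" by blast
  have "\<exists>\<H>'\<subseteq>\<H>. finite \<H>' \<and> (zariski_closure X \<inter> Fx) \<inter> \<Inter>\<H>' = {}"
  proof (rule ccontr)
    assume neg: "\<not> ?thesis"
    have "(zariski_closure X \<inter> Fx) \<inter> \<Inter>\<H> \<noteq> {}"
      by (rule compact_imp_fip[OF cpt]) (use neg \<H> loc_arc_sym_closed in auto)
    with empty show False by simp
  qed
  then obtain \<H>' where \<H>': "\<H>' \<subseteq> \<H>" "finite \<H>'" "(zariski_closure X \<inter> Fx) \<inter> \<Inter>\<H>' = {}" by blast
  define C1 where "C1 = zariski_closure X \<inter> (\<Inter>H\<in>\<H>'. H)"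
  obtain f where "real_polynomial_function f" "zariski_closure X = {x. f x = 0}"
    using zariski_closure_one_equation by blast
  then have "loc_arc_sym (zariski_closure X)" using loc_arc_sym_zero by metis
  then have C1: "loc_arc_sym C1" unfolding C1_def
    using \<H> \<H>' by (intro loc_arc_sym_Int loc_arc_sym_INTER) auto
  define C where "C = (\<Inter>g\<in>carrier G. {x. ac g x \<in> C1})"
  have "loc_arc_sym C" unfolding C_def by (intro loc_arc_sym_INTER fin loc_arc_sym_translate C1)
  moreover have sub: "C \<subseteq> C1" using one_in ac_one by (force simp: C_def)
  moreover have "bounded C1" using Z compact_imp_bounded by (auto simp: C1_def intro: bounded_subset)
  then have "bounded C" using sub bounded_subset by blast
  moreover have "stable C" unfolding stable_def C_def by (auto simp: ac_mult mult_in)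
  moreover have "free C" using sub \<H>'(3) Fx unfolding free_def C1_def by blast
  moreover have "X \<subseteq> C1" unfolding C1_def using \<H> \<H>'(1) by (auto simp: zariski_closure_def)
  then have "X \<subseteq> C" using X by (auto simp: C_def stable_def)
  ultimately show ?thesis by blast
qed

text \<open>
  \<open>X\<close> is cut into pieces according to the type of a point, which records for all
  its translates in which of the finitely many sets of \<open>\<A>\<close> they lie. For a type
  \<open>S\<close>, the set \<open>E S\<close> consists of the orbits of points of
  \<open>C\<close> having at least type \<open>S\<close>. Types of points in one orbit have the
  same size, so a point of \<open>E S\<close> outside every \<open>E T\<close> with \<open>card
  S < card T\<close> has a translate of type exactly \<open>S\<close>. In this description of
  \<open>X\<close> only stable sets are subtracted, so it is preserved by \<open>quot\<close>.
\<close>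

theorem AS_set_affine_quot:
  assumes X: "AS_set_affine X" "stable X" and Z: "compact (zariski_closure X)"
    and fr: "free_on G ac {x. affine_embed x \<in> AS_closure (affine_embed ` X)}"
  shows "AS_set_affine (quot ` X)"
proof -
  obtain C where C: "loc_arc_sym C" "bounded C" "stable C" "free C" "X \<subseteq> C"
    using exists_free_hull[OF X(2) Z fr] by blast
  have "{x. affine_embed x \<in> affine_embed ` X} = X" using inj_affine_embed by (auto simp: inj_def)
  then have "X \<in> boolean_combinations (Collect loc_arc_sym)"
    using boolean_combinations_affine_part[of "affine_embed ` X"] X(1)
    by (simp add: AS_set_affine_def AS_set_def)
  from boolean_combinations_determined[OF this] obtain \<A> where \<A>: "\<A> \<subseteq> Collect loc_arc_sym" "finite \<A>"
    "\<And>x y. (\<forall>A\<in>\<A>. x \<in> A \<longleftrightarrow> y \<in> A) \<Longrightarrow> x \<in> X \<longleftrightarrow> y \<in> X" by blast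
  define U where "U = \<A> \<times> carrier G"
  have finU: "finite U" using \<A>(2) fin by (simp add: U_def)
  define type where "type x = {(A, g) \<in> U. ac g x \<in> A}" for x
  have finT: "finite (type x)" "type x \<subseteq> U" for x using finU by (auto simp: type_def intro: finite_subset)
  have typeX: "x \<in> X \<longleftrightarrow> y \<in> X" if "type x = type y" for x y
  proof (rule \<A>(3), rule ballI)
    fix A assume "A \<in> \<A>"
    then have "(A, eG) \<in> U" using one_in by (simp add: U_def)
    moreover have "(A, eG) \<in> type x \<longleftrightarrow> (A, eG) \<in> type y" using that by simp
    ultimately show "x \<in> A \<longleftrightarrow> y \<in> A" using ac_one by (simp add: type_def)
  qed
  have card_le: "card (type (ac h x)) \<le> card (type x)" if h: "h \<in> carrier G" for h x
  proof (rule card_inj_on_le[OF _ _ finT(1)])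
    show "inj_on (\<lambda>(A, g). (A, g \<otimes>\<^bsub>G\<^esub> h)) (type (ac h x))"
      using bij_betw_imp_inj_on[OF bij_right_mult[OF h]] by (auto simp: inj_on_def type_def U_def)
    show "(\<lambda>(A, g). (A, g \<otimes>\<^bsub>G\<^esub> h)) ` type (ac h x) \<subseteq> type x"
      using h by (auto simp: type_def U_def ac_mult mult_in)
  qed
  define D where "D S = C \<inter> (\<Inter>(A, g)\<in>S. {x. ac g x \<in> A})" for S
  define E where "E S = (\<Union>h\<in>carrier G. {x. ac h x \<in> D S})" for S
  have D: "loc_arc_sym (D S)" if "S \<subseteq> U" for S
  proof -
    have "finite S" using that finU by (rule finite_subset)
    then have "loc_arc_sym (\<Inter>t\<in>S. {x. ac (snd t) x \<in> fst t})"
      using that \<A>(1) by (intro loc_arc_sym_INTER loc_arc_sym_translate) (auto simp: U_def)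
    then show ?thesis unfolding D_def using C(1) by (simp add: case_prod_unfold loc_arc_sym_Int)
  qed
  have E: "loc_arc_sym (E S)" if "S \<subseteq> U" for S
    unfolding E_def by (intro loc_arc_sym_UNION fin loc_arc_sym_translate D that)
  have EC: "E S \<subseteq> C" for S
  proof
    fix x assume "x \<in> E S"
    then obtain h where h: "h \<in> carrier G" "ac h x \<in> C" by (auto simp: E_def D_def)
    obtain k where "k \<in> carrier G" "ac k (ac h x) = x" using inverse_action[OF h(1)] by blast
    then show "x \<in> C" using C(3) h(2) by (metis stable_def)
  qed
  have Estable: "stable (E S)" for S
    unfolding stable_def
  proof (intro ballI)
    fix g x assume g: "g \<in> carrier G" and "x \<in> E S"
    then obtain h where h: "h \<in> carrier G" "ac h x \<in> D S" by (auto simp: E_def)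
    obtain k where k: "k \<in> carrier G" "ac k (ac g x) = x" using inverse_action[OF g] by blast
    have "ac (h \<otimes>\<^bsub>G\<^esub> k) (ac g x) = ac h x" using h k by (simp flip: ac_mult)
    then have "ac (h \<otimes>\<^bsub>G\<^esub> k) (ac g x) \<in> D S" using h(2) by simp
    then show "ac g x \<in> E S" unfolding E_def using h k mult_in[of h k] by blast
  qed
  have Efree: "free (E S)" for S using C(4) EC by (auto simp: free_def)
  have AS: "arc_symmetric (affine_embed ` quot ` E S)" if "S \<subseteq> U" for S
    using loc_arc_sym_quot_image[OF E[OF that] bounded_subset[OF C(2) EC] Estable Efree]
    by (intro arc_symmetric_affine_embed)
  have memD: "x \<in> D S \<longleftrightarrow> x \<in> C \<and> S \<subseteq> type x" if "S \<subseteq> U" for x S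
    using that by (auto simp: D_def type_def)
  define larger where "larger S = {T \<in> Pow U. card S < card T}" for S :: "((real^'d) set \<times> 'g) set"
  have fin_larger: "finite (larger S)" for S using finU by (simp add: larger_def)
  have X_eq: "X = (\<Union>S\<in>type ` X. E S - (\<Union>T\<in>larger S. E T))"
  proof (intro subset_antisym subsetI)
    fix x assume x: "x \<in> X"
    have "x \<in> D (type x)" using memD[OF finT(2)] x C(5) by blast
    then have "x \<in> E (type x)" using one_in ac_one[of x] unfolding E_def by (intro UN_I[of eG]) auto
    moreover have "x \<notin> E T" if "T \<in> larger (type x)" for T
    proof
      assume "x \<in> E T"
      then obtain h where h: "h \<in> carrier G" "ac h x \<in> D T" by (auto simp: E_def)
      have T: "T \<subseteq> U" "card (type x) < card T" using that by (auto simp: larger_def)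
      have "card T \<le> card (type (ac h x))" using h(2) memD[OF T(1)] finT(1) by (intro card_mono) auto
      then show False using card_le[OF h(1), of x] T(2) by linarith
    qed
    ultimately show "x \<in> (\<Union>S\<in>type ` X. E S - (\<Union>T\<in>larger S. E T))" using x by blast
  next
    fix x assume "x \<in> (\<Union>S\<in>type ` X. E S - (\<Union>T\<in>larger S. E T))"
    then obtain x1 where x1: "x1 \<in> X" "x \<in> E (type x1)" "\<And>T. T \<in> larger (type x1) \<Longrightarrow> x \<notin> E T" by blast
    obtain h where h: "h \<in> carrier G" "ac h x \<in> D (type x1)" using x1(2) by (auto simp: E_def)
    have sub: "type x1 \<subseteq> type (ac h x)" and "ac h x \<in> C" using h(2) memD[OF finT(2)] by auto
    then have "ac h x \<in> D (type (ac h x))" using memD[OF finT(2)] by blast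
    then have "x \<in> E (type (ac h x))" using h(1) by (auto simp: E_def)
    then have "\<not> card (type x1) < card (type (ac h x))" using x1(3)[of "type (ac h x)"] finT(2) by (auto simp: larger_def)
    then have "type x1 = type (ac h x)" using sub finT(1) by (metis card_seteq linorder_not_less)
    then have "ac h x \<in> X" using typeX x1(1) by blast
    moreover obtain k where "k \<in> carrier G" "ac k (ac h x) = x" using inverse_action[OF h(1)] by blast
    ultimately show "x \<in> X" using X(2) by (metis stable_def)
  qed
  have stU: "stable (\<Union>T\<in>larger S. E T)" for S using Estable unfolding stable_def by blast
  have empty: "({} :: 'm option projective_space set) \<in> Collect arc_symmetric"
    using arc_symmetric_affine_embed[OF loc_arc_sym_empty bounded_empty] by simp
  have "affine_embed ` quot ` X =
      (\<Union>S\<in>type ` X. affine_embed ` quot ` E S - (\<Union>T\<in>larger S. affine_embed ` quot ` E T))"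
  proof -
    have "quot ` X = (\<Union>S\<in>type ` X. quot ` (E S - (\<Union>T\<in>larger S. E T)))"
      by (subst X_eq) (simp only: image_UN)
    also have "\<dots> = (\<Union>S\<in>type ` X. quot ` E S - (\<Union>T\<in>larger S. quot ` E T))"
      by (simp only: quot_image_Diff[OF stU] image_UN)
    finally show ?thesis by (simp only: image_UN image_set_diff[OF inj_affine_embed])
  qed
  moreover have "\<dots> \<in> boolean_combinations (Collect arc_symmetric)"
  proof (rule boolean_combinations_UNION[OF empty])
    show "finite (type ` X)" using finT(2) finU by (auto intro!: finite_subset[of "type ` X" "Pow U"])
    fix S assume "S \<in> type ` X"
    then have "S \<subseteq> U" using finT(2) by auto
    show "affine_embed ` quot ` E S - (\<Union>T\<in>larger S. affine_embed ` quot ` E T)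
        \<in> boolean_combinations (Collect arc_symmetric)"
    proof (rule boolean_combinations_Diff)
      show "affine_embed ` quot ` E S \<in> boolean_combinations (Collect arc_symmetric)"
        using AS[OF \<open>S \<subseteq> U\<close>] by (simp add: boolean_combinations.base)
      show "(\<Union>T\<in>larger S. affine_embed ` quot ` E T) \<in> boolean_combinations (Collect arc_symmetric)"
      proof (rule boolean_combinations_UNION[OF empty fin_larger])
        fix T assume "T \<in> larger S"
        then have "T \<subseteq> U" by (simp add: larger_def)
        from AS[OF this] show "affine_embed ` quot ` E T \<in> boolean_combinations (Collect arc_symmetric)"
          by (simp add: boolean_combinations.base)
      qed
    qed
  qed
  ultimately show ?thesis unfolding AS_set_affine_def AS_set_def by (simp only:)
qed

end

theorem corollary3p11:
  fixes G :: "('g, 'b) monoid_scheme"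
    and \<sigma> :: "'g \<Rightarrow> 'd::finite \<Rightarrow> 'd"
    and X :: "(real^'d) set"
    and p :: "'m::finite \<Rightarrow> real^'d \<Rightarrow> real"
  assumes "group G"
    and "finite (carrier G)"
    and "group_action G UNIV \<sigma>"
    and "AS_set_affine X"
    and "\<forall>g\<in>carrier G. perm_action G \<sigma> g ` X = X"
    and "compact (zariski_closure X)"
    and "generated_subalgebra (range p) = invariant_polynomials G (perm_action G \<sigma>)"
    and "free_on G (perm_action G \<sigma>) {x. affine_embed x \<in> AS_closure (affine_embed ` X)}"
  shows "AS_set_affine ((\<lambda>x. \<chi> i. p i x) ` X)"
proof -
  interpret permutation_quotient G \<sigma> p
    by (rule permutation_quotient.intro) (fact assms)+
  have "stable X" using assms(5) unfolding stable_def by blast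
  from AS_set_affine_quot[OF assms(4) this assms(6) assms(8)]
  show ?thesis by (simp only: quot_def[abs_def])
qed

end
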